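(* Let $M$ be a compact oriented $m$-dimensional manifold with boundary, $E\to M$ a vector bundle, $0\le k\le m$, and $V=\Omega^k(M,E)$. The two choices $V^\star$ and $V^\dagger$ of the restricted dual of $V$ are equivalent via the mutually inverse isomorphisms $$V^\star\to V^\dagger,\quad(\alpha,\alpha_\partial)\mapsto\left(\Phi_E(\alpha),\Phi_{E,\partial}(\alpha_\partial)\right),\qquad V^\dagger\to V^\star,\quad(\beta,\beta_\partial)\mapsto\left(\Phi_E^{-1}(\beta),\Phi_{E,\partial}^{-1}(\beta_\partial)\right).$$ Moreover, $\Psi_\dagger\circ(\Phi_E,\Phi_{E,\partial})=\Psi_\star$ and $\Psi_\star\circ(\Phi_E^{-1},\Phi_{E,\partial}^{-1})=\Psi_\dagger$.
   Context: All manifolds and maps are smooth. $M$ is a compact oriented $m$-dimensional manifold with boundary $\partial M$ (with the induced orientation), $\iota:\partial M\to M$ is the inclusion, $E\to M$ is a finite-rank real vector bundle with dual $E^*$ (restrictions to $\partial M$ are denoted by the same symbols). $\Lambda_r^s(M,E^* )=\Gamma(\bigwedge^sTM\otimes\bigwedge^rT^*M\otimes E^* )$, and $\Lambda_r^s(\partial M,E^* )$ is defined in the same way on $\partial M$. Contraction: for $\chi=U\otimes\mu\otimes\eta\in\Lambda_r^k(M,E^* )$ and $\varphi=\omega\otimes\xi\in\Omega^k(M,E)$, $\chi\cdot\varphi=\omega(U)\,(\eta\cdot\xi)\,\mu\in\Omega^r(M)$, where $\omega(U)=\omega(U_1,\dots,U_k)$ for $U=U_1\wedge\dots\wedge U_k$.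 Wedge: for $\alpha=\theta\otimes\eta\in\Omega^l(M,E^* )$, $\varphi\wedge\alpha=(\omega\wedge\theta)(\eta\cdot\xi)\in\Omega^{k+l}(M)$. The same operations are used on $\partial M$. $V=\Omega^k(M,E)$ is a Fréchet space with topological dual $V'$. The restricted duals are - $V^\star=\Lambda_m^k(M,E^* )\times\Lambda_{m-1}^k(\partial M,E^* )$ with pairing $\langle(\alpha,\alpha_\partial),\varphi\rangle_\star=\int_M\alpha\cdot\varphi+\int_{\partial M}\alpha_\partial\cdot\iota^*\varphi$; - $V^\dagger=\Omega^{m-k}(M,E^* )\times\Omega^{m-k-1}(\partial M,E^* )$ with pairing $\langle(\alpha,\alpha_\partial),\varphi\rangle_\dagger=\int_M\varphi\wedge\alpha+\int_{\partial M}\iota^*\varphi\wedge\alpha_\partial$. $\Psi_\star:V^\star\to V'$ and $\Psi_\dagger:V^\dagger\to V'$ are the injections $\Psi_\star(\alpha,\alpha_\partial)(\varphi)=\langle(\alpha,\alpha_\partial),\varphi\rangle_\star$, $\Psi_\dagger(\beta,\beta_\partial)(\varphi)=\langle(\beta,\beta_\partial),\varphi\rangle_\dagger$. For $U=U_1\wedge\dots\wedge U_k\in\bigwedge^kT_xM$ and $\mu\in\bigwedge^mT^*_xM$, $(i_U\mu)(u_1,\dots,u_{m-k})=\mu(U_1,\dots,U_k,u_1,\dots,u_{m-k})$. $\Phi_E:\bigwedge^kTM\otimes\bigwedge^mT^*M\otimes E^*\to\bigwedge^{m-k}T^*M\otimes E^*$ is the vector bundle isomorphism $U\otimes\mu\otimes\eta\mapsto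 i_U\mu\otimes\eta$, and $\Phi_{E,\partial}:\bigwedge^kT\partial M\otimes\bigwedge^{m-1}T^*\partial M\otimes E^*\to\bigwedge^{m-k-1}T^*\partial M\otimes E^*$ is its analogue $U_\partial\otimes\mu_\partial\otimes\eta\mapsto i_{U_\partial}\mu_\partial\otimes\eta$ on $\partial M$; both act on sections. *)

theory Defs
  imports
    "HOL-Analysis.Analysis"
    "HOL-Library.Function_Algebras"
    "HOL-Combinatorics.Combinatorics"
begin

section \<open>Linear algebra\<close>

text \<open>Spaces of forms, functionals and sections are linear subspaces of function types, with
  pointwise operations (addition comes from \<^theory>\<open>HOL-Library.Function_Algebras\<close>).\<close>

instantiation "fun" :: (type, real_vector) real_vector
begin

definition scaleR_fun :: "real \<Rightarrow> ('a \<Rightarrow> 'b) \<Rightarrow> 'a \<Rightarrow> 'b"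
  where "scaleR_fun c f = (\<lambda>x. c *\<^sub>R f x)"

instance
  by standard (auto simp: scaleR_fun_def fun_eq_iff scaleR_add_right scaleR_add_left)

end

definition linear_on :: "'v::real_vector set \<Rightarrow> ('v \<Rightarrow> 'w::real_vector) \<Rightarrow> bool"
  where "linear_on S f \<longleftrightarrow>
    (\<forall>x\<in>S. \<forall>y\<in>S. \<forall>a b. f (a *\<^sub>R x + b *\<^sub>R y) = a *\<^sub>R f x + b *\<^sub>R f y)"

definition bilinear_on ::
    "'u::real_vector set \<Rightarrow> 'v::real_vector set \<Rightarrow> ('u \<Rightarrow> 'v \<Rightarrow> 'w::real_vector) \<Rightarrow> bool"
  where "bilinear_on S T f \<longleftrightarrow>
    (\<forall>y\<in>T. linear_on S (\<lambda>x. f x y)) \<and> (\<forall>x\<in>S. linear_on T (f x))"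

text \<open>Functionals on a subspace and alternating maps take the value 0 outside their domain, so
  that equality of functions is equality on the domain.\<close>

definition dual_sp :: "'v::real_vector set \<Rightarrow> ('v \<Rightarrow> real) set"
  where "dual_sp S = {l. linear_on S l \<and> (\<forall>v. v \<notin> S \<longrightarrow> l v = 0)}"

text \<open>Alternating \<open>r\<close>-linear maps from \<open>S\<close> to \<open>W\<close>, the argument tuples being lists of length
  \<open>r\<close>.  The degree is an integer; for \<open>r < 0\<close> the space is zero.\<close>

definition alt_maps ::
    "'v::real_vector set \<Rightarrow> int \<Rightarrow> 'w::real_vector set \<Rightarrow> ('v list \<Rightarrow> 'w) set"
  where "alt_maps S r W = {f.
    (\<forall>vs. if set vs \<subseteq> S \<and> int (length vs) = r then f vs \<in> W else f vs = 0) \<and>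
    (\<forall>us vs. set us \<subseteq> S \<and> set vs \<subseteq> S \<and> int (length us) + 1 + int (length vs) = r \<longrightarrow>
       linear_on S (\<lambda>v. f (us @ v # vs))) \<and>
    (\<forall>vs. \<not> distinct vs \<longrightarrow> f vs = 0)}"

text \<open>For finite-dimensional \<open>S\<close>, \<open>F\<close> we realise \<open>\<Lambda>\<^sup>r S\<^sup>* \<otimes> F\<close> as \<^term>\<open>alt_maps S r F\<close>,
  \<open>\<Lambda>\<^sup>r S\<^sup>* \<otimes> F\<^sup>*\<close> as \<^term>\<open>alt_maps S r (dual_sp F)\<close>, and \<open>\<Lambda>\<^sup>s S\<close> as the alternating
  \<open>s\<close>-linear functions of covectors, with the normalisation
  \<open>(U\<^sub>1 \<and> \<dots> \<and> U\<^sub>s)(\<lambda>\<^sub>1, \<dots>, \<lambda>\<^sub>s) = det (\<lambda>\<^sub>i U\<^sub>j)\<close>.  The next definition is then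
  \<open>\<Lambda>\<^sup>s S \<otimes> \<Lambda>\<^sup>r S\<^sup>* \<otimes> F\<^sup>*\<close>.\<close>

definition mixed :: "'v::real_vector set \<Rightarrow> 'f::real_vector set \<Rightarrow> int \<Rightarrow> int \<Rightarrow>
    (('v \<Rightarrow> real) list \<Rightarrow> 'v list \<Rightarrow> 'f \<Rightarrow> real) set"
  where "mixed S F s r = alt_maps (dual_sp S) s (alt_maps S r (dual_sp F))"

definition ndet :: "nat \<Rightarrow> (nat \<Rightarrow> nat \<Rightarrow> real) \<Rightarrow> real"
  where "ndet n A = (\<Sum>p | p permutes {..<n}. of_int (sign p) * (\<Prod>i<n. A i (p i)))"

definition wedge_vecs :: "'v::real_vector set \<Rightarrow> 'v list \<Rightarrow> ('v \<Rightarrow> real) list \<Rightarrow> real"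
  where "wedge_vecs S Us = (\<lambda>ls.
    if set ls \<subseteq> dual_sp S \<and> length ls = length Us
    then ndet (length Us) (\<lambda>i j. (ls ! i) (Us ! j)) else 0)"

text \<open>The decomposable elements \<open>U \<otimes> \<mu> \<otimes> \<eta>\<close>, \<open>\<omega> \<otimes> \<xi>\<close> and \<open>\<theta> \<otimes> \<eta>\<close>.\<close>

definition tens_mixed :: "'v::real_vector set \<Rightarrow> 'v list \<Rightarrow> ('v list \<Rightarrow> real) \<Rightarrow> ('f \<Rightarrow> real) \<Rightarrow>
    ('v \<Rightarrow> real) list \<Rightarrow> 'v list \<Rightarrow> 'f \<Rightarrow> real"
  where "tens_mixed S Us \<mu> \<eta> = (\<lambda>ls us \<xi>. wedge_vecs S Us ls * \<mu> us * \<eta> \<xi>)"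

definition tens_vec :: "('v list \<Rightarrow> real) \<Rightarrow> 'f::real_vector \<Rightarrow> 'v list \<Rightarrow> 'f"
  where "tens_vec \<omega> \<xi> = (\<lambda>us. \<omega> us *\<^sub>R \<xi>)"

definition tens_dual :: "('v list \<Rightarrow> real) \<Rightarrow> ('f \<Rightarrow> real) \<Rightarrow> 'v list \<Rightarrow> 'f \<Rightarrow> real"
  where "tens_dual \<theta> \<eta> = (\<lambda>us \<xi>. \<theta> us * \<eta> \<xi>)"

text \<open>The contraction \<open>(U \<otimes> \<mu> \<otimes> \<eta>) \<cdot> (\<omega> \<otimes> \<xi>) = \<omega>(U) (\<eta> \<cdot> \<xi>) \<mu>\<close>, as the bilinear map with
  these values.\<close>

definition contr :: "'v::real_vector set \<Rightarrow> 'f::real_vector set \<Rightarrow> nat \<Rightarrow> int \<Rightarrow>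
    (('v \<Rightarrow> real) list \<Rightarrow> 'v list \<Rightarrow> 'f \<Rightarrow> real) \<Rightarrow> ('v list \<Rightarrow> 'f) \<Rightarrow> 'v list \<Rightarrow> real"
  where "contr S F k r = (THE B.
    bilinear_on (mixed S F (int k) r) (alt_maps S (int k) F) B \<and>
    (\<forall>\<kappa> \<phi>. \<not> (\<kappa> \<in> mixed S F (int k) r \<and> \<phi> \<in> alt_maps S (int k) F) \<longrightarrow> B \<kappa> \<phi> = 0) \<and>
    (\<forall>Us \<mu> \<eta> \<omega> \<xi>. set Us \<subseteq> S \<and> length Us = k \<and> \<mu> \<in> alt_maps S r UNIV \<and> \<eta> \<in> dual_sp F \<and>
       \<omega> \<in> alt_maps S (int k) UNIV \<and> \<xi> \<in> F \<longrightarrow>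
       B (tens_mixed S Us \<mu> \<eta>) (tens_vec \<omega> \<xi>) = (\<omega> Us * \<eta> \<xi>) *\<^sub>R \<mu>))"

text \<open>Wedge product of a \<open>k\<close>-form and an \<open>l\<close>-form in the determinant convention
  (\<open>e\<^sup>1 \<and> \<dots> \<and> e\<^sup>n\<close> takes the value 1 on \<open>(e\<^sub>1, \<dots>, e\<^sub>n)\<close>), the one for which
  \<open>\<omega> \<and> i\<^sub>U \<mu> = \<omega>(U) \<mu>\<close>.\<close>

definition wedge_form :: "nat \<Rightarrow> int \<Rightarrow> ('v list \<Rightarrow> real) \<Rightarrow> ('v list \<Rightarrow> real) \<Rightarrow> 'v list \<Rightarrow> real"
  where "wedge_form k l \<omega> \<theta> = (\<lambda>us.
    (\<Sum>p | p permutes {..<length us}. of_int (sign p) *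
        \<omega> (take k (permute_list p us)) * \<theta> (drop k (permute_list p us)))
      / (fact k * fact (nat l)))"

text \<open>The wedge product \<open>(\<omega> \<otimes> \<xi>) \<and> (\<theta> \<otimes> \<eta>) = (\<omega> \<and> \<theta>) (\<eta> \<cdot> \<xi>)\<close>.\<close>

definition wedge :: "'v::real_vector set \<Rightarrow> 'f::real_vector set \<Rightarrow> nat \<Rightarrow> int \<Rightarrow>
    ('v list \<Rightarrow> 'f) \<Rightarrow> ('v list \<Rightarrow> 'f \<Rightarrow> real) \<Rightarrow> 'v list \<Rightarrow> real"
  where "wedge S F k l = (THE B.
    bilinear_on (alt_maps S (int k) F) (alt_maps S l (dual_sp F)) B \<and>
    (\<forall>\<phi> \<alpha>. \<not> (\<phi> \<in> alt_maps S (int k) F \<and> \<alpha> \<in> alt_maps S l (dual_sp F)) \<longrightarrow> B \<phi> \<alpha> = 0) \<and>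
    (\<forall>\<omega> \<xi> \<theta> \<eta>. \<omega> \<in> alt_maps S (int k) UNIV \<and> \<xi> \<in> F \<and>
       \<theta> \<in> alt_maps S l UNIV \<and> \<eta> \<in> dual_sp F \<longrightarrow>
       B (tens_vec \<omega> \<xi>) (tens_dual \<theta> \<eta>) = \<eta> \<xi> *\<^sub>R wedge_form k l \<omega> \<theta>))"

text \<open>\<open>i\<^sub>U \<mu>\<close> for \<open>U = U\<^sub>1 \<and> \<dots> \<and> U\<^sub>k\<close>, and the linear map \<open>U \<otimes> \<mu> \<otimes> \<eta> \<mapsto> i\<^sub>U \<mu> \<otimes> \<eta>\<close>.\<close>

definition interior_mult :: "'v list \<Rightarrow> ('v list \<Rightarrow> real) \<Rightarrow> 'v list \<Rightarrow> real"
  where "interior_mult Us \<mu> = (\<lambda>us. \<mu> (Us @ us))"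

definition Phi_fibre :: "'v::real_vector set \<Rightarrow> 'f::real_vector set \<Rightarrow> nat \<Rightarrow> int \<Rightarrow>
    (('v \<Rightarrow> real) list \<Rightarrow> 'v list \<Rightarrow> 'f \<Rightarrow> real) \<Rightarrow> 'v list \<Rightarrow> 'f \<Rightarrow> real"
  where "Phi_fibre S F k r = (THE L.
    linear_on (mixed S F (int k) r) L \<and>
    (\<forall>\<kappa>. \<kappa> \<notin> mixed S F (int k) r \<longrightarrow> L \<kappa> = 0) \<and>
    (\<forall>Us \<mu> \<eta>. set Us \<subseteq> S \<and> length Us = k \<and> \<mu> \<in> alt_maps S r UNIV \<and> \<eta> \<in> dual_sp F \<longrightarrow>
       L (tens_mixed S Us \<mu> \<eta>) = tens_dual (interior_mult Us \<mu>) \<eta>))"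


section \<open>Smooth functions on subsets of Euclidean space\<close>

text \<open>\<open>\<real>\<^sup>m\<close> is \<^term>\<open>Euclidean_space m\<close>: sequences \<open>x :: nat \<Rightarrow> real\<close> with \<open>x i = 0\<close> for
  \<open>i \<ge> m\<close>.  The model half-space is \<open>{x. x 0 \<le> 0}\<close>, so that the first coordinate direction points
  outwards.\<close>

definition half_space :: "nat \<Rightarrow> (nat \<Rightarrow> real) topology"
  where "half_space m = subtopology (Euclidean_space m) {x. x 0 \<le> 0}"

definition unit_vec :: "nat \<Rightarrow> nat \<Rightarrow> real"
  where "unit_vec j = (\<lambda>i. if i = j then 1 else 0)"

text \<open>\<open>C\<^sup>n\<close> functions on an open subset \<open>W\<close> of \<open>\<real>\<^sup>m\<close>.\<close>

fun Ck_on :: "nat \<Rightarrow> nat \<Rightarrow> (nat \<Rightarrow> real) set \<Rightarrow> ((nat \<Rightarrow> real) \<Rightarrow> real) \<Rightarrow> bool" where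
  "Ck_on m 0 W f \<longleftrightarrow> continuous_on W f"
| "Ck_on m (Suc n) W f \<longleftrightarrow> continuous_on W f \<and>
     (\<exists>g. \<forall>i<m. (\<forall>x\<in>W. ((\<lambda>t. f (x(i := t))) has_real_derivative g i x) (at (x i))) \<and>
                Ck_on m n W (g i))"

text \<open>Smoothness on an arbitrary subset of \<open>\<real>\<^sup>m\<close>: local smooth extendability.\<close>

definition smooth_in :: "nat \<Rightarrow> (nat \<Rightarrow> real) set \<Rightarrow> ((nat \<Rightarrow> real) \<Rightarrow> real) \<Rightarrow> bool"
  where "smooth_in m S f \<longleftrightarrow>
    (\<forall>x\<in>S. \<exists>W g. openin (Euclidean_space m) W \<and> x \<in> W \<and> (\<forall>n. Ck_on m n W g) \<and>
       (\<forall>y\<in>W \<inter> S. g y = f y))"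


section \<open>Manifolds with boundary\<close>

type_synonym 'a chart = "'a set \<times> ('a \<Rightarrow> nat \<Rightarrow> real)"

text \<open>A tangent vector at \<open>x\<close> is the family of its coordinate vectors in all charts at \<open>x\<close>.\<close>

type_synonym 'a tvec = "'a chart \<Rightarrow> nat \<Rightarrow> real"

text \<open>\<open>pos x vs\<close>: the ordered basis \<open>vs\<close> of the tangent space at \<open>x\<close> is positively oriented (in
  dimension 0, \<open>pos x []\<close> is the sign of the point \<open>x\<close>).\<close>

record 'a mfd =
  mtop :: "'a topology"
  mdim :: nat
  atlas :: "'a chart set"
  pos :: "'a \<Rightarrow> 'a tvec list \<Rightarrow> bool"

definition charts_at :: "'a mfd \<Rightarrow> 'a \<Rightarrow> 'a chart set"
  where "charts_at M x = {c \<in> atlas M. x \<in> fst c}"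

definition smooth_fun :: "'a mfd \<Rightarrow> 'a set \<Rightarrow> ('a \<Rightarrow> real) \<Rightarrow> bool"
  where "smooth_fun M W f \<longleftrightarrow>
    (\<forall>(U, h)\<in>atlas M. smooth_in (mdim M) (h ` (U \<inter> W)) (\<lambda>y. f (inv_into U h y)))"

definition smooth_manifold :: "'a mfd \<Rightarrow> bool"
  where "smooth_manifold M \<longleftrightarrow>
    Hausdorff_space (mtop M) \<and> second_countable (mtop M) \<and>
    topspace (mtop M) = (\<Union>(U, h)\<in>atlas M. U) \<and>
    (\<forall>(U, h)\<in>atlas M.
       openin (mtop M) U \<and>
       (openin (Euclidean_space (mdim M)) (h ` U) \<or> openin (half_space (mdim M)) (h ` U)) \<and>
       homeomorphic_map (subtopology (mtop M) U)
         (subtopology (Euclidean_space (mdim M)) (h ` U)) h \<and>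
       (\<forall>i<mdim M. smooth_fun M U (\<lambda>x. h x i)))"

text \<open>Entry \<open>(i, j)\<close> of the Jacobian at \<open>x\<close> of the transition from \<open>c\<close> to \<open>d\<close>; the derivative is
  one-sided where the chart image ends.\<close>

definition jac :: "'a chart \<Rightarrow> 'a chart \<Rightarrow> 'a \<Rightarrow> nat \<Rightarrow> nat \<Rightarrow> real"
  where "jac c d x i j =
    vector_derivative (\<lambda>t. snd d (inv_into (fst c) (snd c) ((snd c x)(j := t))) i)
      (at (snd c x j) within {t. (snd c x)(j := t) \<in> snd c ` (fst c \<inter> fst d)})"

definition tangent_space :: "'a mfd \<Rightarrow> 'a \<Rightarrow> 'a tvec set"
  where "tangent_space M x = {v.
    (\<forall>c. c \<notin> charts_at M x \<longrightarrow> v c = 0) \<and>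
    (\<forall>c\<in>charts_at M x. v c \<in> topspace (Euclidean_space (mdim M))) \<and>
    (\<forall>c\<in>charts_at M x. \<forall>d\<in>charts_at M x. \<forall>i<mdim M.
       v d i = (\<Sum>j<mdim M. jac c d x i j * v c j))}"

text \<open>Coordinate frame \<open>\<partial>\<^sub>j\<close> and coframe \<open>dx\<^sup>i\<close> of a chart.\<close>

definition coord_vec :: "'a mfd \<Rightarrow> 'a chart \<Rightarrow> 'a \<Rightarrow> nat \<Rightarrow> 'a tvec"
  where "coord_vec M c x j = inv_into (tangent_space M x) (\<lambda>v. v c) (unit_vec j)"

definition coord_covec :: "'a mfd \<Rightarrow> 'a chart \<Rightarrow> 'a \<Rightarrow> nat \<Rightarrow> 'a tvec \<Rightarrow> real"
  where "coord_covec M c x i = (\<lambda>v. if v \<in> tangent_space M x then v c i else 0)"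

text \<open>\<open>pos\<close> selects one of the two classes of ordered bases of each tangent space (first
  condition), in a locally constant way (second condition).\<close>

definition oriented :: "'a mfd \<Rightarrow> bool"
  where "oriented M \<longleftrightarrow>
    (\<forall>x\<in>topspace (mtop M). \<forall>c\<in>charts_at M x.
      (\<forall>vs. set vs \<subseteq> tangent_space M x \<and> length vs = mdim M \<and>
         ndet (mdim M) (\<lambda>i j. (vs ! i) c j) \<noteq> 0 \<longrightarrow>
         (pos M x vs \<longleftrightarrow>
           (pos M x (map (coord_vec M c x) [0..<mdim M]) \<longleftrightarrow>
             0 < ndet (mdim M) (\<lambda>i j. (vs ! i) c j)))) \<and>
      (\<exists>W. openin (mtop M) W \<and> x \<in> W \<and> W \<subseteq> fst c \<and>
         (\<forall>y\<in>W. pos M y (map (coord_vec M c y) [0..<mdim M]) \<longleftrightarrow>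
                  pos M x (map (coord_vec M c x) [0..<mdim M]))))"

definition compact_oriented_manifold :: "'a mfd \<Rightarrow> bool"
  where "compact_oriented_manifold M \<longleftrightarrow>
    smooth_manifold M \<and> compact_space (mtop M) \<and> oriented M"

subsection \<open>The boundary as an oriented manifold\<close>

definition bdry_points :: "'a mfd \<Rightarrow> 'a set"
  where "bdry_points M = {x. 0 < mdim M \<and>
    (\<exists>(U, h)\<in>atlas M. x \<in> U \<and> h ` U \<subseteq> {y. y 0 \<le> 0} \<and> h x 0 = 0)}"

text \<open>The chart of the boundary induced by a chart of \<open>M\<close> forgets the coordinate \<open>0\<close>.\<close>

definition bdry_chart :: "'a mfd \<Rightarrow> 'a chart \<Rightarrow> 'a chart"
  where "bdry_chart M c = (fst c \<inter> bdry_points M, \<lambda>x i. snd c x (Suc i))"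

text \<open>The differential at \<open>x\<close> of the inclusion of the boundary, which in the charts
  \<^term>\<open>bdry_chart M c\<close> and \<open>c\<close> is \<open>y \<mapsto> (0, y)\<close>.\<close>

definition d_incl :: "'a mfd \<Rightarrow> 'a \<Rightarrow> 'a tvec \<Rightarrow> 'a tvec"
  where "d_incl M x v = (\<lambda>c.
    if c \<in> charts_at M x then case_nat 0 (v (bdry_chart M c)) else 0)"

definition outward :: "'a mfd \<Rightarrow> 'a \<Rightarrow> 'a tvec \<Rightarrow> bool"
  where "outward M x \<nu> \<longleftrightarrow> \<nu> \<in> tangent_space M x \<and> (\<forall>c\<in>charts_at M x. 0 < \<nu> c 0)"

text \<open>Induced orientation: outward vector first.  For \<open>mdim M = 0\<close> the boundary is empty, and the
  truncated subtraction is immaterial.\<close>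

definition bdry :: "'a mfd \<Rightarrow> 'a mfd"
  where "bdry M = \<lparr>
    mtop = subtopology (mtop M) (bdry_points M),
    mdim = mdim M - 1,
    atlas = bdry_chart M ` atlas M,
    pos = (\<lambda>x vs. \<exists>\<nu>. outward M x \<nu> \<and> pos M x (\<nu> # map (d_incl M x) vs))\<rparr>"

subsection \<open>Integration of top-degree forms\<close>

definition partition_of_unity :: "'a mfd \<Rightarrow> ('a chart \<times> ('a \<Rightarrow> real)) set \<Rightarrow> bool"
  where "partition_of_unity M P \<longleftrightarrow> finite P \<and>
    (\<forall>(c, \<rho>)\<in>P. c \<in> atlas M \<and> smooth_fun M (topspace (mtop M)) \<rho> \<and>
       (\<forall>x\<in>topspace (mtop M). 0 \<le> \<rho> x) \<and>
       mtop M closure_of {x \<in> topspace (mtop M). \<rho> x \<noteq> 0} \<subseteq> fst c) \<and>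
    (\<forall>x\<in>topspace (mtop M). (\<Sum>(c, \<rho>)\<in>P. \<rho> x) = 1)"

definition chart_sign :: "'a mfd \<Rightarrow> 'a chart \<Rightarrow> 'a \<Rightarrow> real"
  where "chart_sign M c x = (if pos M x (map (coord_vec M c x) [0..<mdim M]) then 1 else -1)"

text \<open>Lebesgue integral over \<open>\<real>\<^sup>m\<close>, where elements of \<open>\<real>\<^sup>m\<close> vanish from index \<open>m\<close> on while
  those of the product measure space are undefined there.\<close>

definition euclidean_integral :: "nat \<Rightarrow> ((nat \<Rightarrow> real) \<Rightarrow> real) \<Rightarrow> real"
  where "euclidean_integral m f =
    (\<integral>z. f (\<lambda>i. if i < m then z i else 0) \<partial>(\<Pi>\<^sub>M i\<in>{..<m}. lborel))"

text \<open>The integral of a form over a compact oriented manifold is the common value of the sums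
  below for all partitions of unity subordinate to the atlas.  Charts need not preserve
  orientation, hence the sign.\<close>

definition mfd_integral :: "'a mfd \<Rightarrow> ('a \<Rightarrow> 'a tvec list \<Rightarrow> real) \<Rightarrow> real"
  where "mfd_integral M \<omega> = (THE I. \<forall>P. partition_of_unity M P \<longrightarrow>
    I = (\<Sum>(c, \<rho>)\<in>P. euclidean_integral (mdim M) (\<lambda>y.
          if y \<in> snd c ` fst c
          then let x = inv_into (fst c) (snd c) y in
            \<rho> x * chart_sign M c x * \<omega> x (map (coord_vec M c x) [0..<mdim M])
          else 0)))"


section \<open>Vector bundles and sections\<close>

text \<open>The fibres are linear subspaces of a common real vector space \<open>'f\<close>.  This loses no
  generality, since \<open>'f\<close> carries no topology and may be the direct sum of all fibres; the smooth
  structure of the bundle is that of the local trivialisations \<open>(U, n, \<tau>)\<close>, where \<open>n\<close> is the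
  rank over \<open>U\<close> and \<open>\<tau> x\<close> maps the fibre at \<open>x \<in> U\<close> to \<open>\<real>\<^sup>n\<close>.\<close>

record ('a, 'f) vbundle =
  fibre :: "'a \<Rightarrow> 'f set"
  trivs :: "('a set \<times> nat \<times> ('a \<Rightarrow> 'f \<Rightarrow> nat \<Rightarrow> real)) set"

definition frame :: "('a, 'f) vbundle \<Rightarrow> ('a \<Rightarrow> 'f \<Rightarrow> nat \<Rightarrow> real) \<Rightarrow> 'a \<Rightarrow> nat \<Rightarrow> 'f"
  where "frame E \<tau> x a = inv_into (fibre E x) (\<tau> x) (unit_vec a)"

definition vector_bundle :: "'a mfd \<Rightarrow> ('a, 'f::real_vector) vbundle \<Rightarrow> bool"
  where "vector_bundle M E \<longleftrightarrow>
    (\<forall>x\<in>topspace (mtop M). subspace (fibre E x)) \<and>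
    topspace (mtop M) = (\<Union>(U, n, \<tau>)\<in>trivs E. U) \<and>
    (\<forall>(U, n, \<tau>)\<in>trivs E. openin (mtop M) U \<and>
       (\<forall>x\<in>U. linear_on (fibre E x) (\<tau> x) \<and>
          bij_betw (\<tau> x) (fibre E x) (topspace (Euclidean_space n)))) \<and>
    (\<forall>(U, n, \<tau>)\<in>trivs E. \<forall>(U', n', \<tau>')\<in>trivs E. \<forall>a<n. \<forall>b<n'.
       smooth_fun M (U \<inter> U') (\<lambda>x. \<tau>' x (frame E \<tau> x a) b))"

definition restrict_bundle :: "('a, 'f) vbundle \<Rightarrow> 'a set \<Rightarrow> ('a, 'f) vbundle"
  where "restrict_bundle E A = \<lparr>
    fibre = fibre E,
    trivs = (\<lambda>(U, n, \<tau>). (U \<inter> A, n, \<tau>)) ` trivs E\<rparr>"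

definition multi_idx :: "nat \<Rightarrow> int \<Rightarrow> nat list set"
  where "multi_idx m r = {I. set I \<subseteq> {..<m} \<and> int (length I) = r}"

text \<open>Sections vanish outside the manifold and are smooth if their components with respect to all
  charts and local trivialisations are.  In order: \<open>\<Omega>\<^sup>k(M, E)\<close>, \<open>\<Omega>\<^sup>l(M, E\<^sup>*)\<close> and
  \<open>\<Lambda>\<^sub>r\<^sup>s(M, E\<^sup>*) = \<Gamma>(\<Lambda>\<^sup>s TM \<otimes> \<Lambda>\<^sup>r T\<^sup>*M \<otimes> E\<^sup>*)\<close>.\<close>

definition Omega :: "'a mfd \<Rightarrow> ('a, 'f::real_vector) vbundle \<Rightarrow> int \<Rightarrow> ('a \<Rightarrow> 'a tvec list \<Rightarrow> 'f) set"
  where "Omega M E k = {\<phi>.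
    (\<forall>x. x \<notin> topspace (mtop M) \<longrightarrow> \<phi> x = 0) \<and>
    (\<forall>x\<in>topspace (mtop M). \<phi> x \<in> alt_maps (tangent_space M x) k (fibre E x)) \<and>
    (\<forall>c\<in>atlas M. \<forall>(U, n, \<tau>)\<in>trivs E. \<forall>I\<in>multi_idx (mdim M) k. \<forall>a<n.
       smooth_fun M (fst c \<inter> U) (\<lambda>x. \<tau> x (\<phi> x (map (coord_vec M c x) I)) a))}"

definition Omega_dual ::
    "'a mfd \<Rightarrow> ('a, 'f::real_vector) vbundle \<Rightarrow> int \<Rightarrow> ('a \<Rightarrow> 'a tvec list \<Rightarrow> 'f \<Rightarrow> real) set"
  where "Omega_dual M E l = {\<beta>.
    (\<forall>x. x \<notin> topspace (mtop M) \<longrightarrow> \<beta> x = 0) \<and>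
    (\<forall>x\<in>topspace (mtop M). \<beta> x \<in> alt_maps (tangent_space M x) l (dual_sp (fibre E x))) \<and>
    (\<forall>c\<in>atlas M. \<forall>(U, n, \<tau>)\<in>trivs E. \<forall>I\<in>multi_idx (mdim M) l. \<forall>a<n.
       smooth_fun M (fst c \<inter> U) (\<lambda>x. \<beta> x (map (coord_vec M c x) I) (frame E \<tau> x a)))}"

definition Lambda_dual :: "'a mfd \<Rightarrow> ('a, 'f::real_vector) vbundle \<Rightarrow> int \<Rightarrow> int \<Rightarrow>
    ('a \<Rightarrow> ('a tvec \<Rightarrow> real) list \<Rightarrow> 'a tvec list \<Rightarrow> 'f \<Rightarrow> real) set"
  where "Lambda_dual M E s r = {\<alpha>.
    (\<forall>x. x \<notin> topspace (mtop M) \<longrightarrow> \<alpha> x = 0) \<and>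
    (\<forall>x\<in>topspace (mtop M). \<alpha> x \<in> mixed (tangent_space M x) (fibre E x) s r) \<and>
    (\<forall>c\<in>atlas M. \<forall>(U, n, \<tau>)\<in>trivs E.
       \<forall>I\<in>multi_idx (mdim M) s. \<forall>J\<in>multi_idx (mdim M) r. \<forall>a<n.
       smooth_fun M (fst c \<inter> U)
         (\<lambda>x. \<alpha> x (map (coord_covec M c x) I) (map (coord_vec M c x) J) (frame E \<tau> x a)))}"

definition pullback_incl ::
    "'a mfd \<Rightarrow> ('a \<Rightarrow> 'a tvec list \<Rightarrow> 'f::real_vector) \<Rightarrow> 'a \<Rightarrow> 'a tvec list \<Rightarrow> 'f"
  where "pullback_incl M \<phi> = (\<lambda>x vs.
    if x \<in> bdry_points M \<and> set vs \<subseteq> tangent_space (bdry M) x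
    then \<phi> x (map (d_incl M x) vs) else 0)"

text \<open>Bundle maps act on sections pointwise; the degree \<open>r\<close> is the one of the form factor
  \<open>\<Lambda>\<^sup>r T\<^sup>*M\<close>.\<close>

definition Phi :: "'a mfd \<Rightarrow> ('a, 'f::real_vector) vbundle \<Rightarrow> nat \<Rightarrow> int \<Rightarrow>
    ('a \<Rightarrow> ('a tvec \<Rightarrow> real) list \<Rightarrow> 'a tvec list \<Rightarrow> 'f \<Rightarrow> real) \<Rightarrow> 'a \<Rightarrow> 'a tvec list \<Rightarrow> 'f \<Rightarrow> real"
  where "Phi M E k r \<alpha> = (\<lambda>x. if x \<in> topspace (mtop M)
    then Phi_fibre (tangent_space M x) (fibre E x) k r (\<alpha> x) else 0)"

definition Phi_inv :: "'a mfd \<Rightarrow> ('a, 'f::real_vector) vbundle \<Rightarrow> nat \<Rightarrow> int \<Rightarrow>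
    ('a \<Rightarrow> 'a tvec list \<Rightarrow> 'f \<Rightarrow> real) \<Rightarrow> 'a \<Rightarrow> ('a tvec \<Rightarrow> real) list \<Rightarrow> 'a tvec list \<Rightarrow> 'f \<Rightarrow> real"
  where "Phi_inv M E k r \<beta> = (\<lambda>x. if x \<in> topspace (mtop M)
    then inv_into (mixed (tangent_space M x) (fibre E x) (int k) r)
           (Phi_fibre (tangent_space M x) (fibre E x) k r) (\<beta> x)
    else 0)"


section \<open>The two restricted duals\<close>

abbreviation bdry_bundle :: "'a mfd \<Rightarrow> ('a, 'f) vbundle \<Rightarrow> ('a, 'f) vbundle"
  where "bdry_bundle M E \<equiv> restrict_bundle E (bdry_points M)"

definition V_star where
  "V_star M E k =
     Lambda_dual M E (int k) (int (mdim M)) \<times>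
     Lambda_dual (bdry M) (bdry_bundle M E) (int k) (int (mdim M) - 1)"

definition V_dagger where
  "V_dagger M E k =
     Omega_dual M E (int (mdim M) - int k) \<times>
     Omega_dual (bdry M) (bdry_bundle M E) (int (mdim M) - int k - 1)"

definition pairing_star where
  "pairing_star M E k = (\<lambda>(\<alpha>, \<alpha>b) \<phi>.
     mfd_integral M
       (\<lambda>x. contr (tangent_space M x) (fibre E x) k (int (mdim M)) (\<alpha> x) (\<phi> x)) +
     mfd_integral (bdry M)
       (\<lambda>x. contr (tangent_space (bdry M) x) (fibre E x) k (int (mdim M) - 1)
              (\<alpha>b x) (pullback_incl M \<phi> x)))"

definition pairing_dagger where
  "pairing_dagger M E k = (\<lambda>(\<beta>, \<beta>b) \<phi>.
     mfd_integral M
       (\<lambda>x. wedge (tangent_space M x) (fibre E x) k (int (mdim M) - int k) (\<phi> x) (\<beta> x)) +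
     mfd_integral (bdry M)
       (\<lambda>x. wedge (tangent_space (bdry M) x) (fibre E x) k (int (mdim M) - int k - 1)
              (pullback_incl M \<phi> x) (\<beta>b x)))"

text \<open>The functionals on \<open>V = \<Omega>\<^sup>k(M, E)\<close> defined by the pairings, as functions with domain \<open>V\<close>.\<close>

definition Psi_star where
  "Psi_star M E k a = (\<lambda>\<phi>\<in>Omega M E (int k). pairing_star M E k a \<phi>)"

definition Psi_dagger where
  "Psi_dagger M E k b = (\<lambda>\<phi>\<in>Omega M E (int k). pairing_dagger M E k b \<phi>)"

definition star_to_dagger where
  "star_to_dagger M E k = (\<lambda>(\<alpha>, \<alpha>b).
     (Phi M E k (int (mdim M)) \<alpha>, Phi (bdry M) (bdry_bundle M E) k (int (mdim M) - 1) \<alpha>b))"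

definition dagger_to_star where
  "dagger_to_star M E k = (\<lambda>(\<beta>, \<beta>b).
     (Phi_inv M E k (int (mdim M)) \<beta>,
      Phi_inv (bdry M) (bdry_bundle M E) k (int (mdim M) - 1) \<beta>b))"

definition linear_iso_on ::
    "'v::real_vector set \<Rightarrow> 'w::real_vector set \<Rightarrow> ('v \<Rightarrow> 'w) \<Rightarrow> bool"
  where "linear_iso_on V W f \<longleftrightarrow> subspace V \<and> subspace W \<and> linear_on V f \<and> bij_betw f V W"

end

theory Submission
  imports Defs
begin

text \<open>Fibrewise everything rests on the identity \<open>\<phi> \<and> i\<^sub>U \<mu> = \<phi>(U) \<mu>\<close> for \<open>\<mu>\<close> of top degree, which says
  that the contraction of \<open>\<kappa>\<close> with \<open>\<phi>\<close> equals \<open>\<phi> \<and> \<Phi>(\<kappa>)\<close>.  Taking \<open>\<phi> = \<lambda>\<^sub>1 \<and> \<dots> \<and> \<lambda>\<^sub>k \<otimes> \<xi>\<close> recovers \<open>\<kappa>\<close>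
  from \<open>\<Phi>(\<kappa>)\<close>; surjectivity holds because every \<open>e\<^sup>J\<close> is, up to sign, the interior product of the
  volume form with the complementary frame vectors.  In the coordinate frames \<open>\<Phi>\<close> and its inverse
  are finite sums with constant coefficients, so both preserve smoothness.  The identity needs
  tangent spaces of the right dimension: at points of \<open>M\<close> this is the chain rule for the one-sided
  Jacobians of the transition maps, and on the boundary it also uses the invariance of the
  boundary.\<close>

section \<open>Multilinear algebra\<close>

text \<open>The obstacle is that \<open>Phi_fibre\<close>, \<open>contr\<close> and
  \<open>wedge\<close> are definite descriptions: they are prescribed on decomposable elements only,
  so each must be shown to exist and to be unique. Bases serve for this: existence comes from an
  explicit formula, uniqueness from spanning by decomposable tensors. Multi-indices run over all
  lists, not only over the increasing ones, which is the source of the factors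
  \<open>1 / fact k\<close> in the expansions. The integrals are compared through their integrands,
  which agree at each point. Degrees are integers because forms of degree \<open>m - 1 - k\<close>
  occur on the boundary. For \<open>k = m\<close> this is -1, and both spaces of sections over the
  boundary are then zero, the mixed one because \<open>k\<close> exceeds the dimension; hence the
  fibrewise results cover \<open>k > n\<close>. Chart images need not be open, and
  \<open>Ck_on\<close> speaks of partial derivatives only. The chain rule is therefore stated for a
  function with continuous partials on an open set, composed with a curve differentiable within a
  set, and the uniqueness of the one-sided derivatives has to be secured.\<close>

lemma scaleR_fun_apply [simp]: "(c *\<^sub>R f) x = c *\<^sub>R f x"
  by (simp add: scaleR_fun_def)

lemma sum_fun_apply: "(\<Sum>a\<in>A. f a) x = (\<Sum>a\<in>A. f a x)"
  by (induction A rule: infinite_finite_induct) auto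

lemma linear_onI:
  assumes "\<And>x y a b. x \<in> S \<Longrightarrow> y \<in> S \<Longrightarrow> f (a *\<^sub>R x + b *\<^sub>R y) = a *\<^sub>R f x + b *\<^sub>R f y"
  shows "linear_on S f"
  using assms by (simp add: linear_on_def)

lemma linear_onD:
  "linear_on S f \<Longrightarrow> x \<in> S \<Longrightarrow> y \<in> S \<Longrightarrow> f (a *\<^sub>R x + b *\<^sub>R y) = a *\<^sub>R f x + b *\<^sub>R f y"
  by (simp add: linear_on_def)

lemma linear_on_add: "linear_on S f \<Longrightarrow> x \<in> S \<Longrightarrow> y \<in> S \<Longrightarrow> f (x + y) = f x + f y"
  using linear_onD[of S f x y 1 1] by simp

lemma linear_on_scale: "linear_on S f \<Longrightarrow> x \<in> S \<Longrightarrow> f (a *\<^sub>R x) = a *\<^sub>R f x"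
  using linear_onD[of S f x x a 0] by simp

lemma linear_on_0: "linear_on S f \<Longrightarrow> 0 \<in> S \<Longrightarrow> f 0 = 0"
  using linear_on_scale[of S f 0 0] by simp

lemma subspace_comb: "subspace S \<Longrightarrow> x \<in> S \<Longrightarrow> y \<in> S \<Longrightarrow> a *\<^sub>R x + b *\<^sub>R y \<in> S"
  by (simp add: subspace_add subspace_scale)

lemma linear_on_sum:
  assumes "subspace S" "linear_on S f" "\<And>a. a \<in> A \<Longrightarrow> x a \<in> S"
  shows "f (\<Sum>a\<in>A. c a *\<^sub>R x a) = (\<Sum>a\<in>A. c a *\<^sub>R f (x a))"
  using assms(3)
proof (induction A rule: infinite_finite_induct)
  case (insert a A)
  have "(\<Sum>a\<in>A. c a *\<^sub>R x a) \<in> S"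
    using insert.prems assms(1) by (intro subspace_sum subspace_scale) auto
  then show ?case
    using insert linear_on_add[OF assms(2), of "c a *\<^sub>R x a"] linear_on_scale[OF assms(2), of "x a"]
    by (simp add: assms(1) subspace_scale)
qed (use linear_on_0[OF assms(2)] subspace_0[OF assms(1)] in auto)

lemma linear_on_compose:
  assumes "linear_on S f" "linear_on T g" "f ` S \<subseteq> T"
  shows "linear_on S (\<lambda>x. g (f x))"
  using assms by (auto intro!: linear_onI simp: linear_onD image_subset_iff)

lemma linear_on_scaleR_const: "linear_on S f \<Longrightarrow> linear_on S (\<lambda>x. c *\<^sub>R f x)"
  by (auto intro!: linear_onI simp: linear_onD scaleR_add_right mult.commute)

lemma linear_on_sum_fun: "(\<And>a. a \<in> A \<Longrightarrow> linear_on S (f a)) \<Longrightarrow> linear_on S (\<lambda>x. \<Sum>a\<in>A. f a x)"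
  unfolding linear_on_def by (auto simp: scaleR_sum_right simp flip: sum.distrib)

lemma linear_on_apply: "linear_on S (\<lambda>f. f x)"
  by (auto intro!: linear_onI)

lemma subspace_dual_sp:
  assumes "subspace S" shows "subspace (dual_sp S)"
  by (rule subspaceI)
    (auto simp: dual_sp_def linear_on_def scaleR_add_right mult.commute algebra_simps)

subsection \<open>Alternating maps\<close>

lemma alt_maps_in:
  "f \<in> alt_maps S r W \<Longrightarrow> set us \<subseteq> S \<Longrightarrow> int (length us) = r \<Longrightarrow> f us \<in> W"
  by (auto simp: alt_maps_def split: if_splits dest!: spec[of _ us])

lemma alt_maps_out:
  "f \<in> alt_maps S r W \<Longrightarrow> \<not> (set us \<subseteq> S \<and> int (length us) = r) \<Longrightarrow> f us = 0"
  unfolding alt_maps_def by (simp only: mem_Collect_eq) metis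

lemma alt_maps_not_distinct: "f \<in> alt_maps S r W \<Longrightarrow> \<not> distinct us \<Longrightarrow> f us = 0"
  by (simp add: alt_maps_def)

lemma alt_maps_linear:
  "f \<in> alt_maps S r W \<Longrightarrow> set us \<subseteq> S \<Longrightarrow> set vs \<subseteq> S \<Longrightarrow> int (length us) + 1 + int (length vs) = r
    \<Longrightarrow> linear_on S (\<lambda>v. f (us @ v # vs))"
  by (simp add: alt_maps_def)

lemma alt_maps_linear_update:
  assumes "f \<in> alt_maps S r W" "set us \<subseteq> S" "int (length us) = r" "q < length us"
  shows "linear_on S (\<lambda>v. f (us[q := v]))"
proof -
  have "linear_on S (\<lambda>v. f (take q us @ v # drop (Suc q) us))"
    using assms by (intro alt_maps_linear[OF assms(1)])
      (auto dest: in_set_takeD in_set_dropD)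
  then show ?thesis
    using assms(4) by (simp add: upd_conv_take_nth_drop)
qed

text \<open>Restates membership with list updates and a repeated pair of positions, the shape in
  which determinants and antisymmetrised sums meet the conditions.\<close>

lemma alt_mapsI:
  assumes "subspace S"
    and "\<And>vs. set vs \<subseteq> S \<Longrightarrow> int (length vs) = r \<Longrightarrow> f vs \<in> W"
    and "\<And>vs. \<not> (set vs \<subseteq> S \<and> int (length vs) = r) \<Longrightarrow> f vs = 0"
    and "\<And>vs q. set vs \<subseteq> S \<Longrightarrow> int (length vs) = r \<Longrightarrow> q < length vs \<Longrightarrow> linear_on S (\<lambda>v. f (vs[q := v]))"
    and "\<And>vs i j. set vs \<subseteq> S \<Longrightarrow> int (length vs) = r \<Longrightarrow> i < j \<Longrightarrow> j < length vs \<Longrightarrow> vs ! i = vs ! j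
      \<Longrightarrow> f vs = 0"
  shows "f \<in> alt_maps S r W"
  unfolding alt_maps_def mem_Collect_eq
proof (intro conjI allI impI)
  fix vs
  show "if set vs \<subseteq> S \<and> int (length vs) = r then f vs \<in> W else f vs = 0"
    using assms(2,3) by auto
next
  fix us vs
  assume *: "set us \<subseteq> S \<and> set vs \<subseteq> S \<and> int (length us) + 1 + int (length vs) = r"
  then have "linear_on S (\<lambda>v. f ((us @ 0 # vs)[length us := v]))"
    using subspace_0[OF assms(1)] by (intro assms(4)) auto
  then show "linear_on S (\<lambda>v. f (us @ v # vs))"
    by simp
next
  fix vs :: "'a list"
  assume "\<not> distinct vs"
  then obtain i j where "i < j" "j < length vs" "vs ! i = vs ! j"
    unfolding distinct_conv_nth by (metis nat_neq_iff)
  then show "f vs = 0"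
    using assms(3,5) by blast
qed

lemma alt_maps_neg: "r < 0 \<Longrightarrow> alt_maps S r W = {0}"
  by (auto simp: alt_maps_def fun_eq_iff linear_on_def)

lemma subspace_alt_maps:
  assumes "subspace W" shows "subspace (alt_maps S r W)"
proof (rule subspaceI)
  show "0 \<in> alt_maps S r W"
    using subspace_0[OF assms] by (auto simp: alt_maps_def linear_on_def)
next
  fix f g assume f: "f \<in> alt_maps S r W" and g: "g \<in> alt_maps S r W"
  show "f + g \<in> alt_maps S r W"
    unfolding alt_maps_def mem_Collect_eq
    using alt_maps_linear[OF f] alt_maps_linear[OF g] alt_maps_in[OF f] alt_maps_in[OF g]
      alt_maps_out[OF f] alt_maps_out[OF g] alt_maps_not_distinct[OF f] alt_maps_not_distinct[OF g]
    by (auto simp: subspace_add[OF assms] linear_on_def scaleR_add_right)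
next
  fix c f assume f: "f \<in> alt_maps S r W"
  show "c *\<^sub>R f \<in> alt_maps S r W"
    unfolding alt_maps_def mem_Collect_eq
    using alt_maps_linear[OF f] alt_maps_in[OF f]
      alt_maps_out[OF f] alt_maps_not_distinct[OF f]
    by (auto simp: subspace_scale[OF assms] linear_on_def scaleR_add_right mult.commute)
qed

lemma subspace_mixed:
  "subspace F \<Longrightarrow> subspace (mixed S F s r)"
  unfolding mixed_def by (intro subspace_alt_maps subspace_dual_sp)

text \<open>\<open>0 \<in> W\<close> forces \<open>g 0 = 0\<close>, so the value 0 outside the
  domain and on lists with repetitions survives the composition.\<close>

lemma alt_maps_compose:
  assumes f: "f \<in> alt_maps S r W" and W: "0 \<in> W" and g: "linear_on W g" "g ` W \<subseteq> W'"
  shows "(\<lambda>us. g (f us)) \<in> alt_maps S r W'"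
  unfolding alt_maps_def mem_Collect_eq
proof (intro conjI allI impI)
  fix us vs
  assume *: "set us \<subseteq> S \<and> set vs \<subseteq> S \<and> int (length us) + 1 + int (length vs) = r"
  show "linear_on S (\<lambda>v. g (f (us @ v # vs)))"
    by (rule linear_on_compose[OF _ g(1)])
      (use * in \<open>auto intro!: alt_maps_linear[OF f] alt_maps_in[OF f]\<close>)
qed (use alt_maps_in[OF f] alt_maps_out[OF f] alt_maps_not_distinct[OF f]
    linear_on_0[OF g(1) W] g(2) in auto)

lemma alt_maps_scaleR_left:
  assumes "f \<in> alt_maps S r UNIV" "subspace W" "w \<in> W"
  shows "(\<lambda>us. f us *\<^sub>R w) \<in> alt_maps S r W"
  by (rule alt_maps_compose[OF assms(1), where g = "\<lambda>a. a *\<^sub>R w"])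
    (auto intro!: linear_onI simp: scaleR_add_left subspace_scale assms)

lemma tens_vec_in: "\<omega> \<in> alt_maps S r UNIV \<Longrightarrow> subspace F \<Longrightarrow> \<xi> \<in> F \<Longrightarrow> tens_vec \<omega> \<xi> \<in> alt_maps S r F"
  unfolding tens_vec_def by (rule alt_maps_scaleR_left)

lemma tens_dual_in:
  assumes "\<theta> \<in> alt_maps S r UNIV" "subspace F" "\<eta> \<in> dual_sp F"
  shows "tens_dual \<theta> \<eta> \<in> alt_maps S r (dual_sp F)"
proof -
  have "tens_dual \<theta> \<eta> = (\<lambda>us. \<theta> us *\<^sub>R \<eta>)"
    by (auto simp: tens_dual_def fun_eq_iff)
  then show ?thesis
    using alt_maps_scaleR_left[OF assms(1) subspace_dual_sp[OF assms(2)] assms(3)] by simp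
qed

lemma alt_maps_append_left:
  assumes f: "f \<in> alt_maps S r W" and Us: "set Us \<subseteq> S" and s: "s = r - int (length Us)" and W: "0 \<in> W"
  shows "(\<lambda>us. f (Us @ us)) \<in> alt_maps S s W"
  unfolding alt_maps_def mem_Collect_eq
proof (intro conjI allI impI)
  fix us vs
  assume *: "set us \<subseteq> S \<and> set vs \<subseteq> S \<and> int (length us) + 1 + int (length vs) = s"
  show "linear_on S (\<lambda>v. f (Us @ us @ v # vs))"
    using alt_maps_linear[OF f, of "Us @ us" vs] * Us s by auto
next
  fix vs
  show "if set vs \<subseteq> S \<and> int (length vs) = s then f (Us @ vs) \<in> W else f (Us @ vs) = 0"
    using alt_maps_in[OF f, of "Us @ vs"] alt_maps_out[OF f, of "Us @ vs"] Us s by auto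
qed (auto intro!: alt_maps_not_distinct[OF f])

lemma alt_maps_append_right:
  assumes f: "f \<in> alt_maps S r W" and Us: "set Us \<subseteq> S" and s: "s = r - int (length Us)" and W: "0 \<in> W"
  shows "(\<lambda>us. f (us @ Us)) \<in> alt_maps S s W"
  unfolding alt_maps_def mem_Collect_eq
proof (intro conjI allI impI)
  fix us vs
  assume *: "set us \<subseteq> S \<and> set vs \<subseteq> S \<and> int (length us) + 1 + int (length vs) = s"
  show "linear_on S (\<lambda>v. f ((us @ v # vs) @ Us))"
    using alt_maps_linear[OF f, of us "vs @ Us"] * Us s by auto
next
  fix vs
  show "if set vs \<subseteq> S \<and> int (length vs) = s then f (vs @ Us) \<in> W else f (vs @ Us) = 0"
    using alt_maps_in[OF f, of "vs @ Us"] alt_maps_out[OF f, of "vs @ Us"] Us s by auto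
qed (auto intro!: alt_maps_not_distinct[OF f])

lemma permute_list_transpose:
  assumes "a < length us" "b < length us"
  shows "permute_list (Transposition.transpose a b) us = us[a := us ! b, b := us ! a]"
  by (rule nth_equalityI) (auto simp: permute_list_def nth_list_update Transposition.transpose_def)

text \<open>Polarisation: the value with \<open>?a + ?b\<close> in both positions is 0, and so are
  the two diagonal terms of its expansion.\<close>

lemma alt_maps_swap:
  assumes f: "f \<in> alt_maps S r W" and us: "set us \<subseteq> S" "int (length us) = r" and S: "subspace S"
    and ij: "i < length us" "j < length us" "i \<noteq> j"
  shows "f (us[i := us ! j, j := us ! i]) = - f us"
proof -
  define g where "g = (\<lambda>x y. f (us[i := x, j := y]))"
  have lin1: "linear_on S (\<lambda>x. g x y)" if "y \<in> S" for y
  proof -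
    have "linear_on S (\<lambda>x. f (us[j := y, i := x]))"
      using that us ij by (intro alt_maps_linear_update[OF f]) (auto dest!: set_update_subset_insert[THEN subsetD])
    then show ?thesis
      using ij by (simp add: g_def list_update_swap)
  qed
  have lin2: "linear_on S (\<lambda>y. g x y)" if "x \<in> S" for x
    unfolding g_def
    using that us ij by (intro alt_maps_linear_update[OF f]) (auto dest!: set_update_subset_insert[THEN subsetD])
  have diag: "g x x = 0" for x
    unfolding g_def using ij
    by (intro alt_maps_not_distinct[OF f])
      (use distinct_conv_nth[of "us[i := x, j := x]"] in \<open>auto simp: nth_list_update\<close>)
  let ?a = "us ! i" and ?b = "us ! j"
  have S': "?a \<in> S" "?b \<in> S" using us ij by auto
  have "0 = g (?a + ?b) (?a + ?b)" by (simp add: diag)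
  also have "\<dots> = (g ?a ?a + g ?b ?a) + (g ?a ?b + g ?b ?b)"
    using S' S by (simp only: linear_on_add[OF lin1] linear_on_add[OF lin2] subspace_add)
  also have "\<dots> = g ?a ?b + g ?b ?a"
    by (simp add: diag)
  finally have "g ?b ?a = - g ?a ?b" by (simp add: eq_neg_iff_add_eq_0 add.commute)
  moreover have "g ?a ?b = f us" by (simp add: g_def)
  ultimately show ?thesis by (simp add: g_def)
qed

lemma set_permute_list: "p permutes {..<length us} \<Longrightarrow> set (permute_list p us) = set us"
  by (metis mset_permute_list mset_eq_setD)

lemma alt_maps_permute:
  assumes f: "f \<in> alt_maps S r W" and us: "set us \<subseteq> S" "int (length us) = r" and S: "subspace S"
    and p: "p permutes {..<length us}"
  shows "f (permute_list p us) = of_int (sign p) *\<^sub>R f us"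
proof -
  \<comment> \<open>The list is generalised because splitting off a transposition changes the list
    to which the rest of the permutation is applied.\<close>
  have "\<forall>us'. length us' = length us \<and> set us' \<subseteq> S \<longrightarrow> f (permute_list p us') = of_int (sign p) *\<^sub>R f us'"
    using p finite_lessThan
  proof (induction rule: permutes_induct)
    case (swap a b p)
    show ?case
    proof (intro allI impI)
      fix us' assume us': "length us' = length us \<and> set us' \<subseteq> S"
      have ab: "a < length us'" "b < length us'" using swap us' by auto
      have t: "Transposition.transpose a b permutes {..<length us'}"
        using ab by (intro permutes_swap_id) auto
      have "f (permute_list (Transposition.transpose a b \<circ> p) us') = f (permute_list p (permute_list (Transposition.transpose a b) us'))"
        using swap us' by (subst permute_list_compose) auto
      also have "\<dots> = of_int (sign p) *\<^sub>R f (permute_list (Transposition.transpose a b) us')"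
        using swap us' by (auto simp: set_permute_list[OF t])
      also have "f (permute_list (Transposition.transpose a b) us') = - f us'"
        using ab us' swap us by (simp add: permute_list_transpose alt_maps_swap[OF f _ _ S])
      moreover have "sign (Transposition.transpose a b \<circ> p) = - sign p"
        using swap by (subst sign_compose)
          (auto simp: sign_swap_id permutation_swap_id intro: permutation_permutes[THEN iffD2])
      ultimately show "f (permute_list (Transposition.transpose a b \<circ> p) us') =
          of_int (sign (Transposition.transpose a b \<circ> p)) *\<^sub>R f us'"
        by (simp add: o_def)
    qed
  qed (auto)
  then show ?thesis using us by blast
qed

subsection \<open>Bases\<close>

text \<open>The values of the coordinate functions \<open>c\<close> off \<open>S\<close> are irrelevant.\<close>

definition basis_on :: "'v::real_vector set \<Rightarrow> nat \<Rightarrow> (nat \<Rightarrow> 'v) \<Rightarrow> (nat \<Rightarrow> 'v \<Rightarrow> real) \<Rightarrow> bool"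
  where "basis_on S n e c \<longleftrightarrow> subspace S \<and> (\<forall>i<n. e i \<in> S \<and> linear_on S (c i)) \<and>
    (\<forall>v\<in>S. v = (\<Sum>i<n. c i v *\<^sub>R e i)) \<and> (\<forall>i<n. \<forall>j<n. c i (e j) = (if i = j then 1 else 0))"

text \<open>Cutting off outside \<open>S\<close> places the coordinate function in
  \<open>dual_sp S\<close>, whose elements vanish off the subspace.\<close>

definition dual_vec :: "'v::real_vector set \<Rightarrow> (nat \<Rightarrow> 'v \<Rightarrow> real) \<Rightarrow> nat \<Rightarrow> 'v \<Rightarrow> real"
  where "dual_vec S c i = (\<lambda>v. if v \<in> S then c i v else 0)"

lemma basis_onD:
  assumes "basis_on S n e c"
  shows "subspace S" "i < n \<Longrightarrow> e i \<in> S" "i < n \<Longrightarrow> linear_on S (c i)"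
    "v \<in> S \<Longrightarrow> (\<Sum>i<n. c i v *\<^sub>R e i) = v"
    "i < n \<Longrightarrow> j < n \<Longrightarrow> c i (e j) = (if i = j then 1 else 0)"
  using assms by (auto simp: basis_on_def)

lemma dual_vec_in: "basis_on S n e c \<Longrightarrow> i < n \<Longrightarrow> dual_vec S c i \<in> dual_sp S"
  by (auto simp: dual_sp_def dual_vec_def intro!: linear_onI
      dest: basis_onD simp: subspace_comb[OF basis_onD(1)] linear_onD[OF basis_onD(3)])

lemma dual_sp_expand:
  assumes b: "basis_on S n e c" and l: "l \<in> dual_sp S"
  shows "(\<Sum>i<n. l (e i) *\<^sub>R dual_vec S c i) = l"
proof
  fix v
  show "(\<Sum>i<n. l (e i) *\<^sub>R dual_vec S c i) v = l v"
  proof (cases "v \<in> S")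
    case True
    have "l v = l (\<Sum>i<n. c i v *\<^sub>R e i)" using basis_onD(4)[OF b True] by simp
    also have "\<dots> = (\<Sum>i<n. c i v *\<^sub>R l (e i))"
      using l b by (intro linear_on_sum[OF basis_onD(1)[OF b]]) (auto simp: dual_sp_def dest: basis_onD)
    finally show ?thesis using True by (simp add: sum_fun_apply dual_vec_def mult.commute)
  qed (use l in \<open>auto simp: sum_fun_apply dual_vec_def dual_sp_def\<close>)
qed

text \<open>Makes the expansion of alternating maps available for the multivector slot of
  \<open>mixed\<close>, whose arguments are covectors.\<close>

lemma basis_on_dual:
  assumes "basis_on S n e c"
  shows "basis_on (dual_sp S) n (dual_vec S c) (\<lambda>i l. l (e i))"
  unfolding basis_on_def
  using subspace_dual_sp[OF basis_onD(1)[OF assms]] dual_vec_in[OF assms] dual_sp_expand[OF assms]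
    basis_onD(2,5)[OF assms]
  by (auto simp: linear_on_apply dual_vec_def)

lemma multi_idx_Suc: "multi_idx n (int (Suc k)) = (\<lambda>(j, I). j # I) ` ({..<n} \<times> multi_idx n (int k))"
proof (intro equalityI subsetI)
  fix J assume "J \<in> multi_idx n (int (Suc k))"
  then show "J \<in> (\<lambda>(j, I). j # I) ` ({..<n} \<times> multi_idx n (int k))"
    by (cases J) (auto simp: multi_idx_def)
qed (auto simp: multi_idx_def)

lemma finite_multi_idx: "finite (multi_idx n r)"
  by (rule finite_subset[OF _ finite_lists_length_eq[of "{..<n}" "nat r"]]) (auto simp: multi_idx_def)

lemma multi_idx_map_subset: "basis_on S n e c \<Longrightarrow> I \<in> multi_idx n r \<Longrightarrow> set (map e I) \<subseteq> S"
  by (auto simp: multi_idx_def dest: basis_onD(2))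

lemma multi_idx_length: "I \<in> multi_idx n (int k) \<Longrightarrow> length I = k"
  by (auto simp: multi_idx_def)

text \<open>The prefix \<open>ps\<close> collects the arguments already replaced by basis vectors,
  so that the induction can treat one argument at a time.\<close>

lemma alt_maps_multi_expand:
  assumes b: "basis_on S n e c" and f: "f \<in> alt_maps S r W"
    and "set ps \<subseteq> S" "set us \<subseteq> S" "int (length ps + length us) = r"
  shows "f (ps @ us) = (\<Sum>I\<in>multi_idx n (int (length us)).
    (\<Prod>i<length us. c (I ! i) (us ! i)) *\<^sub>R f (ps @ map e I))"
  using assms(3-)
proof (induction us arbitrary: ps)
  case Nil
  have "multi_idx n 0 = {[]}" by (auto simp: multi_idx_def)
  then show ?case by simp
next
  case (Cons u us)
  note S = basis_onD(1)[OF b]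
  have u: "u = (\<Sum>j<n. c j u *\<^sub>R e j)" using Cons basis_onD(4)[OF b] by simp
  have "f (ps @ u # us) = f (ps @ (\<Sum>j<n. c j u *\<^sub>R e j) # us)" using u by simp
  also have "\<dots> = (\<Sum>j<n. c j u *\<^sub>R f ((ps @ [e j]) @ us))"
    using linear_on_sum[OF S alt_maps_linear[OF f, of ps us], of "{..<n}" e "\<lambda>j. c j u"] Cons.prems basis_onD(2)[OF b]
    by simp
  also have "\<dots> = (\<Sum>j<n. c j u *\<^sub>R (\<Sum>I\<in>multi_idx n (int (length us)).
    (\<Prod>i<length us. c (I ! i) (us ! i)) *\<^sub>R f ((ps @ [e j]) @ map e I)))"
    using Cons.prems basis_onD(2)[OF b] by (intro sum.cong refl arg_cong2[where f = scaleR] Cons.IH) auto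
  also have "\<dots> = (\<Sum>(j, I)\<in>{..<n} \<times> multi_idx n (int (length us)).
      (c j u * (\<Prod>i<length us. c (I ! i) (us ! i))) *\<^sub>R f (ps @ map e (j # I)))"
    by (simp add: sum.cartesian_product[symmetric] scaleR_sum_right)
  also have "\<dots> = (\<Sum>I\<in>multi_idx n (int (length (u # us))).
    (\<Prod>i<length (u # us). c (I ! i) ((u # us) ! i)) *\<^sub>R f (ps @ map e I))"
  proof -
    have inj: "inj_on (\<lambda>(j, I). j # I) ({..<n} \<times> multi_idx n (int (length us)))"
      by (auto simp: inj_on_def)
    show ?thesis
      unfolding length_Cons multi_idx_Suc sum.reindex[OF inj] prod.lessThan_Suc_shift
      by (simp add: o_def case_prod_unfold)
  qed
  finally show ?case .
qed

text \<open>Averaging the multilinear expansion over all orderings of the arguments, with signs,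
  turns the product of coordinates into a determinant; \<open>fact k\<close> is the number of
  orderings.\<close>

lemma alt_maps_expand:
  assumes b: "basis_on S n e c" and f: "f \<in> alt_maps S (int k) W"
    and us: "set us \<subseteq> S" "length us = k"
  shows "f us = (1 / fact k) *\<^sub>R (\<Sum>I\<in>multi_idx n (int k). ndet k (\<lambda>i j. c (I ! i) (us ! j)) *\<^sub>R f (map e I))"
proof -
  note S = basis_onD(1)[OF b]
  have "(\<Sum>I\<in>multi_idx n (int k). ndet k (\<lambda>i j. c (I ! i) (us ! j)) *\<^sub>R f (map e I)) =
     (\<Sum>p | p permutes {..<k}. \<Sum>I\<in>multi_idx n (int k).
        of_int (sign p) *\<^sub>R (\<Prod>i<k. c (I ! i) (us ! p i)) *\<^sub>R f (map e I))"
    unfolding ndet_def scaleR_sum_left by (subst sum.swap) simp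
  also have "\<dots> = (\<Sum>p | p permutes {..<k}. f us)"
  proof (intro sum.cong refl)
    fix p assume "p \<in> {p. p permutes {..<k}}"
    then have p: "p permutes {..<length us}" using us by simp
    have "f (permute_list p us) = (\<Sum>I\<in>multi_idx n (int k). (\<Prod>i<k. c (I ! i) (us ! p i)) *\<^sub>R f (map e I))"
      using alt_maps_multi_expand[OF b f, of "[]" "permute_list p us"] us p
      by (simp add: set_permute_list[OF p] permute_list_nth[OF p])
    moreover have "f (permute_list p us) = of_int (sign p) *\<^sub>R f us"
      using us by (intro alt_maps_permute[OF f _ _ S p]) auto
    ultimately have "of_int (sign p) *\<^sub>R of_int (sign p) *\<^sub>R f us =
        of_int (sign p) *\<^sub>R (\<Sum>I\<in>multi_idx n (int k). (\<Prod>i<k. c (I ! i) (us ! p i)) *\<^sub>R f (map e I))"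
      by simp
    then show "(\<Sum>I\<in>multi_idx n (int k). of_int (sign p) *\<^sub>R (\<Prod>i<k. c (I ! i) (us ! p i)) *\<^sub>R f (map e I)) = f us"
      by (simp add: scaleR_sum_right flip: of_int_mult)
  qed
  also have "\<dots> = fact k *\<^sub>R f us"
    by (simp add: sum_constant_scaleR card_permutations[of "{..<k}" k])
  finally show ?thesis by simp
qed

text \<open>Multi-indices with a repetition give 0 on both sides; the remaining values determine an
  alternating map by \<open>alt_maps_expand\<close>.\<close>

lemma alt_maps_eqI:
  assumes b: "basis_on S n e c" and f: "f \<in> alt_maps S (int k) W" and g: "g \<in> alt_maps S (int k) W'"
    and eq: "\<And>I. I \<in> multi_idx n (int k) \<Longrightarrow> distinct I \<Longrightarrow> f (map e I) = g (map e I)"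
  shows "f = g"
proof
  fix us
  have eq': "f (map e I) = g (map e I)" if I: "I \<in> multi_idx n (int k)" for I
  proof (cases "distinct I")
    case False
    then have "\<not> distinct (map e I)" by (auto simp: distinct_map)
    then show ?thesis by (simp add: alt_maps_not_distinct[OF f] alt_maps_not_distinct[OF g])
  qed (use eq[OF I] in auto)
  show "f us = g us"
  proof (cases "set us \<subseteq> S \<and> int (length us) = int k")
    case True
    then show ?thesis
      using alt_maps_expand[OF b f, of us] alt_maps_expand[OF b g, of us] eq' by simp
  next
    case False
    then show ?thesis
      using alt_maps_out[OF f False] alt_maps_out[OF g False] by simp
  qed
qed

text \<open>Pigeonhole: no list of \<open>k > n\<close> indices below \<open>n\<close> is
  distinct.\<close>

lemma alt_maps_above_dim:
  assumes b: "basis_on S n e c" and f: "f \<in> alt_maps S (int k) W" and "n < k"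
  shows "f = 0"
proof (rule alt_maps_eqI[OF b f])
  show "0 \<in> alt_maps S (int k) UNIV"
    by (auto simp: alt_maps_def linear_on_def)
  fix I assume "I \<in> multi_idx n (int k)" "distinct I"
  then have "card (set I) = k" "set I \<subseteq> {..<n}" by (auto simp: multi_idx_def distinct_card)
  then show "f (map e I) = 0 (map e I)"
    using card_mono[of "{..<n}" "set I"] \<open>n < k\<close> by simp
qed

subsection \<open>Determinants\<close>

lemma ndet_transpose: "ndet n (\<lambda>i j. A j i) = ndet n A"
proof -
  have "ndet n (\<lambda>i j. A j i) = (\<Sum>p | p permutes {..<n}. of_int (sign (inv p)) * (\<Prod>i<n. A (inv p i) i))"
    unfolding ndet_def by (rule sum_permutations_inverse)
  also have "\<dots> = ndet n A"
    unfolding ndet_def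
  proof (intro sum.cong refl)
    fix p assume "p \<in> {p. p permutes {..<n}}"
    then have p: "p permutes {..<n}" by simp
    have "(\<Prod>i<n. A (inv p i) i) = (\<Prod>i<n. A (inv p (p i)) (p i))"
      using prod.permute[OF p, of "\<lambda>i. A (inv p i) i"] by (simp add: o_def)
    then show "of_int (sign (inv p)) * (\<Prod>i<n. A (inv p i) i) = of_int (sign p) * (\<Prod>i<n. A i (p i))"
      using p sign_inverse[of p] by (auto simp: permutes_inverses permutation_permutes)
  qed
  finally show ?thesis .
qed

text \<open>Composing the permutations with the transposition of the two rows keeps every product
  and reverses every sign.\<close>

lemma ndet_equal_rows:
  assumes "i < n" "j < n" "i \<noteq> j" "\<And>l. l < n \<Longrightarrow> A i l = A j l"
  shows "ndet n A = 0"
proof -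
  let ?t = "Transposition.transpose i j"
  have t: "?t permutes {..<n}" using assms by (intro permutes_swap_id) auto
  have "ndet n A = (\<Sum>p | p permutes {..<n}. of_int (sign (p \<circ> ?t)) * (\<Prod>l<n. A l ((p \<circ> ?t) l)))"
    unfolding ndet_def by (rule sum_permutations_compose_right[OF t])
  also have "\<dots> = (\<Sum>p | p permutes {..<n}. - (of_int (sign p) * (\<Prod>l<n. A l (p l))))"
  proof (intro sum.cong refl)
    fix p assume "p \<in> {p. p permutes {..<n}}"
    then have p: "p permutes {..<n}" by simp
    have "(\<Prod>l<n. A l (p (?t l))) = (\<Prod>l<n. A (?t l) (p (?t (?t l))))"
      using prod.permute[OF t, of "\<lambda>l. A l (p (?t l))"] by (simp add: o_def)
    also have "\<dots> = (\<Prod>l<n. A l (p l))"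
      using assms permutes_in_image[OF p]
      by (intro prod.cong refl) (auto simp: Transposition.transpose_def)
    moreover have "sign (p \<circ> ?t) = - sign p"
      using p assms by (subst sign_compose)
        (auto simp: sign_swap_id permutation_swap_id intro: permutation_permutes[THEN iffD2])
    ultimately show "of_int (sign (p \<circ> ?t)) * (\<Prod>l<n. A l ((p \<circ> ?t) l)) = - (of_int (sign p) * (\<Prod>l<n. A l (p l)))"
      by simp
  qed
  also have "\<dots> = - ndet n A" by (simp add: ndet_def sum_negf)
  finally show ?thesis by simp
qed

lemma ndet_zero_row:
  assumes "i < n" "\<And>l. l < n \<Longrightarrow> A i l = 0"
  shows "ndet n A = 0"
  unfolding ndet_def
proof (intro sum.neutral ballI)
  fix p assume "p \<in> {p. p permutes {..<n}}"
  then have "A i (p i) = 0" using assms permutes_in_image[of p "{..<n}" i] by auto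
  then have "(\<Prod>l<n. A l (p l)) = 0" using assms(1) by (intro prod_zero) auto
  then show "of_int (sign p) * (\<Prod>l<n. A l (p l)) = 0" by simp
qed

lemma ndet_one: "ndet n (\<lambda>i j. if i = j then 1 else 0) = 1"
proof -
  have "ndet n (\<lambda>i j. if i = j then 1 else 0) = (\<Sum>p\<in>{id}. of_int (sign p) * (\<Prod>i<n. if i = p i then 1 else 0))"
    unfolding ndet_def
  proof (rule sum.mono_neutral_right)
    show "\<forall>p\<in>{p. p permutes {..<n}} - {id}. of_int (sign p) * (\<Prod>i<n. if i = p i then 1 else 0 :: real) = 0"
    proof
      fix p assume p: "p \<in> {p. p permutes {..<n}} - {id}"
      then obtain i where "p i \<noteq> i" "i < n" by (auto simp: fun_eq_iff permutes_def)
      then have "(\<Prod>i<n. if i = p i then 1 else 0 :: real) = 0"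
        by (intro prod_zero) (auto intro!: bexI[of _ i])
      then show "of_int (sign p) * (\<Prod>i<n. if i = p i then 1 else 0 :: real) = 0" by simp
    qed
  qed (auto simp: finite_permutations permutes_id)
  then show ?thesis by (simp add: sign_id)
qed

lemma ndet_cong: "(\<And>i j. i < n \<Longrightarrow> j < n \<Longrightarrow> A i j = B i j) \<Longrightarrow> ndet n A = ndet n B"
  unfolding ndet_def
  by (intro sum.cong refl arg_cong2[where f = "(*)"] prod.cong) (use permutes_in_image in fastforce)

text \<open>The wedge product of the covectors \<open>a 0\<close>, ..., \<open>a (k - 1)\<close> in
  the determinant convention. Rows belong to arguments, so a repeated argument is a repeated
  row.\<close>

definition ndet_form :: "'v::real_vector set \<Rightarrow> nat \<Rightarrow> (nat \<Rightarrow> 'v \<Rightarrow> real) \<Rightarrow> 'v list \<Rightarrow> real"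
  where "ndet_form S k a = (\<lambda>vs. if set vs \<subseteq> S \<and> length vs = k then ndet k (\<lambda>i j. a j (vs ! i)) else 0)"

lemma ndet_form_in:
  assumes "subspace S" "\<And>j. j < k \<Longrightarrow> linear_on S (a j)"
  shows "ndet_form S k a \<in> alt_maps S (int k) UNIV"
proof (rule alt_mapsI[OF assms(1)])
  fix vs :: "'a list" and q
  assume vs: "set vs \<subseteq> S" "int (length vs) = int k" "q < length vs"
  have S: "set (vs[q := v]) \<subseteq> S" if "v \<in> S" for v
    using that vs set_update_subset_insert[of vs q v] by auto
  have "linear_on S (\<lambda>v. ndet k (\<lambda>i j. a j (vs[q := v] ! i)))"
    unfolding ndet_def
  proof (rule linear_on_sum_fun)
    fix p assume "p \<in> {p. p permutes {..<k}}"
    then have p: "p permutes {..<k}" by simp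
    \<comment> \<open>In each product only the factor of row \<open>q\<close> depends on the varied
      argument.\<close>
    have "(\<lambda>v. of_int (sign p) * (\<Prod>i<k. a (p i) (vs[q := v] ! i))) =
       (\<lambda>v. (of_int (sign p) * (\<Prod>i\<in>{..<k} - {q}. a (p i) (vs ! i))) *\<^sub>R a (p q) v)"
    proof
      fix v
      have "(\<Prod>i<k. a (p i) (vs[q := v] ! i)) = a (p q) (vs[q := v] ! q) * (\<Prod>i\<in>{..<k} - {q}. a (p i) (vs[q := v] ! i))"
        using vs by (intro prod.remove) auto
      also have "(\<Prod>i\<in>{..<k} - {q}. a (p i) (vs[q := v] ! i)) = (\<Prod>i\<in>{..<k} - {q}. a (p i) (vs ! i))"
        by (intro prod.cong) auto
      finally show "of_int (sign p) * (\<Prod>i<k. a (p i) (vs[q := v] ! i)) =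
         (of_int (sign p) * (\<Prod>i\<in>{..<k} - {q}. a (p i) (vs ! i))) *\<^sub>R a (p q) v"
        using vs by simp
    qed
    moreover have "p q < k" using permutes_in_image[OF p, of q] vs by simp
    ultimately show "linear_on S (\<lambda>v. of_int (sign p) * (\<Prod>i<k. a (p i) (vs[q := v] ! i)))"
      using assms(2) by (simp only: linear_on_scaleR_const)
  qed
  then show "linear_on S (\<lambda>v. ndet_form S k a (vs[q := v]))"
    using S vs by (auto simp: linear_on_def ndet_form_def subspace_comb[OF assms(1)])
next
  fix vs :: "'a list" and i j
  assume *: "set vs \<subseteq> S" "int (length vs) = int k" "i < j" "j < length vs" "vs ! i = vs ! j"
  then have "ndet k (\<lambda>i j. a j (vs ! i)) = 0" by (intro ndet_equal_rows[of i _ j]) auto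
  then show "ndet_form S k a vs = 0" by (simp add: ndet_form_def)
qed (auto simp: ndet_form_def)

text \<open>A multivector is the wedge product of the evaluations at its vectors, regarded as
  covectors of the dual space.\<close>

lemma wedge_vecs_eq: "wedge_vecs S Us = ndet_form (dual_sp S) (length Us) (\<lambda>j l. l (Us ! j))"
  by (auto simp: wedge_vecs_def ndet_form_def fun_eq_iff)

lemma wedge_vecs_in:
  "subspace S \<Longrightarrow> length Us = k \<Longrightarrow> wedge_vecs S Us \<in> alt_maps (dual_sp S) (int k) UNIV"
  unfolding wedge_vecs_eq by (auto intro!: ndet_form_in subspace_dual_sp linear_on_apply)

lemma tens_mixed_scaleR: "tens_mixed S Us \<mu> \<eta> = (\<lambda>ls. wedge_vecs S Us ls *\<^sub>R tens_dual \<mu> \<eta>)"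
  by (auto simp: tens_mixed_def tens_dual_def fun_eq_iff)

lemma tens_mixed_in:
  assumes "subspace S" "subspace F" "length Us = k" "\<mu> \<in> alt_maps S r UNIV" "\<eta> \<in> dual_sp F"
  shows "tens_mixed S Us \<mu> \<eta> \<in> mixed S F (int k) r"
  unfolding mixed_def tens_mixed_scaleR
  by (intro alt_maps_scaleR_left wedge_vecs_in subspace_alt_maps subspace_dual_sp tens_dual_in assms)

subsection \<open>Explicit formulas for the fibrewise operations\<close>

text \<open>The bases are auxiliary: \<open>Phi_fibre\<close>, \<open>contr\<close> and
  \<open>wedge\<close> do not refer to them. At a point of a manifold \<open>e\<close> becomes the
  coordinate frame of any chart there.\<close>

locale based_fibre =
  fixes S :: "'v::real_vector set" and n e c and F :: "'f::real_vector set" and nF f cf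
  assumes S: "basis_on S n e c" and F: "basis_on F nF f cf"
begin

abbreviation "\<epsilon> \<equiv> dual_vec S c"
abbreviation "idx l \<equiv> multi_idx n (int l)"
abbreviation "f\<^sub>d \<equiv> dual_vec F cf"

lemmas subS = basis_onD(1)[OF S] and subF = basis_onD(1)[OF F]

lemma mixed_apply_in:
  assumes "\<kappa> \<in> mixed S F (int k) r" "I \<in> idx k"
  shows "\<kappa> (map \<epsilon> I) \<in> alt_maps S r (dual_sp F)"
  using assms multi_idx_map_subset[OF basis_on_dual[OF S], of I] multi_idx_length[of I n k]
  unfolding mixed_def by (intro alt_maps_in[of \<kappa>]) auto

lemma dual_coeff_in:
  "\<alpha> \<in> alt_maps S r (dual_sp F) \<Longrightarrow> (\<lambda>us. \<alpha> us \<xi>) \<in> alt_maps S r UNIV"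
  by (rule alt_maps_compose[where g = "\<lambda>\<eta>. \<eta> \<xi>"])
    (auto intro: linear_on_apply simp: subspace_0[OF subspace_dual_sp[OF subF]])

lemma coord_coeff_in:
  "\<phi> \<in> alt_maps S r F \<Longrightarrow> b < nF \<Longrightarrow> (\<lambda>us. cf b (\<phi> us)) \<in> alt_maps S r UNIV"
  by (rule alt_maps_compose[where g = "cf b"]) (auto intro: basis_onD(3)[OF F] simp: subspace_0[OF subF])

lemma alt_dual_range: "\<alpha> \<in> alt_maps S r (dual_sp F) \<Longrightarrow> \<alpha> us \<in> dual_sp F"
  using alt_maps_in[of \<alpha> S r "dual_sp F" us] alt_maps_out[of \<alpha> S r "dual_sp F" us]
    subspace_0[OF subspace_dual_sp[OF subF]] by metis

lemma alt_range: "\<phi> \<in> alt_maps S r F \<Longrightarrow> \<phi> us \<in> F"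
  using alt_maps_in[of \<phi> S r F us] alt_maps_out[of \<phi> S r F us] subspace_0[OF subF] by metis

lemma decompose_dual:
  assumes "\<alpha> \<in> alt_maps S r (dual_sp F)"
  shows "\<alpha> = (\<Sum>a<nF. 1 *\<^sub>R tens_dual (\<lambda>us. \<alpha> us (f a)) (f\<^sub>d a))"
proof (intro ext)
  fix us \<xi>
  have "\<alpha> us \<xi> = (\<Sum>a<nF. \<alpha> us (f a) *\<^sub>R f\<^sub>d a) \<xi>"
    using dual_sp_expand[OF F alt_dual_range[OF assms]] by simp
  then show "\<alpha> us \<xi> = (\<Sum>a<nF. 1 *\<^sub>R tens_dual (\<lambda>us. \<alpha> us (f a)) (f\<^sub>d a)) us \<xi>"
    by (simp add: sum_fun_apply tens_dual_def)
qed

lemma decompose_vec: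
  assumes "\<phi> \<in> alt_maps S r F"
  shows "\<phi> = (\<Sum>b<nF. 1 *\<^sub>R tens_vec (\<lambda>us. cf b (\<phi> us)) (f b))"
proof
  fix us
  show "\<phi> us = (\<Sum>b<nF. 1 *\<^sub>R tens_vec (\<lambda>us. cf b (\<phi> us)) (f b)) us"
    using basis_onD(4)[OF F alt_range[OF assms]] by (simp add: sum_fun_apply tens_vec_def)
qed

text \<open>Expands the multivector slot by \<open>alt_maps_expand\<close> and the fibre slot in the
  dual basis. Decomposable elements thus span, which gives the uniqueness required by the definite
  descriptions.\<close>

lemma decompose_mixed:
  assumes \<kappa>: "\<kappa> \<in> mixed S F (int k) r"
  shows "\<kappa> = (\<Sum>(I, a)\<in>idx k \<times> {..<nF}.
    (1 / fact k) *\<^sub>R tens_mixed S (map e I) (\<lambda>us. \<kappa> (map \<epsilon> I) us (f a)) (f\<^sub>d a))"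
    (is "_ = ?R")
proof (intro ext)
  fix ls us \<xi>
  have "?R ls us \<xi> =
    (\<Sum>I\<in>idx k. \<Sum>a<nF. 1 / fact k * (wedge_vecs S (map e I) ls * \<kappa> (map \<epsilon> I) us (f a) * f\<^sub>d a \<xi>))"
    by (simp add: sum_fun_apply case_prod_unfold tens_mixed_def sum.cartesian_product)
  also have "\<dots> = (\<Sum>I\<in>idx k. 1 / fact k * wedge_vecs S (map e I) ls * \<kappa> (map \<epsilon> I) us \<xi>)"
  proof (intro sum.cong refl)
    fix I assume I: "I \<in> idx k"
    have "\<kappa> (map \<epsilon> I) us \<xi> = (\<Sum>a<nF. \<kappa> (map \<epsilon> I) us (f a) * f\<^sub>d a \<xi>)"
      using fun_cong[OF fun_cong[OF decompose_dual[OF mixed_apply_in[OF \<kappa> I]]], of us \<xi>]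
      by (simp add: sum_fun_apply tens_dual_def)
    then show "(\<Sum>a<nF. 1 / fact k * (wedge_vecs S (map e I) ls * \<kappa> (map \<epsilon> I) us (f a) * f\<^sub>d a \<xi>)) =
      1 / fact k * wedge_vecs S (map e I) ls * \<kappa> (map \<epsilon> I) us \<xi>"
      by (simp add: sum_distrib_left mult_ac)
  qed
  also have "\<dots> = \<kappa> ls us \<xi>"
  proof (cases "set ls \<subseteq> dual_sp S \<and> length ls = k")
    case True
    have "\<kappa> ls = (1 / fact k) *\<^sub>R (\<Sum>I\<in>idx k. ndet k (\<lambda>i j. (ls ! j) (e (I ! i))) *\<^sub>R \<kappa> (map \<epsilon> I))"
      using True \<kappa> unfolding mixed_def by (intro alt_maps_expand[OF basis_on_dual[OF S]]) auto
    also have "\<dots> = (1 / fact k) *\<^sub>R (\<Sum>I\<in>idx k. wedge_vecs S (map e I) ls *\<^sub>R \<kappa> (map \<epsilon> I))"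
    proof (intro arg_cong2[where f = scaleR] sum.cong refl)
      fix I assume I: "I \<in> idx k"
      \<comment> \<open>The expansion puts the multi-index into the rows, whereas
        \<open>wedge_vecs\<close> puts the covectors there.\<close>
      have "ndet k (\<lambda>i j. (ls ! j) (e (I ! i))) = ndet k (\<lambda>i j. (ls ! i) (e (I ! j)))"
        by (rule ndet_transpose)
      then show "ndet k (\<lambda>i j. (ls ! j) (e (I ! i))) = wedge_vecs S (map e I) ls"
        using True multi_idx_length[OF I] by (auto simp: wedge_vecs_def intro!: ndet_cong)
    qed
    finally have "\<kappa> ls us \<xi> = ((1 / fact k) *\<^sub>R (\<Sum>I\<in>idx k. wedge_vecs S (map e I) ls *\<^sub>R \<kappa> (map \<epsilon> I))) us \<xi>"
      by simp
    then show ?thesis by (simp add: sum_fun_apply sum_distrib_left mult_ac)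
  next
    case False
    then have "wedge_vecs S (map e I) ls = 0" if "I \<in> idx k" for I
      using multi_idx_length[OF that] by (auto simp: wedge_vecs_def)
    moreover have "\<kappa> ls = 0"
      using \<kappa> False unfolding mixed_def by (auto intro: alt_maps_out)
    ultimately show ?thesis by (simp add: sum.neutral)
  qed
  finally show "\<kappa> ls us \<xi> = ?R ls us \<xi>" by simp
qed

lemma decompose_mixed_in:
  assumes "\<kappa> \<in> mixed S F (int k) r" "I \<in> idx k" "a < nF"
  shows "set (map e I) \<subseteq> S" "length (map e I) = k" "(\<lambda>us. \<kappa> (map \<epsilon> I) us (f a)) \<in> alt_maps S r UNIV"
    "f\<^sub>d a \<in> dual_sp F" "tens_mixed S (map e I) (\<lambda>us. \<kappa> (map \<epsilon> I) us (f a)) (f\<^sub>d a) \<in> mixed S F (int k) r"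
proof -
  show *: "set (map e I) \<subseteq> S" "length (map e I) = k" "(\<lambda>us. \<kappa> (map \<epsilon> I) us (f a)) \<in> alt_maps S r UNIV"
    "f\<^sub>d a \<in> dual_sp F"
    using assms multi_idx_map_subset[OF S assms(2)] multi_idx_length[OF assms(2)]
    by (auto simp: dual_coeff_in mixed_apply_in dual_vec_in[OF F])
  show "tens_mixed S (map e I) (\<lambda>us. \<kappa> (map \<epsilon> I) us (f a)) (f\<^sub>d a) \<in> mixed S F (int k) r"
    by (intro tens_mixed_in subS subF *)
qed

text \<open>The expansion of \<open>decompose_mixed\<close> writes \<open>\<kappa>\<close> with
  multivectors \<open>e_I\<close> and form parts \<open>\<kappa> (map \<epsilon> I)\<close>; each
  \<open>e_I\<close> is inserted into its form part.\<close>

definition Phi_formula where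
  "Phi_formula k \<kappa> = (1 / fact k) *\<^sub>R (\<Sum>I\<in>idx k. (\<lambda>us. \<kappa> (map \<epsilon> I) (map e I @ us)))"

text \<open>Same expansion as for \<open>Phi_formula\<close>: \<open>\<phi>\<close> is evaluated at
  \<open>e_I\<close>, and its value in the fibre is fed to the dual slot.\<close>

definition contr_formula where
  "contr_formula k \<kappa> \<phi> = (\<lambda>us. 1 / fact k * (\<Sum>I\<in>idx k. \<kappa> (map \<epsilon> I) us (\<phi> (map e I))))"

text \<open>The coefficients of \<open>g Us\<close> in the expansion over the basis are the values
  of the multivector on the dual basis. This is why the formulas have the prescribed values on
  decomposable elements.\<close>

lemma expand_wedge_vecs:
  assumes "g \<in> alt_maps S (int k) UNIV" "set Us \<subseteq> S" "length Us = k"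
  shows "1 / fact k * (\<Sum>I\<in>idx k. wedge_vecs S Us (map \<epsilon> I) * g (map e I)) = g Us"
proof -
  have "wedge_vecs S Us (map \<epsilon> I) = ndet k (\<lambda>i j. c (I ! i) (Us ! j))" if "I \<in> idx k" for I
    using multi_idx_length[OF that] assms multi_idx_map_subset[OF basis_on_dual[OF S] that]
    by (auto simp: wedge_vecs_def dual_vec_def subset_iff intro!: ndet_cong)
  then show ?thesis
    using alt_maps_expand[OF S assms] by simp
qed

lemma Phi_formula_linear:
  "linear_on (mixed S F (int k) r) (\<lambda>\<kappa>. if \<kappa> \<in> mixed S F (int k) r then Phi_formula k \<kappa> else 0)"
  by (rule linear_onI)
    (auto simp: subspace_comb[OF subspace_mixed[OF subF]] Phi_formula_def fun_eq_iff sum_fun_apply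
      sum.distrib sum_distrib_left algebra_simps)

lemma Phi_formula_tens:
  assumes *: "set Us \<subseteq> S" "length Us = k" "\<mu> \<in> alt_maps S r UNIV" "\<eta> \<in> dual_sp F"
  shows "Phi_formula k (tens_mixed S Us \<mu> \<eta>) = tens_dual (interior_mult Us \<mu>) \<eta>"
proof -
  have "Phi_formula k (tens_mixed S Us \<mu> \<eta>) us \<xi> = tens_dual (interior_mult Us \<mu>) \<eta> us \<xi>" for us \<xi>
  proof (cases "set us \<subseteq> S \<and> int (length us) = r - int k")
    case True
    have "1 / fact k * (\<Sum>I\<in>idx k. wedge_vecs S Us (map \<epsilon> I) * \<mu> (map e I @ us)) = \<mu> (Us @ us)"
      using * True by (intro expand_wedge_vecs alt_maps_append_right[of \<mu>]) auto
    then have "1 / fact k * (\<Sum>I\<in>idx k. wedge_vecs S Us (map \<epsilon> I) * \<mu> (map e I @ us)) * \<eta> \<xi> = \<mu> (Us @ us) * \<eta> \<xi>"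
      by simp
    then show ?thesis
      by (simp add: Phi_formula_def sum_fun_apply tens_mixed_def tens_dual_def interior_mult_def sum_distrib_right)
  next
    case False
    have "\<mu> (Vs @ us) = 0" if "length Vs = k" for Vs
      using * False that by (intro alt_maps_out[of \<mu>]) auto
    then show ?thesis using * multi_idx_length[of _ n k]
      by (simp add: Phi_formula_def sum_fun_apply tens_mixed_def tens_dual_def interior_mult_def)
  qed
  then show ?thesis by (simp add: fun_eq_iff)
qed

text \<open>Existence is \<open>Phi_formula_tens\<close>. For uniqueness,
  \<open>decompose_mixed\<close> writes \<open>\<kappa>\<close> in decomposable elements, on which
  \<open>L\<close> is prescribed.\<close>

lemma Phi_fibre_eq:
  "Phi_fibre S F k r = (\<lambda>\<kappa>. if \<kappa> \<in> mixed S F (int k) r then Phi_formula k \<kappa> else 0)"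
  unfolding Phi_fibre_def
proof (rule the_equality, intro conjI allI impI)
  show "linear_on (mixed S F (int k) r) (\<lambda>\<kappa>. if \<kappa> \<in> mixed S F (int k) r then Phi_formula k \<kappa> else 0)"
    by (rule Phi_formula_linear)
next
  fix Us and \<mu> :: "'v list \<Rightarrow> real" and \<eta>
  assume "set Us \<subseteq> S \<and> length Us = k \<and> \<mu> \<in> alt_maps S r UNIV \<and> \<eta> \<in> dual_sp F"
  then show "(if tens_mixed S Us \<mu> \<eta> \<in> mixed S F (int k) r then Phi_formula k (tens_mixed S Us \<mu> \<eta>) else 0) =
    tens_dual (interior_mult Us \<mu>) \<eta>"
    using Phi_formula_tens[of Us k \<mu> r \<eta>] tens_mixed_in[OF subS subF, of Us k \<mu> r \<eta>] by simp
next
  fix L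
  assume L: "linear_on (mixed S F (int k) r) L \<and> (\<forall>\<kappa>. \<kappa> \<notin> mixed S F (int k) r \<longrightarrow> L \<kappa> = 0) \<and>
    (\<forall>Us \<mu> \<eta>. set Us \<subseteq> S \<and> length Us = k \<and> \<mu> \<in> alt_maps S r UNIV \<and> \<eta> \<in> dual_sp F \<longrightarrow>
       L (tens_mixed S Us \<mu> \<eta>) = tens_dual (interior_mult Us \<mu>) \<eta>)"
  show "L = (\<lambda>\<kappa>. if \<kappa> \<in> mixed S F (int k) r then Phi_formula k \<kappa> else 0)"
  proof
    fix \<kappa>
    show "L \<kappa> = (if \<kappa> \<in> mixed S F (int k) r then Phi_formula k \<kappa> else 0)"
    proof (cases "\<kappa> \<in> mixed S F (int k) r")
      case True
      note d = decompose_mixed_in[OF True]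
      let ?A = "idx k \<times> {..<nF}"
      let ?t = "\<lambda>x. tens_mixed S (map e (fst x)) (\<lambda>us. \<kappa> (map \<epsilon> (fst x)) us (f (snd x))) (f\<^sub>d (snd x))"
      let ?v = "\<lambda>x. tens_dual (interior_mult (map e (fst x)) (\<lambda>us. \<kappa> (map \<epsilon> (fst x)) us (f (snd x)))) (f\<^sub>d (snd x))"
      have "L \<kappa> = L (\<Sum>x\<in>?A. (1 / fact k) *\<^sub>R ?t x)"
        using decompose_mixed[OF True] by (simp add: case_prod_unfold)
      also have "\<dots> = (\<Sum>x\<in>?A. (1 / fact k) *\<^sub>R L (?t x))"
        using L d(5) by (intro linear_on_sum[OF subspace_mixed[OF subF]]) auto
      also have "\<dots> = (\<Sum>x\<in>?A. (1 / fact k) *\<^sub>R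
          ?v x)"
        using L d(1-4) by (intro sum.cong refl arg_cong2[where f = scaleR]) auto
      also have "\<dots> = Phi_formula k \<kappa>"
      proof (intro ext)
        fix us \<xi>
        have "(\<Sum>x\<in>?A. (1 / fact k) *\<^sub>R
          ?v x) us \<xi> =
          (\<Sum>I\<in>idx k. (1 / fact k) * (\<Sum>a<nF. 1 *\<^sub>R tens_dual (\<lambda>us. \<kappa> (map \<epsilon> I) us (f a)) (f\<^sub>d a)) (map e I @ us) \<xi>)"
          by (simp add: sum_fun_apply tens_dual_def interior_mult_def sum.cartesian_product[symmetric] sum_distrib_left
              sum.cartesian_product case_prod_unfold)
        \<comment> \<open>The sum over \<open>a\<close> reassembles a functional on \<open>F\<close>
          from its values on the basis.\<close>
        also have "\<dots> = (\<Sum>I\<in>idx k. (1 / fact k) * \<kappa> (map \<epsilon> I) (map e I @ us) \<xi>)"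
          by (intro sum.cong refl arg_cong2[where f = "(*)"])
            (simp add: decompose_dual[OF mixed_apply_in[OF True], symmetric, simplified])
        finally show "(\<Sum>x\<in>?A. (1 / fact k) *\<^sub>R
          ?v x) us \<xi> =
           Phi_formula k \<kappa> us \<xi>"
          by (simp add: Phi_formula_def sum_fun_apply sum_distrib_left)
      qed
      finally show ?thesis using True by simp
    qed (use L in auto)
  qed
qed auto

lemma Phi_fibre_linear: "linear_on (mixed S F (int k) r) (Phi_fibre S F k r)"
  unfolding Phi_fibre_eq by (rule Phi_formula_linear)

text \<open>The pattern of \<open>Phi_fibre_eq\<close>, with both arguments decomposed for
  uniqueness.\<close>

lemma contr_eq:
  "contr S F k r = (\<lambda>\<kappa> \<phi>. if \<kappa> \<in> mixed S F (int k) r \<and> \<phi> \<in> alt_maps S (int k) F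
      then contr_formula k \<kappa> \<phi> else 0)"
  unfolding contr_def
proof (rule the_equality, intro conjI allI impI)
  let ?B = "\<lambda>\<kappa> \<phi>. if \<kappa> \<in> mixed S F (int k) r \<and> \<phi> \<in> alt_maps S (int k) F
      then contr_formula k \<kappa> \<phi> else 0"
  show "bilinear_on (mixed S F (int k) r) (alt_maps S (int k) F) ?B"
    unfolding bilinear_on_def
  proof (intro conjI ballI)
    fix \<phi> assume "\<phi> \<in> alt_maps S (int k) F"
    then show "linear_on (mixed S F (int k) r) (\<lambda>\<kappa>. ?B \<kappa> \<phi>)"
      by (intro linear_onI)
       (auto simp: subspace_comb[OF subspace_mixed[OF subF]] contr_formula_def fun_eq_iff
        sum.distrib sum_distrib_left algebra_simps)
  next
    fix \<kappa> assume \<kappa>: "\<kappa> \<in> mixed S F (int k) r"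
    show "linear_on (alt_maps S (int k) F) (?B \<kappa>)"
    proof (rule linear_onI)
      fix \<phi> \<psi> a b assume p: "\<phi> \<in> alt_maps S (int k) F" "\<psi> \<in> alt_maps S (int k) F"
      have "contr_formula k \<kappa> (a *\<^sub>R \<phi> + b *\<^sub>R \<psi>) us = (a *\<^sub>R contr_formula k \<kappa> \<phi> + b *\<^sub>R contr_formula k \<kappa> \<psi>) us" for us
      proof -
        have "\<kappa> (map \<epsilon> I) us (a *\<^sub>R \<phi> (map e I) + b *\<^sub>R \<psi> (map e I)) =
          a * \<kappa> (map \<epsilon> I) us (\<phi> (map e I)) + b * \<kappa> (map \<epsilon> I) us (\<psi> (map e I))"
          if I: "I \<in> idx k" for I
        proof -
          have "linear_on F (\<kappa> (map \<epsilon> I) us)"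
            using alt_dual_range[OF mixed_apply_in[OF \<kappa> I], of us] by (simp add: dual_sp_def)
          from linear_onD[OF this alt_range[OF p(1)] alt_range[OF p(2)]] show ?thesis by simp
        qed
        then show ?thesis
          by (simp add: contr_formula_def sum.distrib sum_distrib_left algebra_simps add_divide_distrib)
      qed
      then show "?B \<kappa> (a *\<^sub>R \<phi> + b *\<^sub>R \<psi>) = a *\<^sub>R ?B \<kappa> \<phi> + b *\<^sub>R ?B \<kappa> \<psi>"
        using p \<kappa> by (auto simp: subspace_comb[OF subspace_alt_maps[OF subF]] fun_eq_iff)
    qed
  qed
next
  fix Us and \<mu> \<omega> :: "'v list \<Rightarrow> real" and \<eta> \<xi>
  assume *: "set Us \<subseteq> S \<and> length Us = k \<and> \<mu> \<in> alt_maps S r UNIV \<and> \<eta> \<in> dual_sp F \<and>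
       \<omega> \<in> alt_maps S (int k) UNIV \<and> \<xi> \<in> F"
  have "contr_formula k (tens_mixed S Us \<mu> \<eta>) (tens_vec \<omega> \<xi>) us = (\<omega> Us * \<eta> \<xi>) * \<mu> us" for us
  proof -
    have "\<eta> (a *\<^sub>R \<xi>) = a * \<eta> \<xi>" for a
      using * linear_on_scale[of F \<eta> \<xi> a] by (simp add: dual_sp_def)
    moreover have "1 / fact k * (\<Sum>I\<in>idx k. wedge_vecs S Us (map \<epsilon> I) * \<omega> (map e I)) = \<omega> Us"
      using * by (intro expand_wedge_vecs) auto
    then have "1 / fact k * (\<Sum>I\<in>idx k. wedge_vecs S Us (map \<epsilon> I) * \<omega> (map e I)) * (\<eta> \<xi> * \<mu> us)
       = \<omega> Us * (\<eta> \<xi> * \<mu> us)" by simp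
    ultimately show ?thesis
      by (simp add: contr_formula_def tens_mixed_def tens_vec_def sum_distrib_left sum_distrib_right mult_ac)
  qed
  moreover have "tens_mixed S Us \<mu> \<eta> \<in> mixed S F (int k) r" "tens_vec \<omega> \<xi> \<in> alt_maps S (int k) F"
    using * by (auto intro!: tens_mixed_in tens_vec_in subS subF)
  ultimately show "(if tens_mixed S Us \<mu> \<eta> \<in> mixed S F (int k) r \<and> tens_vec \<omega> \<xi> \<in> alt_maps S (int k) F
     then contr_formula k (tens_mixed S Us \<mu> \<eta>) (tens_vec \<omega> \<xi>) else 0) = (\<omega> Us * \<eta> \<xi>) *\<^sub>R \<mu>"
    by (auto simp: fun_eq_iff)
next
  fix B
  assume B: "bilinear_on (mixed S F (int k) r) (alt_maps S (int k) F) B \<and>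
    (\<forall>\<kappa> \<phi>. \<not> (\<kappa> \<in> mixed S F (int k) r \<and> \<phi> \<in> alt_maps S (int k) F) \<longrightarrow> B \<kappa> \<phi> = 0) \<and>
    (\<forall>Us \<mu> \<eta> \<omega> \<xi>. set Us \<subseteq> S \<and> length Us = k \<and> \<mu> \<in> alt_maps S r UNIV \<and> \<eta> \<in> dual_sp F \<and>
       \<omega> \<in> alt_maps S (int k) UNIV \<and> \<xi> \<in> F \<longrightarrow>
       B (tens_mixed S Us \<mu> \<eta>) (tens_vec \<omega> \<xi>) = (\<omega> Us * \<eta> \<xi>) *\<^sub>R \<mu>)"
  show "B = (\<lambda>\<kappa> \<phi>. if \<kappa> \<in> mixed S F (int k) r \<and> \<phi> \<in> alt_maps S (int k) F
      then contr_formula k \<kappa> \<phi> else 0)"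
  proof (intro ext)
    fix \<kappa> \<phi> us
    show "B \<kappa> \<phi> us = (if \<kappa> \<in> mixed S F (int k) r \<and> \<phi> \<in> alt_maps S (int k) F
      then contr_formula k \<kappa> \<phi> else 0) us"
    proof (cases "\<kappa> \<in> mixed S F (int k) r \<and> \<phi> \<in> alt_maps S (int k) F")
      case True
      then have \<kappa>: "\<kappa> \<in> mixed S F (int k) r" and \<phi>: "\<phi> \<in> alt_maps S (int k) F" by auto
      note d = decompose_mixed_in[OF \<kappa>]
      let ?A = "idx k \<times> {..<nF}"
      let ?t = "\<lambda>x. tens_mixed S (map e (fst x)) (\<lambda>us. \<kappa> (map \<epsilon> (fst x)) us (f (snd x))) (f\<^sub>d (snd x))"
      let ?u = "\<lambda>b. tens_vec (\<lambda>us. cf b (\<phi> us)) (f b)"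
      have u: "?u b \<in> alt_maps S (int k) F" if "b < nF" for b
        using that \<phi> by (intro tens_vec_in coord_coeff_in subF basis_onD(2)[OF F])
      have "B \<kappa> \<phi> = B (\<Sum>x\<in>?A. (1 / fact k) *\<^sub>R ?t x) \<phi>"
        using decompose_mixed[OF \<kappa>] by (simp add: case_prod_unfold)
      also have "\<dots> = (\<Sum>x\<in>?A. (1 / fact k) *\<^sub>R B (?t x) \<phi>)"
        using B d(5) \<phi> by (intro linear_on_sum[OF subspace_mixed[OF subF], where f = "\<lambda>\<kappa>. B \<kappa> \<phi>"])
           (auto simp: bilinear_on_def)
      also have "\<dots> = (\<Sum>x\<in>?A. (1 / fact k) *\<^sub>R (\<Sum>b<nF. 1 *\<^sub>R B (?t x) (?u b)))"
      proof (intro sum.cong refl arg_cong2[where f = scaleR])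
        fix x assume "x \<in> ?A"
        then have "B (?t x) (\<Sum>b<nF. 1 *\<^sub>R ?u b) = (\<Sum>b<nF. 1 *\<^sub>R B (?t x) (?u b))"
          using B d(5) u
          by (intro linear_on_sum[OF subspace_alt_maps[OF subF], where f = "B (?t x)"])
            (auto simp: bilinear_on_def)
        then show "B (?t x) \<phi> = (\<Sum>b<nF. 1 *\<^sub>R B (?t x) (?u b))"
          using decompose_vec[OF \<phi>] by simp
      qed
      also have "\<dots> = (\<Sum>x\<in>?A. (1 / fact k) *\<^sub>R (\<Sum>b<nF. 1 *\<^sub>R
         (cf b (\<phi> (map e (fst x))) * f\<^sub>d (snd x) (f b)) *\<^sub>R (\<lambda>us. \<kappa> (map \<epsilon> (fst x)) us (f (snd x)))))"
        using B d(1-4) coord_coeff_in[OF \<phi>] basis_onD(2)[OF F]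
        by (intro sum.cong refl arg_cong2[where f = scaleR]) auto
      finally have "B \<kappa> \<phi> us = (\<Sum>I\<in>idx k. \<Sum>a<nF. (1 / fact k) * (\<Sum>b<nF.
         cf b (\<phi> (map e I)) * f\<^sub>d a (f b) * \<kappa> (map \<epsilon> I) us (f a)))"
        by (simp add: sum_fun_apply sum.cartesian_product case_prod_unfold)
      also have "\<dots> = (\<Sum>I\<in>idx k. (1 / fact k) * \<kappa> (map \<epsilon> I) us (\<phi> (map e I)))"
      proof (intro sum.cong refl)
        fix I assume I: "I \<in> idx k"
        \<comment> \<open>By duality of \<open>f\<close> and \<open>f\<^sub>d\<close> only
          \<open>b = a\<close> contributes; the sum over \<open>a\<close> then rebuilds the value of
          \<open>\<phi>\<close>.\<close>
        have "(\<Sum>b<nF. cf b (\<phi> (map e I)) * f\<^sub>d a (f b) * \<kappa> (map \<epsilon> I) us (f a)) =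
           cf a (\<phi> (map e I)) * \<kappa> (map \<epsilon> I) us (f a)" if "a < nF" for a
        proof -
          have "(\<Sum>b<nF. cf b (\<phi> (map e I)) * f\<^sub>d a (f b) * \<kappa> (map \<epsilon> I) us (f a)) =
            (\<Sum>b<nF. if a = b then cf a (\<phi> (map e I)) * \<kappa> (map \<epsilon> I) us (f a) else 0)"
            using that by (intro sum.cong refl) (auto simp: dual_vec_def basis_onD[OF F])
          then show ?thesis using that by simp
        qed
        moreover have "\<kappa> (map \<epsilon> I) us (\<Sum>a<nF. cf a (\<phi> (map e I)) *\<^sub>R f a) = (\<Sum>a<nF. cf a (\<phi> (map e I)) *\<^sub>R \<kappa> (map \<epsilon> I) us (f a))"
          using alt_dual_range[OF mixed_apply_in[OF \<kappa> I], of us]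
          by (intro linear_on_sum[OF subF]) (auto simp: dual_sp_def basis_onD[OF F])
        then have "\<kappa> (map \<epsilon> I) us (\<phi> (map e I)) = (\<Sum>a<nF. cf a (\<phi> (map e I)) *\<^sub>R \<kappa> (map \<epsilon> I) us (f a))"
          using basis_onD(4)[OF F alt_range[OF \<phi>], of "map e I"] by simp
        ultimately show "(\<Sum>a<nF. (1 / fact k) * (\<Sum>b<nF.
         cf b (\<phi> (map e I)) * f\<^sub>d a (f b) * \<kappa> (map \<epsilon> I) us (f a))) = (1 / fact k) * \<kappa> (map \<epsilon> I) us (\<phi> (map e I))"
          by (simp add: sum_distrib_left)
      qed
      finally show ?thesis using True by (simp add: contr_formula_def sum_distrib_left)
    qed (use B in auto)
  qed
qed auto

end

section \<open>Permuted lists, antisymmetrisation and the counting of shuffles\<close>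

lemma permute_list_update:
  assumes "p permutes {..<length us}" "q < length us"
  shows "permute_list p (us[q := v]) = (permute_list p us)[inv p q := v]"
proof (rule nth_equalityI)
  fix i assume "i < length (permute_list p (us[q := v]))"
  then have i: "i < length us" by simp
  then have "p i < length us" using permutes_in_image[OF assms(1), of i] by simp
  \<comment> \<open>Position \<open>i\<close> of the permuted list holds entry \<open>p i\<close>,
    so entry \<open>q\<close> sits at position \<open>inv p q\<close>.\<close>
  moreover have "p i = q \<longleftrightarrow> i = inv p q"
    using permutes_inverses[OF assms(1)] by metis
  ultimately show "permute_list p (us[q := v]) ! i = (permute_list p us)[inv p q := v] ! i"
    using i assms by (auto simp: permute_list_def nth_list_update)
qed simp

text \<open>If two arguments agree, precomposing each permutation with their transposition leaves
  the list unchanged and reverses the sign, so the sum equals its negative.\<close>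

lemma alternatization_in:
  fixes G :: "'v::real_vector list \<Rightarrow> real"
  assumes S: "subspace S"
    and G: "\<And>vs q. set vs \<subseteq> S \<Longrightarrow> length vs = n \<Longrightarrow> q < n \<Longrightarrow> linear_on S (\<lambda>v. G (vs[q := v]))"
  shows "(\<lambda>us. if set us \<subseteq> S \<and> length us = n
    then \<Sum>p | p permutes {..<n}. of_int (sign p) * G (permute_list p us) else 0) \<in> alt_maps S (int n) UNIV"
    (is "?H \<in> _")
proof (rule alt_mapsI[OF S])
  fix vs q
  assume vs: "set vs \<subseteq> S" "int (length vs) = int n" "q < length vs"
  have S': "set (vs[q := v]) \<subseteq> S" if "v \<in> S" for v
    using that vs set_update_subset_insert[of vs q v] by auto
  have "linear_on S (\<lambda>v. \<Sum>p | p permutes {..<n}. of_int (sign p) *\<^sub>R G (permute_list p (vs[q := v])))"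
  proof (intro linear_on_sum_fun linear_on_scaleR_const)
    fix p assume "p \<in> {p. p permutes {..<n}}"
    then have p: "p permutes {..<length vs}" using vs by simp
    then have "inv p q < n"
      using permutes_in_image[OF permutes_inv[OF p], of q] vs by simp
    then have "linear_on S (\<lambda>v. G ((permute_list p vs)[inv p q := v]))"
      using vs p by (intro G) (auto simp: set_permute_list)
    then show "linear_on S (\<lambda>v. G (permute_list p (vs[q := v])))"
      using permute_list_update[OF p vs(3)] by simp
  qed
  then show "linear_on S (\<lambda>v. ?H (vs[q := v]))"
    using S' vs by (auto simp: linear_on_def subspace_comb[OF S])
next
  fix vs i j
  assume vs: "set vs \<subseteq> S" "int (length vs) = int n" "i < j" "j < length vs" "vs ! i = vs ! j"
  let ?t = "Transposition.transpose i j"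
  let ?s = "\<Sum>p | p permutes {..<n}. of_int (sign p) * G (permute_list p vs)"
  have t: "?t permutes {..<n}" using vs by (intro permutes_swap_id) auto
  have "?s = (\<Sum>p | p permutes {..<n}. of_int (sign (?t \<circ> p)) * G (permute_list (?t \<circ> p) vs))"
    by (rule setum_permutations_compose_left[OF t])
  also have "\<dots> = (\<Sum>p | p permutes {..<n}. - (of_int (sign p) * G (permute_list p vs)))"
  proof (intro sum.cong refl)
    fix p assume "p \<in> {p. p permutes {..<n}}"
    then have p: "p permutes {..<n}" by simp
    have "permute_list (?t \<circ> p) vs = permute_list p (permute_list ?t vs)"
      using p vs by (intro permute_list_compose) auto
    also have "permute_list ?t vs = vs"
      using vs list_update_id[of vs i] by (subst permute_list_transpose) auto
    finally have "permute_list (?t \<circ> p) vs = permute_list p vs" .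
    moreover have "sign (?t \<circ> p) = - sign p"
      using p vs by (subst sign_compose)
        (auto simp: sign_swap_id permutation_swap_id intro: permutation_permutes[THEN iffD2])
    ultimately show "of_int (sign (?t \<circ> p)) * G (permute_list (?t \<circ> p) vs) = - (of_int (sign p) * G (permute_list p vs))"
      by (simp add: o_def)
  qed
  finally have "?s = 0" by (simp add: sum_negf)
  then show "?H vs = 0" by simp
qed auto

text \<open>Such a permutation amounts to an ordering of \<open>A\<close> on the first
  \<open>k\<close> places and one of the complement on the others. The count cancels the denominator
  of \<open>wedge_form\<close>.\<close>

lemma card_permutes_take:
  assumes A: "A \<subseteq> {..<n}" "card A = k"
  shows "card {p. p permutes {..<n} \<and> set (take k (map p [0..<n])) = A} = fact k * fact (n - k)"
proof -
  let ?B = "{..<n} - A"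
  have fin: "finite A" "finite ?B" using A finite_subset by auto
  have kn: "k \<le> n" using A card_mono[of "{..<n}" A] by simp
  have "bij_betw (\<lambda>p. (take k (map p [0..<n]), drop k (map p [0..<n])))
    {p. p permutes {..<n} \<and> set (take k (map p [0..<n])) = A} (permutations_of_set A \<times> permutations_of_set ?B)"
  proof (rule bij_betw_byWitness[where f' = "\<lambda>(xs, ys) i. if i < n then (xs @ ys) ! i else i"])
    show "\<forall>p\<in>{p. p permutes {..<n} \<and> set (take k (map p [0..<n])) = A}.
       (case (take k (map p [0..<n]), drop k (map p [0..<n])) of (xs, ys) \<Rightarrow> \<lambda>i. if i < n then (xs @ ys) ! i else i) = p"
      unfolding prod.case append_take_drop_id by (auto simp: fun_eq_iff permutes_not_in)
    have *: "map (\<lambda>i. if i < n then (xs @ ys) ! i else i) [0..<n] = xs @ ys \<and> length xs = k"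
      if "xs \<in> permutations_of_set A" "ys \<in> permutations_of_set ?B" for xs ys
    proof -
      have "length xs = k" using that(1) A by (auto simp: permutations_of_set_def distinct_card)
      moreover have "length ys = n - k"
        using that(2) A fin by (auto simp: permutations_of_set_def card_Diff_subset simp flip: distinct_card)
      ultimately show ?thesis using kn by (auto intro!: nth_equalityI)
    qed
    then show "\<forall>x\<in>permutations_of_set A \<times> permutations_of_set ?B.
       (take k (map (case x of (xs, ys) \<Rightarrow> \<lambda>i. if i < n then (xs @ ys) ! i else i) [0..<n]),
        drop k (map (case x of (xs, ys) \<Rightarrow> \<lambda>i. if i < n then (xs @ ys) ! i else i) [0..<n])) = x"
      by simp
    show "(\<lambda>p. (take k (map p [0..<n]), drop k (map p [0..<n]))) `
      {p. p permutes {..<n} \<and> set (take k (map p [0..<n])) = A} \<subseteq> permutations_of_set A \<times> permutations_of_set ?B"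
    proof
      fix x assume "x \<in> (\<lambda>p. (take k (map p [0..<n]), drop k (map p [0..<n]))) `
      {p. p permutes {..<n} \<and> set (take k (map p [0..<n])) = A}"
      then obtain p where p: "p permutes {..<n}" "set (take k (map p [0..<n])) = A"
        and x: "x = (take k (map p [0..<n]), drop k (map p [0..<n]))" by auto
      let ?P = "map p [0..<n]"
      have d: "distinct ?P" using p(1) by (auto simp: distinct_map permutes_inj_on)
      have s: "set ?P = {..<n}" using permutes_image[OF p(1)] by (auto simp: atLeast0LessThan)
      have "set (take k ?P) \<union> set (drop k ?P) = {..<n}"
        using s by (metis append_take_drop_id set_append)
      moreover have "set (take k ?P) \<inter> set (drop k ?P) = {}"
        using d by (metis append_take_drop_id distinct_append)
      ultimately have "set (drop k ?P) = ?B" using p(2) by blast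
      then show "x \<in> permutations_of_set A \<times> permutations_of_set ?B"
        using d p(2) x by (auto simp del: take_map drop_map simp: permutations_of_set_def)
    qed
    show "(\<lambda>(xs, ys) i. if i < n then (xs @ ys) ! i else i) ` (permutations_of_set A \<times> permutations_of_set ?B)
      \<subseteq> {p. p permutes {..<n} \<and> set (take k (map p [0..<n])) = A}"
    proof
      fix p assume "p \<in> (\<lambda>(xs, ys) i. if i < n then (xs @ ys) ! i else i) ` (permutations_of_set A \<times> permutations_of_set ?B)"
      then obtain xs ys where xy: "xs \<in> permutations_of_set A" "ys \<in> permutations_of_set ?B"
        and p: "p = (\<lambda>i. if i < n then (xs @ ys) ! i else i)" by auto
      have z: "distinct (xs @ ys)" "set (xs @ ys) = {..<n}"
        using xy A by (auto simp: permutations_of_set_def)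
      then have "length (xs @ ys) = n" by (metis card_lessThan distinct_card)
      then have "bij_betw ((!) (xs @ ys)) {..<n} {..<n}"
        using z by (intro bij_betw_nth) auto
      then have "bij_betw p {..<n} {..<n}"
        by (subst bij_betw_cong[where g = "(!) (xs @ ys)"]) (auto simp: p)
      then have "p permutes {..<n}" by (rule bij_imp_permutes) (auto simp: p)
      moreover have "set (take k (map p [0..<n])) = A"
        using *[OF xy] xy by (simp add: p permutations_of_set_def del: take_map)
      ultimately show "p \<in> {p. p permutes {..<n} \<and> set (take k (map p [0..<n])) = A}" by simp
    qed
  qed
  from bij_betw_same_card[OF this] show ?thesis
    using A fin by (simp add: card_cartesian_product card_Diff_subset)
qed

section \<open>The wedge product in a basis\<close>

context based_fibre
begin

text \<open>\<open>wedge_form\<close> with the product of the two scalar factors replaced by the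
  pairing of the dual value with the fibre value.\<close>

definition wedge_formula where
  "wedge_formula k l \<phi> \<alpha> = (\<lambda>us. (\<Sum>p | p permutes {..<length us}. of_int (sign p) *
        \<alpha> (drop k (permute_list p us)) (\<phi> (take k (permute_list p us)))) / (fact k * fact (nat l)))"

text \<open>As for \<open>contr_eq\<close>: decomposing both factors over the basis of
  \<open>F\<close> leaves a double sum whose off-diagonal terms vanish by duality.\<close>

lemma wedge_eq:
  "wedge S F k l = (\<lambda>\<phi> \<alpha>. if \<phi> \<in> alt_maps S (int k) F \<and> \<alpha> \<in> alt_maps S l (dual_sp F)
      then wedge_formula k l \<phi> \<alpha> else 0)"
  unfolding wedge_def
proof (rule the_equality, intro conjI allI impI)
  let ?B = "\<lambda>\<phi> \<alpha>. if \<phi> \<in> alt_maps S (int k) F \<and> \<alpha> \<in> alt_maps S l (dual_sp F)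
      then wedge_formula k l \<phi> \<alpha> else 0"
  show "bilinear_on (alt_maps S (int k) F) (alt_maps S l (dual_sp F)) ?B"
    unfolding bilinear_on_def
  proof (intro conjI ballI)
    fix \<phi> assume "\<phi> \<in> alt_maps S (int k) F"
    then show "linear_on (alt_maps S l (dual_sp F)) (?B \<phi>)"
      by (intro linear_onI)
       (auto simp: subspace_comb[OF subspace_alt_maps[OF subspace_dual_sp[OF subF]]] wedge_formula_def fun_eq_iff
        sum.distrib sum_distrib_left algebra_simps add_divide_distrib)
  next
    fix \<alpha> assume \<alpha>: "\<alpha> \<in> alt_maps S l (dual_sp F)"
    show "linear_on (alt_maps S (int k) F) (\<lambda>\<phi>. ?B \<phi> \<alpha>)"
    proof (rule linear_onI)
      fix \<phi> \<psi> a b assume p: "\<phi> \<in> alt_maps S (int k) F" "\<psi> \<in> alt_maps S (int k) F"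
      have "\<alpha> vs (a *\<^sub>R \<phi> us + b *\<^sub>R \<psi> us) = a * \<alpha> vs (\<phi> us) + b * \<alpha> vs (\<psi> us)" for vs us
      proof -
        have "linear_on F (\<alpha> vs)"
          using alt_dual_range[OF \<alpha>, of vs] by (simp add: dual_sp_def)
        from linear_onD[OF this alt_range[OF p(1)] alt_range[OF p(2)]] show ?thesis by simp
      qed
      then show "?B (a *\<^sub>R \<phi> + b *\<^sub>R \<psi>) \<alpha> = a *\<^sub>R ?B \<phi> \<alpha> + b *\<^sub>R ?B \<psi> \<alpha>"
        using p \<alpha> by (auto simp: subspace_comb[OF subspace_alt_maps[OF subF]] fun_eq_iff
            wedge_formula_def sum.distrib sum_distrib_left algebra_simps add_divide_distrib)
    qed
  qed
next
  fix \<omega> \<theta> :: "'v list \<Rightarrow> real" and \<xi> \<eta>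
  assume *: "\<omega> \<in> alt_maps S (int k) UNIV \<and> \<xi> \<in> F \<and> \<theta> \<in> alt_maps S l UNIV \<and> \<eta> \<in> dual_sp F"
  have "\<eta> (a *\<^sub>R \<xi>) = a * \<eta> \<xi>" for a
    using * linear_on_scale[of F \<eta> \<xi> a] by (simp add: dual_sp_def)
  then have "wedge_formula k l (tens_vec \<omega> \<xi>) (tens_dual \<theta> \<eta>) = \<eta> \<xi> *\<^sub>R wedge_form k l \<omega> \<theta>"
    by (simp add: fun_eq_iff wedge_formula_def wedge_form_def tens_vec_def tens_dual_def sum_distrib_left mult_ac)
  moreover have "tens_vec \<omega> \<xi> \<in> alt_maps S (int k) F" "tens_dual \<theta> \<eta> \<in> alt_maps S l (dual_sp F)"
    using * by (auto intro!: tens_dual_in tens_vec_in subF)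
  ultimately show "(if tens_vec \<omega> \<xi> \<in> alt_maps S (int k) F \<and> tens_dual \<theta> \<eta> \<in> alt_maps S l (dual_sp F)
      then wedge_formula k l (tens_vec \<omega> \<xi>) (tens_dual \<theta> \<eta>) else 0) = \<eta> \<xi> *\<^sub>R wedge_form k l \<omega> \<theta>"
    by simp
next
  fix B
  assume B: "bilinear_on (alt_maps S (int k) F) (alt_maps S l (dual_sp F)) B \<and>
    (\<forall>\<phi> \<alpha>. \<not> (\<phi> \<in> alt_maps S (int k) F \<and> \<alpha> \<in> alt_maps S l (dual_sp F)) \<longrightarrow> B \<phi> \<alpha> = 0) \<and>
    (\<forall>\<omega> \<xi> \<theta> \<eta>. \<omega> \<in> alt_maps S (int k) UNIV \<and> \<xi> \<in> F \<and>
       \<theta> \<in> alt_maps S l UNIV \<and> \<eta> \<in> dual_sp F \<longrightarrow>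
       B (tens_vec \<omega> \<xi>) (tens_dual \<theta> \<eta>) = \<eta> \<xi> *\<^sub>R wedge_form k l \<omega> \<theta>)"
  show "B = (\<lambda>\<phi> \<alpha>. if \<phi> \<in> alt_maps S (int k) F \<and> \<alpha> \<in> alt_maps S l (dual_sp F)
      then wedge_formula k l \<phi> \<alpha> else 0)"
  proof (intro ext)
    fix \<phi> \<alpha> us
    show "B \<phi> \<alpha> us = (if \<phi> \<in> alt_maps S (int k) F \<and> \<alpha> \<in> alt_maps S l (dual_sp F)
      then wedge_formula k l \<phi> \<alpha> else 0) us"
    proof (cases "\<phi> \<in> alt_maps S (int k) F \<and> \<alpha> \<in> alt_maps S l (dual_sp F)")
      case True
      then have \<phi>: "\<phi> \<in> alt_maps S (int k) F" and \<alpha>: "\<alpha> \<in> alt_maps S l (dual_sp F)" by auto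
      let ?u = "\<lambda>b. tens_vec (\<lambda>us. cf b (\<phi> us)) (f b)"
      let ?w = "\<lambda>a. tens_dual (\<lambda>us. \<alpha> us (f a)) (f\<^sub>d a)"
      have u: "?u b \<in> alt_maps S (int k) F" if "b < nF" for b
        using that \<phi> by (intro tens_vec_in coord_coeff_in subF basis_onD(2)[OF F])
      have w: "?w a \<in> alt_maps S l (dual_sp F)" if "a < nF" for a
        using that \<alpha> by (intro tens_dual_in dual_coeff_in subF dual_vec_in[OF F])
      have "B \<phi> \<alpha> = B (\<Sum>b<nF. 1 *\<^sub>R ?u b) \<alpha>"
        using decompose_vec[OF \<phi>] by simp
      also have "\<dots> = (\<Sum>b<nF. 1 *\<^sub>R B (?u b) \<alpha>)"
        using B u \<alpha> by (intro linear_on_sum[OF subspace_alt_maps[OF subF], where f = "\<lambda>\<phi>. B \<phi> \<alpha>"])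
           (auto simp: bilinear_on_def)
      also have "\<dots> = (\<Sum>b<nF. 1 *\<^sub>R (\<Sum>a<nF. 1 *\<^sub>R B (?u b) (?w a)))"
      proof (intro sum.cong refl arg_cong2[where f = scaleR])
        fix b assume "b \<in> {..<nF}"
        then have "B (?u b) (\<Sum>a<nF. 1 *\<^sub>R ?w a) = (\<Sum>a<nF. 1 *\<^sub>R B (?u b) (?w a))"
          using B u w
          by (intro linear_on_sum[OF subspace_alt_maps[OF subspace_dual_sp[OF subF]], where f = "B (?u b)"])
            (auto simp: bilinear_on_def)
        then show "B (?u b) \<alpha> = (\<Sum>a<nF. 1 *\<^sub>R B (?u b) (?w a))"
          using decompose_dual[OF \<alpha>] by simp
      qed
      also have "\<dots> = (\<Sum>b<nF. 1 *\<^sub>R (\<Sum>a<nF. 1 *\<^sub>R f\<^sub>d a (f b) *\<^sub>R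
          wedge_form k l (\<lambda>us. cf b (\<phi> us)) (\<lambda>us. \<alpha> us (f a))))"
        using B coord_coeff_in[OF \<phi>] dual_coeff_in[OF \<alpha>] basis_onD(2)[OF F] dual_vec_in[OF F]
        by (intro sum.cong refl arg_cong2[where f = scaleR]) auto
      also have "\<dots> = (\<Sum>b<nF. wedge_form k l (\<lambda>us. cf b (\<phi> us)) (\<lambda>us. \<alpha> us (f b)))"
      proof (intro sum.cong refl)
        fix b assume b: "b \<in> {..<nF}"
        have "(\<Sum>a<nF. 1 *\<^sub>R f\<^sub>d a (f b) *\<^sub>R wedge_form k l (\<lambda>us. cf b (\<phi> us)) (\<lambda>us. \<alpha> us (f a))) =
          (\<Sum>a<nF. if b = a then wedge_form k l (\<lambda>us. cf b (\<phi> us)) (\<lambda>us. \<alpha> us (f b)) else 0)"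
          using b by (intro sum.cong refl) (auto simp: dual_vec_def basis_onD[OF F])
        then show "1 *\<^sub>R (\<Sum>a<nF. 1 *\<^sub>R f\<^sub>d a (f b) *\<^sub>R wedge_form k l (\<lambda>us. cf b (\<phi> us)) (\<lambda>us. \<alpha> us (f a))) =
          wedge_form k l (\<lambda>us. cf b (\<phi> us)) (\<lambda>us. \<alpha> us (f b))"
          using b by simp
      qed
      finally have "B \<phi> \<alpha> us = (\<Sum>p | p permutes {..<length us}. of_int (sign p) *
        (\<Sum>b<nF. cf b (\<phi> (take k (permute_list p us))) * \<alpha> (drop k (permute_list p us)) (f b))) / (fact k * fact (nat l))"
        by (simp add: sum_fun_apply wedge_form_def sum_divide_distrib[symmetric] sum_distrib_left mult.assoc
            sum.swap[of _ "{p. p permutes {..<length us}}"])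
      moreover have "(\<Sum>b<nF. cf b (\<phi> vs) * \<alpha> ws (f b)) = \<alpha> ws (\<phi> vs)" for vs ws
      proof -
        have "\<alpha> ws (\<Sum>b<nF. cf b (\<phi> vs) *\<^sub>R f b) = (\<Sum>b<nF. cf b (\<phi> vs) *\<^sub>R \<alpha> ws (f b))"
          using alt_dual_range[OF \<alpha>, of ws]
          by (intro linear_on_sum[OF subF]) (auto simp: dual_sp_def basis_onD[OF F])
        then show ?thesis using basis_onD(4)[OF F alt_range[OF \<phi>], of vs] by simp
      qed
      ultimately show ?thesis using True by (simp add: wedge_formula_def)
    qed (use B in auto)
  qed
qed auto

subsection \<open>Wedge product with an interior product\<close>

text \<open>A summand survives only if the first \<open>k\<close> places carry exactly the indices
  in \<open>I\<close>; otherwise a basis vector is repeated in \<open>\<mu>\<close>. The surviving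
  summands are all equal: the sign of \<open>p\<close> occurs twice, and the sign of reordering the
  first block into \<open>I\<close> is common to \<open>\<mu>\<close> and \<open>\<phi>\<close>.
  Their number is \<open>fact k * fact (n - k)\<close>.\<close>

lemma wedge_interior_basis:
  assumes \<mu>: "\<mu> \<in> alt_maps S (int n) (dual_sp F)" and \<phi>: "\<phi> \<in> alt_maps S (int k) F"
    and I: "I \<in> idx k" "distinct I"
  shows "(\<Sum>p | p permutes {..<n}. of_int (sign p) *
        \<mu> (map e I @ drop k (permute_list p (map e [0..<n]))) (\<phi> (take k (permute_list p (map e [0..<n]))))) =
     fact k * fact (n - k) * \<mu> (map e [0..<n]) (\<phi> (map e I))"
proof -
  let ?E = "map e [0..<n]"
  have IS: "set I \<subseteq> {..<n}" "length I = k" "card (set I) = k"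
    using I by (auto simp: multi_idx_def distinct_card)
  have kn: "k \<le> n" using IS card_mono[of "{..<n}" "set I"] by simp
  have eS: "set (map e J) \<subseteq> S" if "set J \<subseteq> {..<n}" for J
    using that basis_onD(2)[OF S] by auto
  have term_eq: "of_int (sign p) * \<mu> (map e I @ drop k (permute_list p ?E)) (\<phi> (take k (permute_list p ?E))) =
     (if set (take k (map p [0..<n])) = set I then \<mu> ?E (\<phi> (map e I)) else 0)"
    if p: "p permutes {..<n}" for p
  proof -
    let ?P = "map p [0..<n]"
    have PE: "permute_list p ?E = map e ?P"
      using permutes_in_image[OF p] by (auto simp: permute_list_def)
    have d: "distinct ?P" using p by (auto simp: distinct_map permutes_inj_on)
    have s: "set ?P = {..<n}" using permutes_image[OF p] by (auto simp: atLeast0LessThan)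
    have un: "set (take k ?P) \<union> set (drop k ?P) = {..<n}"
      using s by (metis append_take_drop_id set_append)
    have dt: "distinct (take k ?P)" "length (take k ?P) = k" using d kn by auto
    have ct: "card (set (take k ?P)) = k" using distinct_card[OF dt(1)] dt(2) by simp
    have ld: "length (drop k ?P) = n - k" by simp
    show ?thesis
    proof (cases "set (take k ?P) = set I")
      case False
      \<comment> \<open>Otherwise \<open>I\<close> would lie in the first \<open>k\<close> places
        and exhaust them by cardinality.\<close>
      have "set I \<inter> set (drop k ?P) \<noteq> {}"
      proof
        assume "set I \<inter> set (drop k ?P) = {}"
        then have "set I \<subseteq> set (take k ?P)" using un IS(1) by blast
        then show False using False ct IS(3) card_subset_eq[of "set (take k ?P)" "set I"] by auto
      qed
      then have "\<not> distinct (map e (I @ drop k ?P))"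
        by (auto simp: distinct_map)
      then have "\<mu> (map e I @ drop k (map e ?P)) = 0"
        using alt_maps_not_distinct[OF \<mu>] by (simp add: drop_map del: map_map)
      then show ?thesis using False PE by (simp del: map_map)
    next
      case True
      then have "mset I = mset (take k ?P)"
        using I(2) dt(1) by (metis set_eq_iff_mset_eq_distinct)
      then obtain q where q: "q permutes {..<length (take k ?P)}" "permute_list q (take k ?P) = I"
        by (rule mset_eq_permutation)
      let ?T = "map e (take k ?P)" and ?D = "map e (drop k ?P)"
      have TS: "set ?T \<subseteq> S" "set ?D \<subseteq> S"
        using un eS[of "take k ?P"] eS[of "drop k ?P"] by blast+
      have q': "q permutes {..<length ?T}" using q(1) by simp
      have eI: "map e I = permute_list q ?T"
        using q permute_list_map[OF q(1), of e] by simp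
      have "\<phi> (map e I) = of_int (sign q) *\<^sub>R \<phi> ?T"
        unfolding eI using kn by (intro alt_maps_permute[OF \<phi> TS(1) _ subS q']) simp
      moreover have "(\<lambda>us. \<mu> (us @ ?D)) \<in> alt_maps S (int k) (dual_sp F)"
        using TS kn subspace_0[OF subspace_dual_sp[OF subF]] ld by (intro alt_maps_append_right[OF \<mu>]) auto
      then have "\<mu> (map e I @ ?D) = of_int (sign q) *\<^sub>R \<mu> (?T @ ?D)"
        unfolding eI using kn by (intro alt_maps_permute[OF _ TS(1) _ subS q']) simp_all
      moreover have "\<mu> (?T @ ?D) = of_int (sign p) *\<^sub>R \<mu> ?E"
      proof -
        have "?T @ ?D = permute_list p ?E" unfolding PE by (metis append_take_drop_id map_append)
        moreover have "\<mu> (permute_list p ?E) = of_int (sign p) *\<^sub>R \<mu> ?E"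
          using p by (intro alt_maps_permute[OF \<mu> eS _ subS]) auto
        ultimately show ?thesis by simp
      qed
      moreover have "\<mu> ?E (a *\<^sub>R \<phi> ?T) = a * \<mu> ?E (\<phi> ?T)" for a
        using alt_dual_range[OF \<mu>, of ?E] linear_on_scale[of F "\<mu> ?E" "\<phi> ?T" a] alt_range[OF \<phi>, of ?T]
        by (simp add: dual_sp_def)
      moreover have "real_of_int (sign p) * real_of_int (sign p) = 1" "real_of_int (sign q) * real_of_int (sign q) = 1"
        by (simp_all flip: of_int_mult)
      ultimately show ?thesis using True unfolding PE
        by (simp add: take_map drop_map mult_ac del: map_map)
    qed
  qed
  have "(\<Sum>p | p permutes {..<n}. of_int (sign p) *
        \<mu> (map e I @ drop k (permute_list p ?E)) (\<phi> (take k (permute_list p ?E)))) =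
     (\<Sum>p | p permutes {..<n}. if set (take k (map p [0..<n])) = set I then \<mu> ?E (\<phi> (map e I)) else 0)"
    by (intro sum.cong refl term_eq) simp
  also have "\<dots> = (\<Sum>p\<in>{p. p permutes {..<n} \<and> set (take k (map p [0..<n])) = set I}. \<mu> ?E (\<phi> (map e I)))"
    by (simp add: sum.inter_filter[symmetric] finite_permutations)
  also have "\<dots> = fact k * fact (n - k) * \<mu> ?E (\<phi> (map e I))"
    using card_permutes_take[OF IS(1,3)] by simp
  finally show ?thesis .
qed

text \<open>The identity \<open>\<phi> \<and> i\<^sub>W \<mu> = \<phi>(W) \<mu>\<close>: both sides are alternating in \<open>us\<close> and in \<open>W\<close>, which
  reduces it to basis vectors.\<close>

lemma wedge_interior:
  assumes \<mu>: "\<mu> \<in> alt_maps S (int n) (dual_sp F)" and \<phi>: "\<phi> \<in> alt_maps S (int k) F" and kn: "k \<le> n"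
    and W: "set W \<subseteq> S" "length W = k" and us: "set us \<subseteq> S" "length us = n"
  shows "(\<Sum>p | p permutes {..<n}. of_int (sign p) *
        \<mu> (W @ drop k (permute_list p us)) (\<phi> (take k (permute_list p us)))) =
     fact k * fact (n - k) * \<mu> us (\<phi> W)"
proof -
  \<comment> \<open>\<open>H\<close> keeps both arguments variable: it is antisymmetric in
    \<open>us\<close> for fixed \<open>W\<close>, even though the two blocks of \<open>us\<close>
    enter different maps.\<close>
  define H where "H = (\<lambda>W us. if set us \<subseteq> S \<and> length us = n
    then \<Sum>p | p permutes {..<n}. of_int (sign p) *
        \<mu> (W @ drop k (permute_list p us)) (\<phi> (take k (permute_list p us))) else 0)"
  have D0: "0 \<in> dual_sp F" by (rule subspace_0[OF subspace_dual_sp[OF subF]])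
  have H_in: "H V \<in> alt_maps S (int n) UNIV" if V: "set V \<subseteq> S" "length V = k" for V
    unfolding H_def
  proof (rule alternatization_in[OF subS])
    fix vs q
    assume vs: "set vs \<subseteq> S" "length vs = n" "q < n"
    show "linear_on S (\<lambda>v. \<mu> (V @ drop k (vs[q := v])) (\<phi> (take k (vs[q := v]))))"
    \<comment> \<open>The varied position belongs either to the block passed to
      \<open>\<phi>\<close> or to the one passed to \<open>\<mu>\<close>.\<close>
    proof (cases "q < k")
      case True
      have "linear_on S (\<lambda>v. \<phi> ((take k vs)[q := v]))"
        using vs kn True by (intro alt_maps_linear_update[OF \<phi>]) (auto dest: in_set_takeD)
      moreover have "linear_on F (\<mu> (V @ drop k vs))"
        using alt_dual_range[OF \<mu>] by (auto simp: dual_sp_def)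
      ultimately have "linear_on S (\<lambda>v. \<mu> (V @ drop k vs) (\<phi> ((take k vs)[q := v])))"
        by (rule linear_on_compose) (auto simp: alt_range[OF \<phi>])
      then show ?thesis using True by (simp add: take_update_swap drop_update_cancel)
    next
      case False
      have "linear_on S (\<lambda>v. \<mu> ((V @ drop k vs)[q := v]))"
        using vs V kn False by (intro alt_maps_linear_update[OF \<mu>]) (auto dest: in_set_dropD)
      then have "linear_on S (\<lambda>v. \<mu> ((V @ drop k vs)[q := v]) (\<phi> (take k vs)))"
        by (rule linear_on_compose[OF _ linear_on_apply[of UNIV]]) simp
      then show ?thesis using False V by (simp add: list_update_append drop_update_swap)
    qed
  qed
  have R_in: "(\<lambda>us. (fact k * fact (n - k)) *\<^sub>R \<mu> us \<xi>) \<in> alt_maps S (int n) UNIV" for \<xi>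
    using subspace_scale[OF subspace_alt_maps[of UNIV] dual_coeff_in[OF \<mu>], of "fact k * fact (n - k)" \<xi>]
    by (simp add: scaleR_fun_def)
  let ?E = "map e [0..<n]"
  have E: "set ?E \<subseteq> S" using basis_onD(2)[OF S] by auto
  \<comment> \<open>A form of top degree is determined by one value: a distinct multi-index of
    length \<open>n\<close> is a permutation of all indices.\<close>
  have top: "g = h" if "g \<in> alt_maps S (int n) UNIV" "h \<in> alt_maps S (int n) UNIV" "g ?E = h ?E" for g h :: "_ \<Rightarrow> real"
  proof (rule alt_maps_eqI[OF S that(1,2)])
    fix I assume I: "I \<in> multi_idx n (int n)" "distinct I"
    then have "set I = {..<n}"
      by (intro card_subset_eq) (auto simp: multi_idx_def distinct_card)
    then have "mset I = mset [0..<n]"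
      using I(2) by (subst set_eq_iff_mset_eq_distinct[symmetric]) (auto simp: atLeast0LessThan)
    then obtain q where q: "q permutes {..<length [0..<n]}" "permute_list q [0..<n] = I"
      by (rule mset_eq_permutation)
    then have "map e I = permute_list q ?E" using permute_list_map[OF q(1), of e] by simp
    then show "g (map e I) = h (map e I)"
      using q(1) that(3) E alt_maps_permute[OF that(1) E _ subS, of q] alt_maps_permute[OF that(2) E _ subS, of q] by simp
  qed
  have basis_case: "H (map e I) = (\<lambda>us. (fact k * fact (n - k)) *\<^sub>R \<mu> us (\<phi> (map e I)))"
    if I: "I \<in> idx k" "distinct I" for I
  proof (rule top[OF H_in R_in])
    show "set (map e I) \<subseteq> S" "length (map e I) = k"
      using multi_idx_map_subset[OF S I(1)] multi_idx_length[OF I(1)] by auto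
    show "H (map e I) ?E = (fact k * fact (n - k)) *\<^sub>R \<mu> ?E (\<phi> (map e I))"
      using wedge_interior_basis[OF \<mu> \<phi> I] E unfolding H_def by simp
  qed
  \<comment> \<open>The same sum as a function of \<open>W\<close> with the given \<open>us\<close>;
    it is alternating in \<open>W\<close> because the arguments after \<open>W\<close> are fixed in
    each summand.\<close>
  define G where "G = (\<lambda>W. \<Sum>p | p permutes {..<n}. of_int (sign p) *\<^sub>R
        \<mu> (W @ drop k (permute_list p us)) (\<phi> (take k (permute_list p us))))"
  have "G \<in> alt_maps S (int k) UNIV"
  proof -
    have "(\<lambda>W. \<mu> (W @ drop k (permute_list p us)) (\<phi> (take k (permute_list p us)))) \<in> alt_maps S (int k) UNIV"
      if "p permutes {..<n}" for p
    proof -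
      have "set (drop k (permute_list p us)) \<subseteq> S"
        using us that set_permute_list[of p us] set_drop_subset[of k "permute_list p us"] by simp
      then have "(\<lambda>W. \<mu> (W @ drop k (permute_list p us))) \<in> alt_maps S (int k) (dual_sp F)"
        using us kn D0 by (intro alt_maps_append_right[OF \<mu>]) auto
      then show ?thesis by (rule dual_coeff_in)
    qed
    then have "(\<Sum>p | p permutes {..<n}. of_int (sign p) *\<^sub>R
        (\<lambda>W. \<mu> (W @ drop k (permute_list p us)) (\<phi> (take k (permute_list p us))))) \<in> alt_maps S (int k) UNIV"
      by (intro subspace_sum subspace_scale subspace_alt_maps) auto
    moreover have "G = (\<Sum>p | p permutes {..<n}. of_int (sign p) *\<^sub>R
        (\<lambda>W. \<mu> (W @ drop k (permute_list p us)) (\<phi> (take k (permute_list p us)))))"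
      by (auto simp: G_def fun_eq_iff sum_fun_apply)
    ultimately show ?thesis by simp
  qed
  moreover have "(\<lambda>W. (fact k * fact (n - k)) *\<^sub>R \<mu> us (\<phi> W)) \<in> alt_maps S (int k) UNIV"
    using alt_dual_range[OF \<mu>, of us]
    by (intro alt_maps_compose[OF \<phi> subspace_0[OF subF], where g = "\<lambda>\<xi>. (fact k * fact (n - k)) *\<^sub>R \<mu> us \<xi>"])
       (auto simp: dual_sp_def simp del: real_scaleR_def intro: linear_on_scaleR_const)
  moreover have "G (map e I) = (fact k * fact (n - k)) *\<^sub>R \<mu> us (\<phi> (map e I))"
    if "I \<in> idx k" "distinct I" for I
    using fun_cong[OF basis_case[OF that], of us] us by (simp add: H_def G_def)
  ultimately have "G = (\<lambda>W. (fact k * fact (n - k)) *\<^sub>R \<mu> us (\<phi> W))"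
    by (rule alt_maps_eqI[OF S])
  then show ?thesis unfolding G_def fun_eq_iff by simp
qed

subsection \<open>The fibrewise isomorphism\<close>

lemma Phi_formula_in:
  assumes \<kappa>: "\<kappa> \<in> mixed S F (int k) r"
  shows "Phi_formula k \<kappa> \<in> alt_maps S (r - int k) (dual_sp F)"
  unfolding Phi_formula_def
proof (intro subspace_scale subspace_sum subspace_alt_maps subspace_dual_sp subF)
  fix I assume I: "I \<in> idx k"
  show "(\<lambda>us. \<kappa> (map \<epsilon> I) (map e I @ us)) \<in> alt_maps S (r - int k) (dual_sp F)"
    using multi_idx_length[OF I] multi_idx_map_subset[OF S I] subspace_0[OF subspace_dual_sp[OF subF]]
    by (intro alt_maps_append_left[OF mixed_apply_in[OF \<kappa> I]]) auto
qed

lemma dual_apply_0: "\<alpha> \<in> alt_maps S r (dual_sp F) \<Longrightarrow> \<alpha> us 0 = 0"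
  using alt_dual_range[of \<alpha> r us] linear_on_0[of F "\<alpha> us"] subspace_0[OF subF] by (simp add: dual_sp_def)

text \<open>\<open>wedge_interior\<close> is applied to each form
  \<open>\<kappa> (map \<epsilon> I)\<close> with \<open>W = map e I\<close>. The
  \<open>\<phi>\<close> is arbitrary: outside its space both operations return 0.\<close>

lemma contr_eq_wedge:
  assumes \<kappa>: "\<kappa> \<in> mixed S F (int k) (int n)"
  shows "contr S F k (int n) \<kappa> \<phi> = wedge S F k (int n - int k) \<phi> (Phi_fibre S F k (int n) \<kappa>)"
proof (cases "\<phi> \<in> alt_maps S (int k) F")
  case True
  note \<alpha> = Phi_formula_in[OF \<kappa>]
  have "contr_formula k \<kappa> \<phi> us = wedge_formula k (int n - int k) \<phi> (Phi_formula k \<kappa>) us" for us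
  proof (cases "set us \<subseteq> S \<and> length us = n \<and> k \<le> n")
    case us: True
    have "wedge_formula k (int n - int k) \<phi> (Phi_formula k \<kappa>) us =
      (\<Sum>p | p permutes {..<n}. \<Sum>I\<in>idx k. 1 / fact k * (of_int (sign p) *
        \<kappa> (map \<epsilon> I) (map e I @ drop k (permute_list p us)) (\<phi> (take k (permute_list p us))))) / (fact k * fact (n - k))"
      using us by (simp add: wedge_formula_def Phi_formula_def sum_fun_apply sum_distrib_left sum_distrib_right
          mult_ac nat_diff_distrib of_nat_diff[symmetric] del: of_nat_diff)
    also have "\<dots> = (\<Sum>I\<in>idx k. 1 / fact k * (\<Sum>p | p permutes {..<n}. of_int (sign p) *
        \<kappa> (map \<epsilon> I) (map e I @ drop k (permute_list p us)) (\<phi> (take k (permute_list p us))))) / (fact k * fact (n - k))"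
      by (subst sum.swap) (simp add: sum_distrib_left)
    also have "\<dots> = (\<Sum>I\<in>idx k. 1 / fact k * (fact k * fact (n - k) * \<kappa> (map \<epsilon> I) us (\<phi> (map e I)))) / (fact k * fact (n - k))"
      using us multi_idx_length[of _ n k] multi_idx_map_subset[OF S, of _ "int k"]
      by (intro arg_cong2[where f = "(/)"] sum.cong refl arg_cong2[where f = "(*)"] wedge_interior[OF mixed_apply_in[OF \<kappa>] True]) auto
    also have "\<dots> = contr_formula k \<kappa> \<phi> us"
      by (simp add: contr_formula_def sum_distrib_left sum_divide_distrib)
    finally show ?thesis by simp
  next
    \<comment> \<open>For a list outside the domain, or for \<open>k > n\<close>, each side vanishes
      on its own; in the latter case because \<open>\<phi> = 0\<close>.\<close>
    case us: False
    have "contr_formula k \<kappa> \<phi> us = 0"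
    proof (cases "k \<le> n")
      case k: True
      then have "\<kappa> (map \<epsilon> I) us = 0" if "I \<in> idx k" for I
        using us by (intro alt_maps_out[OF mixed_apply_in[OF \<kappa> that]]) auto
      then show ?thesis by (simp add: contr_formula_def)
    next
      case False
      then have "\<phi> = 0" using alt_maps_above_dim[OF S True] by simp
      then show ?thesis
        using dual_apply_0[OF mixed_apply_in[OF \<kappa>]] by (simp add: contr_formula_def)
    qed
    moreover have "Phi_formula k \<kappa> (drop k (permute_list p us)) (\<phi> (take k (permute_list p us))) = 0"
      if p: "p permutes {..<length us}" for p
    \<comment> \<open>If the first block is admissible, the defect of \<open>us\<close> lies in the
      last block and \<open>Phi_formula\<close> vanishes; otherwise \<open>\<phi>\<close>
      does.\<close>
    proof (cases "set (take k (permute_list p us)) \<subseteq> S \<and> length (take k (permute_list p us)) = k \<and> k \<le> n")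
      case True
      moreover have "set us = set (take k (permute_list p us)) \<union> set (drop k (permute_list p us))"
        using set_permute_list[OF p] by (metis append_take_drop_id set_append)
      ultimately have "\<not> (set (drop k (permute_list p us)) \<subseteq> S \<and> int (length (drop k (permute_list p us))) = int n - int k)"
        using us by auto
      then have "Phi_formula k \<kappa> (drop k (permute_list p us)) = 0"
        by (rule alt_maps_out[OF \<alpha>])
      then show ?thesis by simp
    next
      case False
      have "\<phi> (take k (permute_list p us)) = 0"
      proof (cases "k \<le> n")
        case k: True
        then show ?thesis using False by (intro alt_maps_out[OF True]) auto
      next
        case k: False
        then show ?thesis using alt_maps_above_dim[OF S True] by simp
      qed
      then show ?thesis using dual_apply_0[OF \<alpha>] by simp
    qed
    then have "wedge_formula k (int n - int k) \<phi> (Phi_formula k \<kappa>) us = 0"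
      by (simp add: wedge_formula_def)
    ultimately show ?thesis by simp
  qed
  then show ?thesis
    using True \<kappa> \<alpha> by (simp add: contr_eq wedge_eq Phi_fibre_eq fun_eq_iff)
qed (simp add: contr_eq wedge_eq)

text \<open>Contracting \<open>\<kappa>\<close> with the form \<open>(\<lambda>\<^sub>1 \<and> \<dots> \<and> \<lambda>\<^sub>k) \<otimes> \<xi>\<close> evaluates it at the \<open>\<lambda>\<^sub>i\<close> and \<open>\<xi>\<close>, so
  the preceding identity recovers \<open>\<kappa>\<close> from its image.\<close>

lemma mixed_recover:
  assumes \<kappa>: "\<kappa> \<in> mixed S F (int k) (int n)" and ls: "set ls \<subseteq> dual_sp S" "length ls = k"
    and us: "set us \<subseteq> S" "length us = n" and kn: "k \<le> n"
  shows "\<kappa> ls us \<xi> = (\<Sum>p | p permutes {..<n}. of_int (sign p) *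
      ndet k (\<lambda>i j. (ls ! j) (permute_list p us ! i)) *
      Phi_fibre S F k (int n) \<kappa> (drop k (permute_list p us)) \<xi>) / (fact k * fact (n - k))"
\<comment> \<open>Elements of \<open>dual_sp F\<close> vanish off \<open>F\<close>, so both sides
  are 0 for \<open>\<xi>\<close> outside the fibre.\<close>
proof (cases "\<xi> \<in> F")
  case \<xi>: True
  define \<phi> where "\<phi> = tens_vec (ndet_form S k (\<lambda>j. ls ! j)) \<xi>"
  have \<phi>: "\<phi> \<in> alt_maps S (int k) F"
    unfolding \<phi>_def using ls \<xi>
    by (intro tens_vec_in ndet_form_in subS subF) (auto simp: dual_sp_def subset_iff in_set_conv_nth)
  note \<alpha> = Phi_formula_in[OF \<kappa>]
  have scale: "\<beta> vs (a *\<^sub>R \<xi>) = a * \<beta> vs \<xi>" if "\<beta> \<in> alt_maps S r (dual_sp F)" for \<beta> vs a r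
    using alt_dual_range[OF that, of vs] linear_on_scale[of F "\<beta> vs" \<xi> a] \<xi> by (simp add: dual_sp_def)
  have "\<kappa> ls = (1 / fact k) *\<^sub>R (\<Sum>I\<in>idx k. ndet k (\<lambda>i j. (ls ! j) (e (I ! i))) *\<^sub>R \<kappa> (map \<epsilon> I))"
    using ls \<kappa> unfolding mixed_def by (intro alt_maps_expand[OF basis_on_dual[OF S]]) auto
  then have "\<kappa> ls us \<xi> = 1 / fact k * (\<Sum>I\<in>idx k. ndet k (\<lambda>i j. (ls ! j) (e (I ! i))) * \<kappa> (map \<epsilon> I) us \<xi>)"
    by (simp add: sum_fun_apply)
  also have "\<dots> = contr_formula k \<kappa> \<phi> us"
  proof -
    have "\<phi> (map e I) = ndet k (\<lambda>i j. (ls ! j) (e (I ! i))) *\<^sub>R \<xi>" if "I \<in> idx k" for I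
      using multi_idx_length[OF that] multi_idx_map_subset[OF S that]
      by (auto simp: \<phi>_def tens_vec_def ndet_form_def intro!: ndet_cong)
    then have "\<kappa> (map \<epsilon> I) us (\<phi> (map e I)) = ndet k (\<lambda>i j. (ls ! j) (e (I ! i))) * \<kappa> (map \<epsilon> I) us \<xi>"
      if "I \<in> idx k" for I
      using that scale[OF mixed_apply_in[OF \<kappa> that]] by simp
    then show ?thesis by (simp add: contr_formula_def)
  qed
  also have "\<dots> = contr S F k (int n) \<kappa> \<phi> us"
    using \<kappa> \<phi> by (simp add: contr_eq)
  also have "\<dots> = wedge S F k (int n - int k) \<phi> (Phi_fibre S F k (int n) \<kappa>) us"
    by (simp add: contr_eq_wedge[OF \<kappa>])
  also have "\<dots> = wedge_formula k (int n - int k) \<phi> (Phi_formula k \<kappa>) us"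
    using \<kappa> \<alpha> \<phi> by (simp add: wedge_eq Phi_fibre_eq)
  also have "\<dots> = (\<Sum>p | p permutes {..<n}. of_int (sign p) *
      ndet k (\<lambda>i j. (ls ! j) (permute_list p us ! i)) *
      Phi_formula k \<kappa> (drop k (permute_list p us)) \<xi>) / (fact k * fact (n - k))"
  proof -
    have "of_int (sign p) * Phi_formula k \<kappa> (drop k (permute_list p us)) (\<phi> (take k (permute_list p us))) =
      of_int (sign p) * ndet k (\<lambda>i j. (ls ! j) (permute_list p us ! i)) * Phi_formula k \<kappa> (drop k (permute_list p us)) \<xi>"
      if "p permutes {..<n}" for p
    proof -
      have "set (take k (permute_list p us)) \<subseteq> S"
        using us that set_permute_list[of p us] set_take_subset[of k "permute_list p us"] by simp
      then have "\<phi> (take k (permute_list p us)) = ndet k (\<lambda>i j. (ls ! j) (permute_list p us ! i)) *\<^sub>R \<xi>"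
        using us kn by (auto simp: \<phi>_def tens_vec_def ndet_form_def intro!: ndet_cong)
      then show ?thesis by (simp add: scale[OF \<alpha>])
    qed
    moreover have "nat (int n - int k) = n - k" by simp
    ultimately show ?thesis unfolding wedge_formula_def us(2) by (simp add: mult.assoc)
  qed
  finally show ?thesis using \<kappa> by (simp add: Phi_fibre_eq)
next
  case False
  have "\<kappa> ls \<in> alt_maps S (int n) (dual_sp F)"
    using \<kappa> ls unfolding mixed_def by (intro alt_maps_in[of \<kappa>]) auto
  then have "\<kappa> ls us \<xi> = 0"
    using alt_dual_range[of "\<kappa> ls" "int n" us] False by (simp add: dual_sp_def)
  moreover have "Phi_formula k \<kappa> vs \<xi> = 0" for vs
    using alt_dual_range[OF Phi_formula_in[OF \<kappa>], of vs] False by (simp add: dual_sp_def)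
  ultimately show ?thesis using \<kappa> by (simp add: Phi_fibre_eq)
qed

text \<open>For \<open>k \<le> n\<close> the formula in \<open>mixed_recover\<close> depends on the
  image only; for \<open>k > n\<close> the source is zero, the dual space having dimension
  \<open>n\<close>.\<close>

lemma Phi_fibre_inj: "inj_on (Phi_fibre S F k (int n)) (mixed S F (int k) (int n))"
proof (rule inj_onI)
  fix \<kappa> \<kappa>' assume \<kappa>: "\<kappa> \<in> mixed S F (int k) (int n)" "\<kappa>' \<in> mixed S F (int k) (int n)"
    and eq: "Phi_fibre S F k (int n) \<kappa> = Phi_fibre S F k (int n) \<kappa>'"
  note \<kappa>' = \<kappa>[unfolded mixed_def]
  show "\<kappa> = \<kappa>'"
  proof (cases "k \<le> n")
    case True
    show ?thesis
    proof (intro ext)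
      fix ls us \<xi>
      show "\<kappa> ls us \<xi> = \<kappa>' ls us \<xi>"
      proof (cases "set ls \<subseteq> dual_sp S \<and> int (length ls) = int k")
        case ls: True
        show ?thesis
        proof (cases "set us \<subseteq> S \<and> int (length us) = int n")
          case us: True
          show ?thesis
            using ls us True eq mixed_recover[OF \<kappa>(1), of ls us \<xi>] mixed_recover[OF \<kappa>(2), of ls us \<xi>] by simp
        next
          case us: False
          have "\<kappa> ls us = 0" "\<kappa>' ls us = 0"
            using ls by (auto intro!: alt_maps_out[OF _ us] intro: alt_maps_in[OF \<kappa>'(1)] alt_maps_in[OF \<kappa>'(2)])
          then show ?thesis by simp
        qed
      next
        case False
        show ?thesis using alt_maps_out[OF \<kappa>'(1) False] alt_maps_out[OF \<kappa>'(2) False] by simp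
      qed
    qed
  next
    case False
    then show ?thesis
      using alt_maps_above_dim[OF basis_on_dual[OF S] \<kappa>'(1)] alt_maps_above_dim[OF basis_on_dual[OF S] \<kappa>'(2)] by simp
  qed
qed

text \<open>With \<open>I\<close> the complementary indices and the volume form suitably normalised,
  both sides are 1 at \<open>map e J\<close>, change sign in the same way under reordering, and
  vanish at every other set of indices.\<close>

lemma interior_vol:
  assumes J: "J \<in> idx l" "distinct J" and l: "l + k = n"
  obtains Us \<mu> where "set Us \<subseteq> S" "length Us = k" "\<mu> \<in> alt_maps S (int n) UNIV"
    "interior_mult Us \<mu> = ndet_form S l (\<lambda>j. c (J ! j))"
proof -
  define I where "I = sorted_list_of_set ({..<n} - set J)"
  have JS: "set J \<subseteq> {..<n}" "length J = l" "card (set J) = l"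
    using J by (auto simp: multi_idx_def distinct_card)
  have I: "set I = {..<n} - set J" "distinct I" "length I = k"
    unfolding I_def using JS l by (auto simp: card_Diff_subset)
  have eS: "set (map e L) \<subseteq> S" if "set L \<subseteq> {..<n}" for L
    using that basis_onD(2)[OF S] by auto
  define vol where "vol = ndet_form S n c"
  have vol: "vol \<in> alt_maps S (int n) UNIV"
    unfolding vol_def by (intro ndet_form_in subS basis_onD(3)[OF S])
  let ?E = "map e [0..<n]"
  have E: "set ?E \<subseteq> S" by (intro eS) auto
  have "vol ?E = ndet n (\<lambda>i j. if i = j then 1 else 0)"
    using E by (auto simp: vol_def ndet_form_def basis_onD(5)[OF S] intro!: ndet_cong)
  then have volE: "vol ?E = 1" by (simp add: ndet_one)
  \<comment> \<open>\<open>v0\<close> is the sign of the arrangement of all indices as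
    \<open>I\<close> followed by \<open>J\<close>; dividing by it removes this sign.\<close>
  define v0 where "v0 = vol (map e I @ map e J)"
  have "v0 \<noteq> 0"
  proof -
    have "mset (I @ J) = mset [0..<n]"
      using I J JS by (subst set_eq_iff_mset_eq_distinct[symmetric]) auto
    then obtain q where q: "q permutes {..<length [0..<n]}" "permute_list q [0..<n] = I @ J"
      by (rule mset_eq_permutation)
    then have "map e I @ map e J = permute_list q ?E" using permute_list_map[OF q(1), of e] by simp
    then have "v0 = of_int (sign q) *\<^sub>R vol ?E"
      unfolding v0_def using q(1) by (simp only:) (intro alt_maps_permute[OF vol E _ subS], auto)
    then show ?thesis using volE by (simp add: sign_def)
  qed
  define \<mu> where "\<mu> = (1 / v0) *\<^sub>R vol"
  have \<mu>: "\<mu> \<in> alt_maps S (int n) UNIV"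
    unfolding \<mu>_def by (intro subspace_scale subspace_alt_maps vol) auto
  let ?D = "ndet_form S l (\<lambda>j. c (J ! j))"
  have D: "?D \<in> alt_maps S (int l) UNIV"
    using JS by (intro ndet_form_in subS basis_onD(3)[OF S]) (auto simp: subset_iff)
  have G: "interior_mult (map e I) \<mu> \<in> alt_maps S (int l) UNIV"
    unfolding interior_mult_def using I l by (intro alt_maps_append_left[OF \<mu> eS]) auto
  have "interior_mult (map e I) \<mu> = ?D"
  proof (rule alt_maps_eqI[OF S G D])
    fix J' assume J': "J' \<in> idx l" "distinct J'"
    then have J'S: "set J' \<subseteq> {..<n}" "length J' = l" "card (set J') = l"
      by (auto simp: multi_idx_def distinct_card)
    show "interior_mult (map e I) \<mu> (map e J') = ?D (map e J')"
    proof (cases "set J' = set J")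
      case True
      then have "mset J' = mset J"
        using J'(2) J(2) by (metis set_eq_iff_mset_eq_distinct)
      then obtain q where q: "q permutes {..<length J}" "permute_list q J = J'"
        by (rule mset_eq_permutation)
      have eq: "map e J' = permute_list q (map e J)" using q permute_list_map[OF q(1), of e] by simp
      have D1: "?D (map e J) = ndet l (\<lambda>i j. if i = j then 1 else 0)"
        using eS[OF JS(1)] JS J(2)
        by (auto simp: ndet_form_def basis_onD(5)[OF S] subset_iff nth_eq_iff_index_eq intro!: ndet_cong)
      have I1: "interior_mult (map e I) \<mu> (map e J) = 1"
        using \<open>v0 \<noteq> 0\<close> by (simp add: interior_mult_def \<mu>_def v0_def)
      have sgn: "g (map e J') = of_int (sign q) *\<^sub>R g (map e J)" if "g \<in> alt_maps S (int l) UNIV" for g :: "_ \<Rightarrow> real"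
        unfolding eq using q(1) JS by (intro alt_maps_permute[OF that eS _ subS]) auto
      show ?thesis using sgn[OF G] sgn[OF D] by (simp add: D1 I1 ndet_one)
    next
      case False
      \<comment> \<open>An index of \<open>J'\<close> outside \<open>J\<close> lies in
        \<open>I\<close>: it repeats a vector on the left and produces a zero row on the
        right.\<close>
      then have "\<not> set J' \<subseteq> set J"
        using JS J'S card_subset_eq[of "set J" "set J'"] by auto
      then obtain i where i: "i < l" "J' ! i \<notin> set J"
        using J'S(2) by (auto simp: in_set_conv_nth subset_iff)
      have "J' ! i < n" using J'S i by (auto simp: subset_iff)
      then have "J' ! i \<in> set I" using I i by simp
      moreover have "J' ! i \<in> set J'" using i J'S by auto
      ultimately have "\<not> distinct (map e I @ map e J')" by auto
      then have "interior_mult (map e I) \<mu> (map e J') = 0"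
        unfolding interior_mult_def by (rule alt_maps_not_distinct[OF \<mu>])
      moreover have "ndet l (\<lambda>i' j. c (J ! j) (map e J' ! i')) = 0"
      proof (rule ndet_zero_row[OF i(1)])
        fix j assume j: "j < l"
        then have "J ! j \<in> set J" using JS by auto
        then have "J ! j < n" "J ! j \<noteq> J' ! i" using JS i by auto
        then show "c (J ! j) (map e J' ! i) = 0"
          using i J'S \<open>J' ! i < n\<close> by (simp add: basis_onD(5)[OF S])
      qed
      then have "?D (map e J') = 0" by (simp add: ndet_form_def)
      ultimately show ?thesis by simp
    qed
  qed
  then show ?thesis using that[of "map e I" \<mu>] eS[of I] I \<mu> by auto
qed

text \<open>For \<open>k > n\<close> the target has negative degree and is zero. Otherwise
  \<open>alt_maps_expand\<close> writes \<open>\<alpha>\<close> in the forms of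
  \<open>interior_vol\<close>, each of which has a preimage.\<close>

lemma Phi_fibre_surj:
  assumes \<alpha>: "\<alpha> \<in> alt_maps S (int n - int k) (dual_sp F)"
  shows "\<alpha> \<in> Phi_fibre S F k (int n) ` mixed S F (int k) (int n)"
proof (cases "k \<le> n")
  case False
  then have "\<alpha> = 0" using \<alpha> alt_maps_neg[of "int n - int k" S "dual_sp F"] by auto
  moreover have "0 \<in> mixed S F (int k) (int n)" by (rule subspace_0[OF subspace_mixed[OF subF]])
  ultimately show ?thesis
    using linear_on_0[OF Phi_fibre_linear, of k "int n"] by force
next
  case True
  define l where "l = n - k"
  have l: "l + k = n" "int n - int k = int l" using True by (auto simp: l_def)
  let ?D = "\<lambda>J. ndet_form S l (\<lambda>j. c (J ! j))"
  have mem: "0 \<in> mixed S F (int k) (int n)" by (rule subspace_0[OF subspace_mixed[OF subF]])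
  have ex: "\<exists>\<kappa>. \<kappa> \<in> mixed S F (int k) (int n) \<and> Phi_fibre S F k (int n) \<kappa> = tens_dual (?D J) (\<alpha> (map e J))"
    if J: "J \<in> idx l" for J
  proof (cases "distinct J")
    case d: True
    obtain Us \<mu> where *: "set Us \<subseteq> S" "length Us = k" "\<mu> \<in> alt_maps S (int n) UNIV" "interior_mult Us \<mu> = ?D J"
      using interior_vol[OF J d l(1)] by metis
    have "Phi_fibre S F k (int n) (tens_mixed S Us \<mu> (\<alpha> (map e J))) = tens_dual (?D J) (\<alpha> (map e J))"
      using * Phi_formula_tens[OF *(1-3) alt_dual_range[OF \<alpha>]] tens_mixed_in[OF subS subF *(2,3) alt_dual_range[OF \<alpha>]]
      by (simp add: Phi_fibre_eq)
    then show ?thesis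
      using tens_mixed_in[OF subS subF *(2,3) alt_dual_range[OF \<alpha>]] by blast
  next
    \<comment> \<open>A repeated index makes \<open>\<alpha> (map e J)\<close> vanish, so 0 is a
      preimage.\<close>
    case False
    then have "\<not> distinct (map e J)" by (auto simp: distinct_map)
    then have "tens_dual (?D J) (\<alpha> (map e J)) = 0"
      using alt_maps_not_distinct[OF \<alpha>] by (auto simp: tens_dual_def fun_eq_iff)
    then show ?thesis
      using linear_on_0[OF Phi_fibre_linear mem] mem by (intro exI[of _ 0]) simp
  qed
  obtain K where K: "\<And>J. J \<in> idx l \<Longrightarrow> K J \<in> mixed S F (int k) (int n)"
    "\<And>J. J \<in> idx l \<Longrightarrow> Phi_fibre S F k (int n) (K J) = tens_dual (?D J) (\<alpha> (map e J))"
    using bchoice[of "idx l" "\<lambda>J \<kappa>. \<kappa> \<in> mixed S F (int k) (int n) \<and>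
      Phi_fibre S F k (int n) \<kappa> = tens_dual (?D J) (\<alpha> (map e J))"] ex by blast
  \<comment> \<open>The factor \<open>1 / fact l\<close> is that of \<open>alt_maps_expand\<close>
    in degree \<open>l\<close>.\<close>
  let ?\<kappa> = "\<Sum>J\<in>idx l. (1 / fact l) *\<^sub>R K J"
  have "?\<kappa> \<in> mixed S F (int k) (int n)"
    using K(1) by (intro subspace_sum subspace_scale subspace_mixed subF) auto
  moreover have "Phi_fibre S F k (int n) ?\<kappa> = (\<Sum>J\<in>idx l. (1 / fact l) *\<^sub>R tens_dual (?D J) (\<alpha> (map e J)))"
    using K by (subst linear_on_sum[OF subspace_mixed[OF subF] Phi_fibre_linear]) auto
  moreover have "(\<Sum>J\<in>idx l. (1 / fact l) *\<^sub>R tens_dual (?D J) (\<alpha> (map e J))) = \<alpha>"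
  proof
    fix us
    show "(\<Sum>J\<in>idx l. (1 / fact l) *\<^sub>R tens_dual (?D J) (\<alpha> (map e J))) us = \<alpha> us"
    proof (cases "set us \<subseteq> S \<and> length us = l")
      case us: True
      have "?D J us = ndet l (\<lambda>i j. c (J ! i) (us ! j))" for J
        using us ndet_transpose[of l "\<lambda>i j. c (J ! i) (us ! j)"] by (simp add: ndet_form_def)
      then have "(\<Sum>J\<in>idx l. (1 / fact l) *\<^sub>R tens_dual (?D J) (\<alpha> (map e J))) us =
        (1 / fact l) *\<^sub>R (\<Sum>J\<in>idx l. ndet l (\<lambda>i j. c (J ! i) (us ! j)) *\<^sub>R \<alpha> (map e J))"
        by (simp add: fun_eq_iff sum_fun_apply tens_dual_def sum_distrib_left mult_ac)
      also have "\<dots> = \<alpha> us"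
        using us \<alpha> by (intro alt_maps_expand[OF S, symmetric]) (auto simp: l)
      finally show ?thesis .
    next
      case False
      then have \<alpha>0: "\<alpha> us = 0"
        using alt_maps_out[OF \<alpha>, of us] by (simp add: l)
      have tens0: "tens_dual (ndet_form S l a) \<eta> us = 0" for a \<eta>
        using False by (intro ext) (auto simp: tens_dual_def ndet_form_def)
      show ?thesis
        by (simp only: sum_fun_apply scaleR_fun_apply tens0 \<alpha>0 scaleR_zero_right sum.neutral_const)
    qed
  qed
  ultimately show ?thesis by (intro image_eqI[of _ _ ?\<kappa>]) (simp_all only:)
qed

lemma Phi_fibre_bij:
  "bij_betw (Phi_fibre S F k (int n)) (mixed S F (int k) (int n)) (alt_maps S (int n - int k) (dual_sp F))"
  unfolding bij_betw_def
proof (intro conjI equalityI subsetI Phi_fibre_inj Phi_fibre_surj)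
  fix \<alpha> assume "\<alpha> \<in> Phi_fibre S F k (int n) ` mixed S F (int k) (int n)"
  then obtain \<kappa> where \<kappa>: "\<kappa> \<in> mixed S F (int k) (int n)" "\<alpha> = Phi_formula k \<kappa>"
    unfolding Phi_fibre_eq by auto
  show "\<alpha> \<in> alt_maps S (int n - int k) (dual_sp F)"
    unfolding \<kappa>(2) by (rule Phi_formula_in[OF \<kappa>(1)])
qed

end

section \<open>Derivatives in coordinates\<close>

lemma open_fun_basis:
  fixes z :: "'a \<Rightarrow> 'b::topological_space"
  assumes "open T" "z \<in> T"
  obtains X where "\<And>i. open (X i)" "\<And>i. z i \<in> X i" "finite {i. X i \<noteq> UNIV}" "{y. \<forall>i. y i \<in> X i} \<subseteq> T"
proof -
  have "openin (product_topology (\<lambda>i. euclidean) UNIV) T"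
    using assms(1) by (simp add: euclidean_product_topology)
  from product_topology_open_contains_basis[OF this assms(2)] obtain X where
    "z \<in> (\<Pi>\<^sub>E i\<in>UNIV. X i)" "\<And>i. openin euclidean (X i)" "finite {i. X i \<noteq> topspace euclidean}"
    "(\<Pi>\<^sub>E i\<in>UNIV. X i) \<subseteq> T" by blast
  then show ?thesis by (intro that[of X]) (auto simp: PiE_UNIV_domain)
qed

text \<open>A basic neighbourhood in the product topology restricts finitely many coordinates
  only.\<close>

lemma tendsto_funI:
  fixes z :: "'a \<Rightarrow> 'b::topological_space"
  assumes "\<And>i. ((\<lambda>t. \<zeta> t i) \<longlongrightarrow> z i) F"
  shows "(\<zeta> \<longlongrightarrow> z) F"
proof (rule topological_tendstoI)
  fix T assume "open T" "z \<in> T"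
  then obtain X where X: "\<And>i. open (X i)" "\<And>i. z i \<in> X i" "finite {i. X i \<noteq> UNIV}" "{y. \<forall>i. y i \<in> X i} \<subseteq> T"
    by (rule open_fun_basis) (rule that)
  have "eventually (\<lambda>t. \<forall>i\<in>{i. X i \<noteq> UNIV}. \<zeta> t i \<in> X i) F"
    using X(1,2) assms by (intro eventually_ball_finite[OF X(3)] ballI topological_tendstoD) auto
  then show "eventually (\<lambda>t. \<zeta> t \<in> T) F"
  proof (rule eventually_mono)
    fix t assume "\<forall>i\<in>{i. X i \<noteq> UNIV}. \<zeta> t i \<in> X i"
    then have "\<zeta> t i \<in> X i" for i by (cases "X i = UNIV") auto
    then show "\<zeta> t \<in> T" using X(4) by blast
  qed
qed

text \<open>Coordinates from \<open>m\<close> on vanish, so one radius for the first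
  \<open>m\<close> coordinates describes a neighbourhood.\<close>

lemma openin_Euclidean_box:
  assumes "openin (Euclidean_space m) W" "z \<in> W"
  obtains \<epsilon> where "\<epsilon> > 0" "\<And>y. (\<forall>i\<ge>m. y i = 0) \<Longrightarrow> (\<forall>i<m. \<bar>y i - z i\<bar> < \<epsilon>) \<Longrightarrow> y \<in> W"
proof -
  obtain T where T: "openin (powertop_real UNIV) T" "W = T \<inter> {x. \<forall>i\<ge>m. x i = 0}"
    using assms(1) unfolding Euclidean_space_def openin_subtopology by auto
  then have "open T" by (simp add: euclidean_product_topology)
  then obtain X where X: "\<And>i. open (X i)" "\<And>i. z i \<in> X i" "finite {i. X i \<noteq> UNIV}" "{y. \<forall>i. y i \<in> X i} \<subseteq> T"
    using open_fun_basis[of T z] assms(2) T(2) by auto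
  have "\<exists>e>0. \<forall>t. \<bar>t - z i\<bar> < e \<longrightarrow> t \<in> X i" for i
    using X(1,2)[of i] unfolding open_dist by (auto simp: dist_real_def)
  then obtain e where e: "\<And>i. e i > 0" "\<And>i t. \<bar>t - z i\<bar> < e i \<Longrightarrow> t \<in> X i" by metis
  \<comment> \<open>Inserting 1 keeps the minimum defined when \<open>m = 0\<close>.\<close>
  define \<epsilon> where "\<epsilon> = Min (insert 1 (e ` {..<m}))"
  have "\<epsilon> > 0" unfolding \<epsilon>_def using e(1) by (subst Min_gr_iff) auto
  moreover have "y \<in> W" if y: "\<forall>i\<ge>m. y i = 0" "\<forall>i<m. \<bar>y i - z i\<bar> < \<epsilon>" for y
  proof -
    have "y i \<in> X i" for i
    proof (cases "i < m")
      case True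
      then have "\<epsilon> \<le> e i" unfolding \<epsilon>_def by (intro Min_le) auto
      then show ?thesis using y(2) True by (intro e(2)) force
    next
      case False
      then have "y i = z i" using y(1) T(2) assms(2) by auto
      then show ?thesis using X(2) by simp
    qed
    then show ?thesis using X(4) T(2) y(1) by blast
  qed
  ultimately show ?thesis by (rule that)
qed

text \<open>The absolute values make the statement independent of the order of \<open>a\<close> and
  \<open>b\<close>, since a coordinate of a curve may move either way or not at all.\<close>

lemma mvt_segment:
  fixes f f' :: "real \<Rightarrow> real"
  assumes "\<And>x. \<bar>x - a\<bar> \<le> \<bar>b - a\<bar> \<Longrightarrow> (f has_real_derivative f' x) (at x)"
  shows "\<exists>s. \<bar>s - a\<bar> \<le> \<bar>b - a\<bar> \<and> f b - f a = (b - a) * f' s"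
proof -
  consider "a < b" | "a = b" | "b < a" by linarith
  then show ?thesis
  proof cases
    case 1
    then obtain s where "a < s" "s < b" "f b - f a = (b - a) * f' s"
      using MVT2[of a b f f'] assms by auto
    then show ?thesis by (intro exI[of _ s]) auto
  next
    case 3
    then obtain s where "b < s" "s < a" "f a - f b = (a - b) * f' s"
      using MVT2[of b a f f'] assms by auto
    then show ?thesis by (intro exI[of _ s]) (auto simp: algebra_simps)
  qed auto
qed

text \<open>Change the coordinates one at a time and apply the mean value theorem to each change.\<close>

lemma chain_rule_partials:
  fixes G :: "(nat \<Rightarrow> real) \<Rightarrow> real" and \<gamma> :: "real \<Rightarrow> nat \<Rightarrow> real"
  assumes W: "openin (Euclidean_space m) W" "z \<in> W"
    and G: "\<And>i x. i < m \<Longrightarrow> x \<in> W \<Longrightarrow> ((\<lambda>t. G (x(i := t))) has_real_derivative g i x) (at (x i))"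
    and g: "\<And>i. i < m \<Longrightarrow> continuous_on W (g i)"
    and \<gamma>: "\<And>i. i < m \<Longrightarrow> ((\<lambda>t. \<gamma> t i) has_real_derivative d i) (at t0 within A)"
      "\<And>t i. m \<le> i \<Longrightarrow> \<gamma> t i = 0" "\<gamma> t0 = z"
  shows "((\<lambda>t. G (\<gamma> t)) has_real_derivative (\<Sum>i<m. g i z * d i)) (at t0 within A)"
proof -
  let ?F = "at t0 within A"
  have z0: "z i = 0" if "m \<le> i" for i using \<gamma>(2,3) that by metis
  obtain \<epsilon> where \<epsilon>: "\<epsilon> > 0" "\<And>y. (\<forall>i\<ge>m. y i = 0) \<Longrightarrow> (\<forall>i<m. \<bar>y i - z i\<bar> < \<epsilon>) \<Longrightarrow> y \<in> W"
    by (rule openin_Euclidean_box[OF W]) (rule that)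
  have lim: "((\<lambda>t. \<gamma> t i) \<longlongrightarrow> z i) ?F" if "i < m" for i
    using DERIV_continuous[OF \<gamma>(1)[OF that]] \<gamma>(3) by (simp add: continuous_within)
  have near: "eventually (\<lambda>t. \<forall>i\<in>{..<m}. \<bar>\<gamma> t i - z i\<bar> < \<epsilon>) ?F"
    using tendstoD[OF lim \<epsilon>(1)] by (intro eventually_ball_finite) (auto simp: dist_real_def)
  \<comment> \<open>\<open>p l t\<close> has moved the first \<open>l\<close> coordinates from
    \<open>z\<close> to the curve; it leads from the constant \<open>z\<close> at
    \<open>l = 0\<close> to the curve at \<open>l = m\<close>.\<close>
  define p where "p = (\<lambda>l t i. if i < l then \<gamma> t i else z i)"
  have main: "((\<lambda>t. G (p l t)) has_real_derivative (\<Sum>i<l. g i z * d i)) ?F" if "l \<le> m" for l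
    using that
  proof (induction l)
    case 0
    then show ?case by (simp add: p_def)
  next
    case (Suc l)
    then have l: "l < m" by simp
    define R where "R = (\<lambda>t. G ((p l t)(l := \<gamma> t l)) - G ((p l t)(l := z l)))"
    define Q where "Q = (\<lambda>t s. \<bar>s - z l\<bar> \<le> \<bar>\<gamma> t l - z l\<bar> \<and> (p l t)(l := s) \<in> W \<and>
        R t = (\<gamma> t l - z l) * g l ((p l t)(l := s)))"
    have "eventually (\<lambda>t. \<exists>s. Q t s) ?F"
      using near
    proof (rule eventually_mono)
      fix t assume t: "\<forall>i\<in>{..<m}. \<bar>\<gamma> t i - z i\<bar> < \<epsilon>"
      have inW: "(p l t)(l := s) \<in> W" if "\<bar>s - z l\<bar> \<le> \<bar>\<gamma> t l - z l\<bar>" for s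
      proof (rule \<epsilon>(2))
        show "\<forall>i\<ge>m. ((p l t)(l := s)) i = 0" using l z0 by (auto simp: p_def)
        have "\<bar>s - z l\<bar> < \<epsilon>" using that t l by force
        then show "\<forall>i<m. \<bar>((p l t)(l := s)) i - z i\<bar> < \<epsilon>" using t \<epsilon>(1) by (auto simp: p_def)
      qed
      have "\<exists>s. \<bar>s - z l\<bar> \<le> \<bar>\<gamma> t l - z l\<bar> \<and>
         G ((p l t)(l := \<gamma> t l)) - G ((p l t)(l := z l)) = (\<gamma> t l - z l) * g l ((p l t)(l := s))"
      proof (rule mvt_segment[of "z l" "\<gamma> t l" "\<lambda>s. G ((p l t)(l := s))"])
        fix s assume "\<bar>s - z l\<bar> \<le> \<bar>\<gamma> t l - z l\<bar>"
        from G[OF l inW[OF this]]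
        show "((\<lambda>s. G ((p l t)(l := s))) has_real_derivative g l ((p l t)(l := s))) (at s)" by simp
      qed
      then show "\<exists>s. Q t s" using inW unfolding Q_def R_def by blast
    qed
    then have ev: "eventually (\<lambda>t. Q t (SOME s. Q t s)) ?F"
      by (rule eventually_mono) (rule someI_ex)
    \<comment> \<open>The mean value point exists only for \<open>t\<close> so close to
      \<open>t0\<close> that the segment lies in \<open>W\<close>; for other \<open>t\<close> the
      choice is arbitrary.\<close>
    define s where "s = (\<lambda>t. SOME s. Q t s)"
    have Qs: "eventually (\<lambda>t. Q t (s t)) ?F" using ev by (simp add: s_def)
    \<comment> \<open>The mean value point is at least as close to \<open>z l\<close> as the curve,
      so continuity of the partial derivative gives the limit of the quotient.\<close>
    have "(s \<longlongrightarrow> z l) ?F"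
      by (rule metric_tendsto_imp_tendsto[OF lim[OF l]])
        (use Qs in \<open>auto elim!: eventually_mono simp: Q_def dist_real_def\<close>)
    then have "((\<lambda>t. (p l t)(l := s t)) \<longlongrightarrow> z) ?F"
      using lim l by (intro tendsto_funI, rename_tac i, case_tac "i = l"; case_tac "i < l") (auto simp: p_def)
    then have "((\<lambda>t. g l ((p l t)(l := s t))) \<longlongrightarrow> g l z) ?F"
      using Qs by (intro continuous_on_tendsto_compose[OF g[OF l] _ W(2)]) (auto elim!: eventually_mono simp: Q_def)
    moreover have "((\<lambda>t. (\<gamma> t l - \<gamma> t0 l) / (t - t0)) \<longlongrightarrow> d l) ?F"
      using \<gamma>(1)[OF l] by (simp add: has_field_derivative_iff)
    ultimately have "((\<lambda>t. (\<gamma> t l - \<gamma> t0 l) / (t - t0) * g l ((p l t)(l := s t))) \<longlongrightarrow> d l * g l z) ?F"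
      by (intro tendsto_mult)
    moreover have "eventually (\<lambda>t. (\<gamma> t l - \<gamma> t0 l) / (t - t0) * g l ((p l t)(l := s t)) = (R t - R t0) / (t - t0)) ?F"
      using Qs by (rule eventually_mono) (auto simp: Q_def R_def \<gamma>(3))
    ultimately have "((\<lambda>t. (R t - R t0) / (t - t0)) \<longlongrightarrow> d l * g l z) ?F"
      by (rule Lim_transform_eventually)
    then have "(R has_real_derivative d l * g l z) ?F"
      by (simp add: has_field_derivative_iff)
    with Suc have "((\<lambda>t. G (p l t) + R t) has_real_derivative (\<Sum>i<l. g i z * d i) + d l * g l z) ?F"
      by (intro DERIV_add) auto
    moreover have "G (p l t) + R t = G (p (Suc l) t)" for t
    proof -
      have "(p l t)(l := \<gamma> t l) = p (Suc l) t" "(p l t)(l := z l) = p l t"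
        by (auto simp: p_def fun_eq_iff less_Suc_eq)
      then show ?thesis by (simp add: R_def)
    qed
    ultimately show ?case by (simp add: mult.commute)
  qed
  have "p m = \<gamma>" using \<gamma>(2) z0 by (auto simp: p_def fun_eq_iff)
  then show ?thesis using main[of m] by simp
qed

section \<open>Charts and tangent spaces\<close>

abbreviation transition :: "'a chart \<Rightarrow> 'a chart \<Rightarrow> (nat \<Rightarrow> real) \<Rightarrow> nat \<Rightarrow> real"
  where "transition c d y \<equiv> snd d (inv_into (fst c) (snd c) y)"

locale smooth_mfd =
  fixes M :: "'a mfd"
  assumes smooth: "smooth_manifold M"
begin

abbreviation "m \<equiv> mdim M"

lemma chart:
  assumes "c \<in> atlas M"
  shows "openin (mtop M) (fst c)" "fst c \<subseteq> topspace (mtop M)"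
    "openin (Euclidean_space m) (snd c ` fst c) \<or> openin (half_space m) (snd c ` fst c)"
    "homeomorphic_map (subtopology (mtop M) (fst c)) (subtopology (Euclidean_space m) (snd c ` fst c)) (snd c)"
    "i < m \<Longrightarrow> smooth_fun M (fst c) (\<lambda>x. snd c x i)"
proof -
  obtain U h where c: "c = (U, h)" by force
  have *: "openin (mtop M) U \<and>
       (openin (Euclidean_space (mdim M)) (h ` U) \<or> openin (half_space (mdim M)) (h ` U)) \<and>
       homeomorphic_map (subtopology (mtop M) U)
         (subtopology (Euclidean_space (mdim M)) (h ` U)) h \<and>
       (\<forall>i<mdim M. smooth_fun M U (\<lambda>x. h x i))"
    using smooth assms unfolding smooth_manifold_def c by blast
  then show "openin (mtop M) (fst c)" "openin (Euclidean_space m) (snd c ` fst c) \<or> openin (half_space m) (snd c ` fst c)"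
    "homeomorphic_map (subtopology (mtop M) (fst c)) (subtopology (Euclidean_space m) (snd c ` fst c)) (snd c)"
    "i < m \<Longrightarrow> smooth_fun M (fst c) (\<lambda>x. snd c x i)"
    by (auto simp: c)
  then show "fst c \<subseteq> topspace (mtop M)" by (intro openin_subset)
qed

lemma topspace_charts: "topspace (mtop M) = (\<Union>c\<in>atlas M. fst c)"
  using smooth unfolding smooth_manifold_def by (auto simp: case_prod_unfold)

lemma chart_inj: "c \<in> atlas M \<Longrightarrow> inj_on (snd c) (fst c)"
  using homeomorphic_imp_injective_map[OF chart(4)[of c]] chart(2)[of c] by (simp add: Int_absorb1)

lemma chart_sub:
  assumes "c \<in> atlas M" "x \<in> fst c" "m \<le> i" shows "snd c x i = 0"
proof -
  have "snd c ` fst c \<subseteq> topspace (Euclidean_space m)"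
    using chart(3)[OF assms(1)] by (auto dest!: openin_subset simp: half_space_def)
  then show ?thesis using assms by (auto simp: topspace_Euclidean_space)
qed

lemma half_space_topspace: "openin (half_space m) S \<Longrightarrow> S \<subseteq> {y. y 0 \<le> 0}"
  by (auto dest!: openin_subset simp: half_space_def)

lemma chart_image_open:
  assumes c: "c \<in> atlas M" and V: "openin (mtop M) V"
  shows "openin (Euclidean_space m) (snd c ` fst c) \<Longrightarrow> openin (Euclidean_space m) (snd c ` (fst c \<inter> V))"
    "openin (half_space m) (snd c ` fst c) \<Longrightarrow> openin (half_space m) (snd c ` (fst c \<inter> V))"
proof -
  have "openin (subtopology (mtop M) (fst c)) (fst c \<inter> V)"
    using V by (simp add: openin_subtopology_Int2)
  then have *: "openin (subtopology (Euclidean_space m) (snd c ` fst c)) (snd c ` (fst c \<inter> V))"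
    using homeomorphic_imp_open_map[OF chart(4)[OF c]] by (simp add: open_map_def)
  then show "openin (Euclidean_space m) (snd c ` fst c) \<Longrightarrow> openin (Euclidean_space m) (snd c ` (fst c \<inter> V))"
    by (rule openin_trans_full)
  assume h: "openin (half_space m) (snd c ` fst c)"
  have "subtopology (half_space m) (snd c ` fst c) = subtopology (Euclidean_space m) (snd c ` fst c)"
    using half_space_topspace[OF h] by (simp add: half_space_def subtopology_subtopology Int_absorb1)
  with * h show "openin (half_space m) (snd c ` (fst c \<inter> V))"
    using openin_trans_full by metis
qed

text \<open>Treats both kinds of charts at once: in a half-space chart only the part of the box with
  \<open>y 0 \<le> 0\<close> is reached.\<close>

lemma chart_image_box:
  assumes c: "c \<in> atlas M" and V: "openin (mtop M) V" and x: "x \<in> fst c \<inter> V"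
  obtains \<epsilon> where "\<epsilon> > 0" "\<And>y. (\<forall>i\<ge>m. y i = 0) \<Longrightarrow> (\<forall>i<m. \<bar>y i - snd c x i\<bar> < \<epsilon>) \<Longrightarrow>
    openin (Euclidean_space m) (snd c ` fst c) \<or> y 0 \<le> 0 \<Longrightarrow> y \<in> snd c ` (fst c \<inter> V)"
proof (cases "openin (Euclidean_space m) (snd c ` fst c)")
  case o: True
  obtain \<epsilon> where "\<epsilon> > 0" "\<And>y. (\<forall>i\<ge>m. y i = 0) \<Longrightarrow> (\<forall>i<m. \<bar>y i - snd c x i\<bar> < \<epsilon>) \<Longrightarrow>
      y \<in> snd c ` (fst c \<inter> V)"
    by (rule openin_Euclidean_box[OF chart_image_open(1)[OF c V o] imageI[OF x]]) (rule that)
  then show ?thesis by (rule that)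
next
  case False
  then obtain T where T: "openin (Euclidean_space m) T" "snd c ` (fst c \<inter> V) = T \<inter> {x. x 0 \<le> 0}"
    using chart(3)[OF c] chart_image_open(2)[OF c V] unfolding half_space_def openin_subtopology by auto
  have "snd c x \<in> T" using T(2) x by blast
  then obtain \<epsilon> where "\<epsilon> > 0" "\<And>y. (\<forall>i\<ge>m. y i = 0) \<Longrightarrow> (\<forall>i<m. \<bar>y i - snd c x i\<bar> < \<epsilon>) \<Longrightarrow> y \<in> T"
    by (rule openin_Euclidean_box[OF T(1)]) (rule that)
  then show ?thesis using False T(2) by (intro that[of \<epsilon>]) auto
qed

text \<open>Non-triviality of the filter is what makes a derivative within the slice unique, hence
  \<open>jac\<close> well determined.\<close>

lemma chart_slice:
  assumes c: "c \<in> atlas M" and V: "openin (mtop M) V" and x: "x \<in> fst c \<inter> V" and j: "j < m"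
  shows "snd c x j \<in> {t. (snd c x)(j := t) \<in> snd c ` (fst c \<inter> V)}"
    "at (snd c x j) within {t. (snd c x)(j := t) \<in> snd c ` (fst c \<inter> V)} \<noteq> bot"
proof -
  let ?y = "snd c x" and ?A = "{t. (snd c x)(j := t) \<in> snd c ` (fst c \<inter> V)}"
  show "?y j \<in> ?A" using x by auto
  obtain \<epsilon> where \<epsilon>: "\<epsilon> > 0" "\<And>y. (\<forall>i\<ge>m. y i = 0) \<Longrightarrow> (\<forall>i<m. \<bar>y i - snd c x i\<bar> < \<epsilon>) \<Longrightarrow>
    openin (Euclidean_space m) (snd c ` fst c) \<or> y 0 \<le> 0 \<Longrightarrow> y \<in> snd c ` (fst c \<inter> V)"
    by (rule chart_image_box[OF c V x]) (rule that)
  have "?y 0 \<le> 0" if "\<not> openin (Euclidean_space m) (snd c ` fst c)"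
    using that chart(3)[OF c] half_space_topspace[of "snd c ` fst c"] x by auto
  \<comment> \<open>Only smaller values of the coordinate are used: decreasing coordinate 0 stays in
    the half-space.\<close>
  then have "?y(j := t) \<in> snd c ` (fst c \<inter> V)" if "t \<in> {?y j - \<epsilon> <..< ?y j}" for t
    using \<epsilon>(1) j x that by (intro \<epsilon>(2)) (cases "j = 0"; auto simp: chart_sub[OF c])+
  then have "{?y j - \<epsilon> <..< ?y j} \<subseteq> ?A" by blast
  then have "?y j islimpt ?A"
    using islimpt_subset[OF islimpt_greaterThanLessThan2[of "?y j - \<epsilon>" "?y j"]] \<epsilon>(1) by simp
  then show "at (?y j) within ?A \<noteq> bot"
    using trivial_limit_within[of "?y j" ?A] by simp
qed

lemma charts_atD: "c \<in> charts_at M x \<Longrightarrow> c \<in> atlas M" "c \<in> charts_at M x \<Longrightarrow> x \<in> fst c"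
  by (auto simp: charts_at_def)

text \<open>Smoothness provides a local extension \<open>G\<close> of the transition component to an
  open set. Its partial derivatives at the point are the entries of \<open>jac\<close> by uniqueness
  of derivatives within the slice.\<close>

lemma transition_partials:
  assumes c: "c \<in> charts_at M x" and d: "d \<in> charts_at M x" and i: "i < m"
  obtains W G g where "openin (Euclidean_space m) W" "snd c x \<in> W"
    "\<And>l y. l < m \<Longrightarrow> y \<in> W \<Longrightarrow> ((\<lambda>t. G (y(l := t))) has_real_derivative g l y) (at (y l))"
    "\<And>l. l < m \<Longrightarrow> continuous_on W (g l)"
    "\<And>y. y \<in> W \<Longrightarrow> y \<in> snd c ` (fst c \<inter> fst d) \<Longrightarrow> G y = transition c d y i"
    "\<And>l. l < m \<Longrightarrow> jac c d x i l = g l (snd c x)"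
    "\<And>l. l < m \<Longrightarrow> ((\<lambda>t. transition c d ((snd c x)(l := t)) i) has_real_derivative jac c d x i l)
      (at (snd c x l) within {t. (snd c x)(l := t) \<in> snd c ` (fst c \<inter> fst d)})"
proof -
  note c' = charts_atD[OF c] and d' = charts_atD[OF d]
  let ?S = "snd c ` (fst c \<inter> fst d)" and ?y = "snd c x"
  have yS: "?y \<in> ?S" using c' d' by auto
  have "smooth_in m ?S (\<lambda>y. transition c d y i)"
    using bspec[OF chart(5)[OF d'(1) i, unfolded smooth_fun_def] c'(1)] by (simp add: case_prod_unfold)
  from bspec[OF this[unfolded smooth_in_def] yS]
  obtain W G where W: "openin (Euclidean_space m) W" "?y \<in> W"
    and C: "\<forall>n. Ck_on m n W G" and eq: "\<forall>y\<in>W \<inter> ?S. G y = transition c d y i"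
    by (elim exE conjE) (rule that)
  from spec[OF C, of "Suc 0"]
  obtain g where "\<forall>i<m. (\<forall>x\<in>W. ((\<lambda>t. G (x(i := t))) has_real_derivative g i x) (at (x i))) \<and> continuous_on W (g i)"
    unfolding Ck_on.simps by (elim exE conjE) (rule that)
  then have g: "\<And>l y. l < m \<Longrightarrow> y \<in> W \<Longrightarrow> ((\<lambda>t. G (y(l := t))) has_real_derivative g l y) (at (y l))"
    "\<And>l. l < m \<Longrightarrow> continuous_on W (g l)" by blast+
  obtain \<epsilon> where \<epsilon>: "\<epsilon> > 0" "\<And>y. (\<forall>i\<ge>m. y i = 0) \<Longrightarrow> (\<forall>i<m. \<bar>y i - ?y i\<bar> < \<epsilon>) \<Longrightarrow> y \<in> W"
    by (rule openin_Euclidean_box[OF W]) (rule that)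
  have T: "((\<lambda>t. transition c d (?y(l := t)) i) has_real_derivative g l ?y)
      (at (?y l) within {t. ?y(l := t) \<in> ?S})" if l: "l < m" for l
  proof (rule has_field_derivative_transform_within[OF _ \<epsilon>(1)])
    show "((\<lambda>t. G (?y(l := t))) has_real_derivative g l ?y) (at (?y l) within {t. ?y(l := t) \<in> ?S})"
      using g(1)[OF l W(2)] by (rule has_field_derivative_at_within)
    show "?y l \<in> {t. ?y(l := t) \<in> ?S}" using yS by simp
    fix t assume t: "t \<in> {t. ?y(l := t) \<in> ?S}" "dist t (?y l) < \<epsilon>"
    have "?y(l := t) \<in> W"
      using t(2) \<epsilon>(1) l c' by (intro \<epsilon>(2)) (auto simp: dist_real_def chart_sub)
    then show "G (?y(l := t)) = transition c d (?y(l := t)) i"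
      using t(1) by (intro bspec[OF eq]) auto
  qed
  have J: "jac c d x i l = g l ?y" if l: "l < m" for l
  proof -
    have "at (?y l) within {t. ?y(l := t) \<in> ?S} \<noteq> bot"
      using c' d' by (intro chart_slice(2) chart(1) l) auto
    then show ?thesis
      using T[OF l] unfolding jac_def
      by (intro vector_derivative_within) (auto simp: has_real_derivative_iff_has_vector_derivative)
  qed
  show ?thesis
  proof (rule that[OF W g])
    show "G y = transition c d y i" if "y \<in> W" "y \<in> ?S" for y
      using eq that by blast
    show "jac c d x i l = g l ?y" if "l < m" for l by (rule J[OF that])
    show "((\<lambda>t. transition c d (?y(l := t)) i) has_real_derivative jac c d x i l)
      (at (?y l) within {t. ?y(l := t) \<in> ?S})" if "l < m" for l
      unfolding J[OF that] by (rule T[OF that])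
  qed
qed

lemma transition_deriv:
  assumes "c \<in> charts_at M x" "d \<in> charts_at M x" "i < m" "l < m"
  shows "((\<lambda>t. transition c d ((snd c x)(l := t)) i) has_real_derivative jac c d x i l)
      (at (snd c x l) within {t. (snd c x)(l := t) \<in> snd c ` (fst c \<inter> fst d)})"
proof (rule transition_partials[OF assms(1-3)])
  assume "\<And>l. l < m \<Longrightarrow> ((\<lambda>t. transition c d ((snd c x)(l := t)) i) has_real_derivative jac c d x i l)
      (at (snd c x l) within {t. (snd c x)(l := t) \<in> snd c ` (fst c \<inter> fst d)})"
  from this[OF assms(4)] show ?thesis .
qed

lemma has_real_derivative_unique_within:
  assumes "at x within S \<noteq> bot" "(f has_real_derivative a) (at x within S)" "(f has_real_derivative b) (at x within S)"
  shows "a = b"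
  using vector_derivative_unique_within[OF assms(1)] assms(2,3)
  by (simp add: has_real_derivative_iff_has_vector_derivative)

lemma jac_self:
  assumes c: "c \<in> charts_at M x" and "i < m" "j < m"
  shows "jac c c x i j = (if i = j then 1 else 0)"
proof -
  note c' = charts_atD[OF c]
  let ?A = "{t. (snd c x)(j := t) \<in> snd c ` (fst c \<inter> fst c)}" and ?y = "snd c x"
  have "((\<lambda>t. transition c c (?y(j := t)) i) has_real_derivative jac c c x i j) (at (?y j) within ?A)"
    by (rule transition_deriv[OF c c \<open>i < m\<close> \<open>j < m\<close>])
  moreover have "((\<lambda>t. transition c c (?y(j := t)) i) has_real_derivative (if i = j then 1 else 0)) (at (?y j) within ?A)"
  proof (rule has_field_derivative_transform_within[of _ _ _ _ 1])
    show "((\<lambda>t. (?y(j := t)) i) has_real_derivative (if i = j then 1 else 0)) (at (?y j) within ?A)"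
      by (auto intro!: derivative_eq_intros)
  qed (use c' in \<open>auto simp: f_inv_into_f\<close>)
  moreover have "at (?y j) within ?A \<noteq> bot"
    using c' \<open>j < m\<close> by (intro chart_slice(2) chart(1)) auto
  ultimately show ?thesis by (rule has_real_derivative_unique_within[rotated])
qed

text \<open>The component of the transition from \<open>c\<close> to \<open>e\<close> is
  differentiated along the coordinate line \<open>j\<close> of \<open>c\<close> in two ways:
  directly, and as an extension of the transition from \<open>d\<close> to \<open>e\<close> along
  the image curve in \<open>d\<close>.\<close>

lemma jac_cocycle:
  assumes c: "c \<in> charts_at M x" and d: "d \<in> charts_at M x" and e: "e \<in> charts_at M x" and ij: "i < m" "j < m"
  shows "jac c e x i j = (\<Sum>l<m. jac d e x i l * jac c d x l j)"
proof -
  note c' = charts_atD[OF c] and d' = charts_atD[OF d] and e' = charts_atD[OF e]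
  let ?y = "snd c x" and ?z = "snd d x"
  let ?V = "fst d \<inter> fst e"
  define A where "A = {t. ?y(j := t) \<in> snd c ` (fst c \<inter> ?V)}"
  have V: "openin (mtop M) ?V" using chart(1) d' e' by (intro openin_Int) auto
  have A: "?y j \<in> A" "at (?y j) within A \<noteq> bot"
    unfolding A_def using chart_slice[OF c'(1) V _ ij(2), of x] c'(2) d'(2) e'(2) by blast+
  \<comment> \<open>The value \<open>?z\<close> off \<open>A\<close> keeps the curve in Euclidean
    space for every parameter, as the chain rule demands.\<close>
  define \<gamma> where "\<gamma> = (\<lambda>t. if t \<in> A then transition c d (?y(j := t)) else ?z)"
  have inv: "inv_into (fst c) (snd c) (?y(j := t)) \<in> fst c \<inter> ?V" if tA: "t \<in> A" for t
  proof -
    obtain p where "p \<in> fst c \<inter> ?V" "?y(j := t) = snd c p" using tA unfolding A_def by blast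
    then show ?thesis using inv_into_f_f[OF chart_inj[OF c'(1)], of p] by simp
  qed
  have \<gamma>0: "\<gamma> (?y j) = ?z"
    using A(1) inv_into_f_f[OF chart_inj[OF c'(1)] c'(2)] by (simp add: \<gamma>_def)
  have \<gamma>m: "\<gamma> t l = 0" if "m \<le> l" for t l
    using that inv[of t] chart_sub[OF d'(1)] d'(2) by (auto simp: \<gamma>_def)
  have \<gamma>d: "((\<lambda>t. \<gamma> t l) has_real_derivative jac c d x l j) (at (?y j) within A)" if l: "l < m" for l
  proof (rule has_field_derivative_transform_within[of _ _ _ _ 1])
    have "((\<lambda>t. transition c d (?y(j := t)) l) has_real_derivative jac c d x l j)
        (at (?y j) within {t. ?y(j := t) \<in> snd c ` (fst c \<inter> fst d)})"
      by (rule transition_deriv[OF c d l ij(2)])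
    then show "((\<lambda>t. transition c d (?y(j := t)) l) has_real_derivative jac c d x l j) (at (?y j) within A)"
      by (rule DERIV_subset) (auto simp: A_def)
  qed (use A(1) in \<open>auto simp: \<gamma>_def\<close>)
  obtain W G g where W: "openin (Euclidean_space m) W" "?z \<in> W"
    and g: "\<And>l y. l < m \<Longrightarrow> y \<in> W \<Longrightarrow> ((\<lambda>t. G (y(l := t))) has_real_derivative g l y) (at (y l))"
    "\<And>l. l < m \<Longrightarrow> continuous_on W (g l)"
    and GW: "\<And>y. y \<in> W \<Longrightarrow> y \<in> snd d ` (fst d \<inter> fst e) \<Longrightarrow> G y = transition d e y i"
    and J: "\<And>l. l < m \<Longrightarrow> jac d e x i l = g l ?z"
    and "\<And>l. l < m \<Longrightarrow> ((\<lambda>t. transition d e (?z(l := t)) i) has_real_derivative jac d e x i l)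
      (at (?z l) within {t. ?z(l := t) \<in> snd d ` (fst d \<inter> fst e)})"
    by (rule transition_partials[OF d e ij(1)]) (rule that)
  have "((\<lambda>t. G (\<gamma> t)) has_real_derivative (\<Sum>l<m. g l ?z * jac c d x l j)) (at (?y j) within A)"
    by (rule chain_rule_partials[OF W g \<gamma>d \<gamma>m \<gamma>0])
  moreover have "((\<lambda>t. G (\<gamma> t)) has_real_derivative jac c e x i j) (at (?y j) within A)"
  proof -
    obtain \<epsilon> where \<epsilon>: "\<epsilon> > 0" "\<And>y. (\<forall>i\<ge>m. y i = 0) \<Longrightarrow> (\<forall>i<m. \<bar>y i - ?z i\<bar> < \<epsilon>) \<Longrightarrow> y \<in> W"
      by (rule openin_Euclidean_box[OF W]) (rule that)
    have lim: "((\<lambda>t. \<gamma> t l) \<longlongrightarrow> ?z l) (at (?y j) within A)" if "l < m" for l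
      using DERIV_continuous[OF \<gamma>d[OF that]] \<gamma>0 by (simp add: continuous_within)
    have "eventually (\<lambda>t. \<forall>l\<in>{..<m}. \<bar>\<gamma> t l - ?z l\<bar> < \<epsilon>) (at (?y j) within A)"
      using tendstoD[OF lim \<epsilon>(1)] by (intro eventually_ball_finite) (auto simp: dist_real_def)
    \<comment> \<open>Within \<open>\<delta>\<close> the curve stays in \<open>W\<close>, where
      \<open>G\<close> agrees with the transition.\<close>
    then obtain \<delta> where \<delta>: "\<delta> > 0" "\<And>t. t \<in> A \<Longrightarrow> t \<noteq> ?y j \<Longrightarrow> dist t (?y j) < \<delta> \<Longrightarrow> \<forall>l\<in>{..<m}. \<bar>\<gamma> t l - ?z l\<bar> < \<epsilon>"
      unfolding eventually_at by blast
    show ?thesis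
    proof (rule has_field_derivative_transform_within[OF _ \<delta>(1) A(1)])
      have "((\<lambda>t. transition c e (?y(j := t)) i) has_real_derivative jac c e x i j)
          (at (?y j) within {t. ?y(j := t) \<in> snd c ` (fst c \<inter> fst e)})"
        by (rule transition_deriv[OF c e ij])
      then show "((\<lambda>t. transition c e (?y(j := t)) i) has_real_derivative jac c e x i j) (at (?y j) within A)"
        by (rule DERIV_subset) (auto simp: A_def)
      fix t assume t: "t \<in> A" "dist t (?y j) < \<delta>"
      let ?p = "inv_into (fst c) (snd c) (?y(j := t))"
      have p: "?p \<in> fst c \<inter> ?V" "\<gamma> t = snd d ?p" using inv[OF t(1)] t(1) by (auto simp: \<gamma>_def)
      have "\<forall>l<m. \<bar>\<gamma> t l - ?z l\<bar> < \<epsilon>"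
        using \<delta>(2)[OF t(1) _ t(2)] \<gamma>0 \<epsilon>(1) by (cases "t = ?y j") auto
      then have "\<gamma> t \<in> W" using \<gamma>m by (intro \<epsilon>(2)) auto
      then have "G (\<gamma> t) = transition d e (\<gamma> t) i" using p by (intro GW) auto
      also have "\<dots> = snd e ?p i"
        using p inv_into_f_f[OF chart_inj[OF d'(1)], of ?p] by simp
      finally show "transition c e (?y(j := t)) i = G (\<gamma> t)" by simp
    qed
  qed
  ultimately have "(\<Sum>l<m. g l ?z * jac c d x l j) = jac c e x i j"
    by (rule has_real_derivative_unique_within[OF A(2)])
  then show ?thesis using J by simp
qed

text \<open>Invariance of the boundary: if some chart mapped a boundary point to an interior point, the
  first coordinate of a boundary chart would have a local maximum there, so the Jacobian would have
  a zero row.\<close>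

lemma bdry_chart_coord:
  assumes x: "x \<in> bdry_points M" and c: "c \<in> charts_at M x"
  shows "snd c ` fst c \<subseteq> {y. y 0 \<le> 0}" "snd c x 0 = 0"
proof -
  obtain d where d: "d \<in> charts_at M x" "snd d ` fst d \<subseteq> {y. y 0 \<le> 0}" "snd d x 0 = 0" and m0: "0 < m"
    using x unfolding bdry_points_def charts_at_def by (auto simp: case_prod_unfold)
  note c' = charts_atD[OF c] and d' = charts_atD[OF d(1)]
  let ?y = "snd c x"
  have "\<not> (openin (Euclidean_space m) (snd c ` fst c) \<or> ?y 0 < 0)"
  proof
    assume int: "openin (Euclidean_space m) (snd c ` fst c) \<or> ?y 0 < 0"
    obtain \<epsilon> where \<epsilon>: "\<epsilon> > 0" "\<And>y. (\<forall>i\<ge>m. y i = 0) \<Longrightarrow> (\<forall>i<m. \<bar>y i - ?y i\<bar> < \<epsilon>) \<Longrightarrow>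
      openin (Euclidean_space m) (snd c ` fst c) \<or> y 0 \<le> 0 \<Longrightarrow> y \<in> snd c ` (fst c \<inter> fst d)"
      by (rule chart_image_box[OF c'(1) chart(1)[OF d'(1)] IntI[OF c'(2) d'(2)]]) (rule that)
    \<comment> \<open>In a half-space chart the bound \<open>- ?y 0\<close> prevents coordinate 0
      from becoming positive.\<close>
    define \<delta> where "\<delta> = (if openin (Euclidean_space m) (snd c ` fst c) then \<epsilon> else min \<epsilon> (- ?y 0))"
    have \<delta>: "\<delta> > 0" "\<delta> \<le> \<epsilon>" using int \<epsilon>(1) by (auto simp: \<delta>_def)
    have zero: "jac c d x 0 j = 0" if j: "j < m" for j
    proof -
      let ?A = "{t. ?y(j := t) \<in> snd c ` (fst c \<inter> fst d)}" and ?B = "{?y j - \<delta> <..< ?y j + \<delta>}"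
      have BA: "?B \<subseteq> ?A"
      proof
        fix t assume t: "t \<in> ?B"
        then have a: "\<bar>t - ?y j\<bar> < \<delta>" by auto
        have "openin (Euclidean_space m) (snd c ` fst c) \<or> (?y(j := t)) 0 \<le> 0"
          using a int by (cases "j = 0") (auto simp: \<delta>_def split: if_splits)
        then show "t \<in> ?A"
          using a \<delta> j c' \<epsilon>(1) by (auto intro!: \<epsilon>(2) simp: chart_sub)
      qed
      have "((\<lambda>t. transition c d (?y(j := t)) 0) has_real_derivative jac c d x 0 j) (at (?y j) within ?A)"
        by (rule transition_deriv[OF c d(1) m0 j])
      \<comment> \<open>The slice contains an interval around the point, so the derivative is
        two-sided and the criterion for a local maximum applies.\<close>
      then have "((\<lambda>t. transition c d (?y(j := t)) 0) has_real_derivative jac c d x 0 j) (at (?y j))"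
        using at_within_open_subset[of "?y j" ?B ?A] BA \<delta>(1) by simp
      then show ?thesis
      proof (rule DERIV_local_max[OF _ \<delta>(1)], intro allI impI)
        fix t assume "\<bar>?y j - t\<bar> < \<delta>"
        then have "t \<in> ?B" by (auto simp: abs_less_iff)
        then have "?y(j := t) \<in> snd c ` (fst c \<inter> fst d)" using BA by blast
        then obtain p where p: "p \<in> fst c \<inter> fst d" "?y(j := t) = snd c p" by blast
        then have "transition c d (?y(j := t)) 0 \<le> 0"
          using d(2) inv_into_f_f[OF chart_inj[OF c'(1)], of p] by auto
        also have "0 = transition c d (?y(j := ?y j)) 0"
          using d(3) inv_into_f_f[OF chart_inj[OF c'(1)] c'(2)] by simp
        finally show "transition c d (?y(j := t)) 0 \<le> transition c d (?y(j := ?y j)) 0" .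
      qed
    qed
    \<comment> \<open>Through \<open>c\<close>, the diagonal entry 1 of the identity becomes a
      combination of the vanishing row 0.\<close>
    have "jac d d x 0 0 = (\<Sum>l<m. jac c d x 0 l * jac d c x l 0)"
      using jac_cocycle[OF d(1) c d(1) m0 m0] .
    then show False using jac_self[OF d(1) m0 m0] zero by simp
  qed
  then have "openin (half_space m) (snd c ` fst c)" "\<not> ?y 0 < 0" using chart(3)[OF c'(1)] by auto
  then show "snd c ` fst c \<subseteq> {y. y 0 \<le> 0}" "?y 0 = 0"
    using half_space_topspace[of "snd c ` fst c"] c'(2) by fastforce+
qed

end

section \<open>Tangent spaces and their coordinate frames\<close>

lemma tangent_spaceD:
  assumes "v \<in> tangent_space N x"
  shows "c \<notin> charts_at N x \<Longrightarrow> v c = 0" "c \<in> charts_at N x \<Longrightarrow> mdim N \<le> i \<Longrightarrow> v c i = 0"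
    "c \<in> charts_at N x \<Longrightarrow> d \<in> charts_at N x \<Longrightarrow> i < mdim N \<Longrightarrow> v d i = (\<Sum>j<mdim N. jac c d x i j * v c j)"
  using assms unfolding tangent_space_def mem_Collect_eq topspace_Euclidean_space by blast+

lemma tangent_spaceI:
  assumes "\<And>c. c \<notin> charts_at N x \<Longrightarrow> v c = 0" "\<And>c i. c \<in> charts_at N x \<Longrightarrow> mdim N \<le> i \<Longrightarrow> v c i = 0"
    "\<And>c d i. c \<in> charts_at N x \<Longrightarrow> d \<in> charts_at N x \<Longrightarrow> i < mdim N \<Longrightarrow>
      v d i = (\<Sum>j<mdim N. jac c d x i j * v c j)"
  shows "v \<in> tangent_space N x"
  using assms unfolding tangent_space_def mem_Collect_eq topspace_Euclidean_space by blast

text \<open>The components in one chart determine those in all others through the Jacobians.\<close>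

lemma tangent_space_eqI:
  assumes uv: "u \<in> tangent_space N x" "v \<in> tangent_space N x" and c: "c \<in> charts_at N x" and eq: "u c = v c"
  shows "u = v"
proof (rule ext)
  fix d
  show "u d = v d"
  proof (cases "d \<in> charts_at N x")
    case True
    show ?thesis
    proof
      fix i
      show "u d i = v d i"
      proof (cases "i < mdim N")
        case i: True
        show ?thesis
          unfolding tangent_spaceD(3)[OF uv(1) c True i] tangent_spaceD(3)[OF uv(2) c True i] eq ..
      next
        case False
        then show ?thesis using tangent_spaceD(2)[OF uv(1) True] tangent_spaceD(2)[OF uv(2) True] by simp
      qed
    qed
  next
    case False
    then show ?thesis using tangent_spaceD(1)[OF uv(1)] tangent_spaceD(1)[OF uv(2)] by simp
  qed
qed

lemma subspace_tangent_space: "subspace (tangent_space N x)"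
proof (rule subspaceI)
  fix u v assume u: "u \<in> tangent_space N x" and v: "v \<in> tangent_space N x"
  show "u + v \<in> tangent_space N x"
  proof (rule tangent_spaceI)
    fix c d i assume cd: "c \<in> charts_at N x" "d \<in> charts_at N x" "i < mdim N"
    show "(u + v) d i = (\<Sum>j<mdim N. jac c d x i j * (u + v) c j)"
      using tangent_spaceD(3)[OF u cd] tangent_spaceD(3)[OF v cd]
      by (simp only: plus_fun_apply sum.distrib distrib_left)
  qed (simp_all add: tangent_spaceD(1,2)[OF u] tangent_spaceD(1,2)[OF v])
next
  fix a v assume v: "v \<in> tangent_space N x"
  show "a *\<^sub>R v \<in> tangent_space N x"
  proof (rule tangent_spaceI)
    fix c d i assume cd: "c \<in> charts_at N x" "d \<in> charts_at N x" "i < mdim N"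
    show "(a *\<^sub>R v) d i = (\<Sum>j<mdim N. jac c d x i j * (a *\<^sub>R v) c j)"
      using tangent_spaceD(3)[OF v cd]
      by (simp only: scaleR_fun_apply real_scaleR_def sum_distrib_left mult.left_commute)
  qed (simp_all add: tangent_spaceD(1,2)[OF v])
qed (rule tangent_spaceI; simp)

text \<open>The Jacobian identities are premises so that the result serves both the manifold and its
  boundary. The vector \<open>ext w\<close> transports coordinates \<open>w\<close> from
  \<open>c\<close> to all charts; the cocycle identity makes it a tangent vector.\<close>

lemma tangent_basis:
  assumes self: "\<And>c i j. c \<in> charts_at N x \<Longrightarrow> i < mdim N \<Longrightarrow> j < mdim N \<Longrightarrow>
      jac c c x i j = (if i = j then 1 else 0)"
    and cocycle: "\<And>c d e i j. c \<in> charts_at N x \<Longrightarrow> d \<in> charts_at N x \<Longrightarrow> e \<in> charts_at N x \<Longrightarrow>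
      i < mdim N \<Longrightarrow> j < mdim N \<Longrightarrow> jac c e x i j = (\<Sum>l<mdim N. jac d e x i l * jac c d x l j)"
    and c: "c \<in> charts_at N x"
  shows "basis_on (tangent_space N x) (mdim N) (coord_vec N c x) (\<lambda>i v. v c i)"
proof -
  let ?n = "mdim N" and ?T = "tangent_space N x"
  define ext where "ext = (\<lambda>(w :: nat \<Rightarrow> real) d. if d \<in> charts_at N x
    then (\<lambda>i. if i < ?n then \<Sum>j<?n. jac c d x i j * w j else 0) else 0)"
  have ext_in: "ext w \<in> ?T" for w
  proof (rule tangent_spaceI)
    fix d e i assume de: "d \<in> charts_at N x" "e \<in> charts_at N x" and i: "i < ?n"
    have "(\<Sum>l<?n. jac d e x i l * (\<Sum>j<?n. jac c d x l j * w j)) =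
        (\<Sum>j<?n. (\<Sum>l<?n. jac d e x i l * jac c d x l j) * w j)"
      unfolding sum_distrib_left sum_distrib_right by (subst sum.swap) (simp add: mult_ac)
    also have "\<dots> = (\<Sum>j<?n. jac c e x i j * w j)"
      using cocycle[OF c de i] by simp
    finally show "ext w e i = (\<Sum>j<?n. jac d e x i j * ext w d j)"
      using de i by (simp add: ext_def)
  qed (simp_all add: ext_def)
  have ext_c: "ext w c = w" if "\<And>i. ?n \<le> i \<Longrightarrow> w i = 0" for w
  proof
    fix i
    have "(\<Sum>j<?n. jac c c x i j * w j) = (\<Sum>j<?n. if i = j then w j else 0)" if "i < ?n"
      using self[OF c that] by (intro sum.cong) auto
    then show "ext w c i = w i" using that c by (auto simp: ext_def)
  qed
  \<comment> \<open>\<open>coord_vec\<close> is an inverse image, meaningful only once the unit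
    vector is known to be attained.\<close>
  have unit: "unit_vec j \<in> (\<lambda>v. v c) ` ?T" if "j < ?n" for j
    by (rule image_eqI[of _ _ "ext (unit_vec j)"])
      (use that in \<open>auto simp: ext_in ext_c unit_vec_def\<close>)
  have e: "coord_vec N c x j \<in> ?T" "coord_vec N c x j c = unit_vec j" if "j < ?n" for j
    unfolding coord_vec_def using inv_into_into[OF unit[OF that]] f_inv_into_f[OF unit[OF that]] by auto
  have "(\<Sum>i<?n. v c i *\<^sub>R coord_vec N c x i) = v" if v: "v \<in> ?T" for v
  proof (rule tangent_space_eqI[OF _ v c])
    show "(\<Sum>i<?n. v c i *\<^sub>R coord_vec N c x i) \<in> ?T"
      using e by (intro subspace_sum subspace_scale subspace_tangent_space) auto
    show "(\<Sum>i<?n. v c i *\<^sub>R coord_vec N c x i) c = v c"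
    proof
      fix l
      have "(\<Sum>i<?n. v c i *\<^sub>R coord_vec N c x i) c l = (\<Sum>i<?n. if i = l then v c l else 0)"
        unfolding sum_fun_apply using e(2) by (intro sum.cong) (auto simp: unit_vec_def)
      also have "\<dots> = v c l"
        using tangent_spaceD(2)[OF v c] by simp
      finally show "(\<Sum>i<?n. v c i *\<^sub>R coord_vec N c x i) c l = v c l" .
    qed
  qed
  moreover have "linear_on ?T (\<lambda>v. v c i)" for i by (auto intro!: linear_onI)
  ultimately show ?thesis
    unfolding basis_on_def using subspace_tangent_space e by (auto simp: unit_vec_def)
qed

lemma dual_vec_coord_covec: "dual_vec (tangent_space N x) (\<lambda>i v. v c i) = coord_covec N c x"
  by (auto simp: dual_vec_def coord_covec_def fun_eq_iff)

text \<open>\<open>vector_derivative\<close> is a choice from the derivative predicate, and both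
  functions satisfy the same predicate within \<open>A\<close>.\<close>

lemma vector_derivative_cong_on:
  assumes "\<And>t. t \<in> A \<Longrightarrow> f t = g t" "a \<in> A"
  shows "vector_derivative f (at a within A) = vector_derivative g (at a within A)"
proof -
  have "(f has_vector_derivative D) (at a within A) \<longleftrightarrow> (g has_vector_derivative D) (at a within A)" for D
    using assms has_vector_derivative_transform[of a A g f D] has_vector_derivative_transform[of a A f g D] by auto
  then show ?thesis by (simp add: vector_derivative_def)
qed

section \<open>Charts, Jacobians and tangent spaces of the boundary\<close>

context smooth_mfd
begin

lemma bdry_chart_simps [simp]:
  "fst (bdry_chart M c) = fst c \<inter> bdry_points M" "snd (bdry_chart M c) x i = snd c x (Suc i)"
  by (auto simp: bdry_chart_def)

text \<open>By \<open>bdry_chart_coord\<close> a chart around one boundary point is a half-space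
  chart, so the definition applies at \<open>p\<close>; the converse is invariance at
  \<open>p\<close> itself.\<close>

lemma bdry_points_iff:
  assumes "c \<in> charts_at M x" "x \<in> bdry_points M" "p \<in> fst c"
  shows "p \<in> bdry_points M \<longleftrightarrow> snd c p 0 = 0"
proof
  assume "snd c p 0 = 0"
  then show "p \<in> bdry_points M"
    using bdry_chart_coord(1)[OF assms(2,1)] charts_atD[OF assms(1)] assms(2,3)
    unfolding bdry_points_def by (auto simp: case_prod_unfold)
next
  assume "p \<in> bdry_points M"
  then show "snd c p 0 = 0"
    using bdry_chart_coord(2)[of p c] assms by (auto simp: charts_at_def)
qed

lemma bdry_chart_inj:
  assumes "c \<in> atlas M" shows "inj_on (snd (bdry_chart M c)) (fst (bdry_chart M c))"
proof (rule inj_onI)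
  fix p q assume pq: "p \<in> fst (bdry_chart M c)" "q \<in> fst (bdry_chart M c)"
    and eq: "snd (bdry_chart M c) p = snd (bdry_chart M c) q"
  have "snd c p i = snd c q i" for i
  proof (cases i)
    case 0
    then show ?thesis using pq assms bdry_chart_coord(2)[of p c] bdry_chart_coord(2)[of q c] by (auto simp: charts_at_def)
  next
    case (Suc j)
    then show ?thesis using fun_cong[OF eq, of j] by simp
  qed
  then show "p = q" using inj_onD[OF chart_inj[OF assms], of p q] pq by (auto simp: fun_eq_iff)
qed

text \<open>Moving a coordinate other than 0 leaves coordinate 0 at the value 0, hence stays in the
  boundary.\<close>

lemma bdry_slice:
  assumes x: "x \<in> bdry_points M" and c: "c \<in> charts_at M x" and d: "d \<in> charts_at M x"
    and t: "(snd c x)(Suc j := t) \<in> snd c ` (fst c \<inter> fst d)"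
  obtains p where "p \<in> fst c \<inter> fst d \<inter> bdry_points M" "snd c p = (snd c x)(Suc j := t)"
    "inv_into (fst c) (snd c) ((snd c x)(Suc j := t)) = p"
proof -
  obtain p where p: "p \<in> fst c \<inter> fst d" "(snd c x)(Suc j := t) = snd c p" using t by blast
  have "snd c p 0 = ((snd c x)(Suc j := t)) 0" by (simp only: p(2))
  then have "snd c p 0 = 0" using bdry_chart_coord(2)[OF x c] by simp
  then have "p \<in> bdry_points M" using bdry_points_iff[OF c x] p(1) by simp
  moreover have "inv_into (fst c) (snd c) ((snd c x)(Suc j := t)) = p"
    using p inv_into_f_f[OF chart_inj[OF charts_atD(1)[OF c]], of p] by simp
  ultimately show ?thesis using p that by auto
qed

text \<open>Along a coordinate line tangent to the boundary, coordinate 0 of every other chart is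
  constantly 0.\<close>

lemma jac_bdry_zero:
  assumes x: "x \<in> bdry_points M" and c: "c \<in> charts_at M x" and d: "d \<in> charts_at M x" and j: "Suc j < m"
  shows "jac c d x 0 (Suc j) = 0"
proof -
  let ?A = "{t. (snd c x)(Suc j := t) \<in> snd c ` (fst c \<inter> fst d)}"
  have nz: "snd c x (Suc j) \<in> ?A" "at (snd c x (Suc j)) within ?A \<noteq> bot"
    using chart_slice[OF charts_atD(1)[OF c] chart(1)[OF charts_atD(1)[OF d]] _ j, of x]
      charts_atD(2)[OF c] charts_atD(2)[OF d] by blast+
  have "((\<lambda>t. transition c d ((snd c x)(Suc j := t)) 0) has_real_derivative jac c d x 0 (Suc j))
      (at (snd c x (Suc j)) within ?A)"
    using j by (intro transition_deriv[OF c d]) auto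
  moreover have "((\<lambda>t. transition c d ((snd c x)(Suc j := t)) 0) has_real_derivative 0)
      (at (snd c x (Suc j)) within ?A)"
  proof (rule has_field_derivative_transform_within[of "\<lambda>_. 0" _ _ _ 1])
    fix t assume "t \<in> ?A"
    then obtain p where "p \<in> fst c \<inter> fst d \<inter> bdry_points M"
      "inv_into (fst c) (snd c) ((snd c x)(Suc j := t)) = p"
      using bdry_slice[OF x c d] by blast
    then show "0 = transition c d ((snd c x)(Suc j := t)) 0"
      using bdry_points_iff[OF d x, of p] by simp
  qed (use nz(1) in auto)
  ultimately show ?thesis by (rule has_real_derivative_unique_within[OF nz(2)])
qed

text \<open>The slice in direction \<open>j\<close> of the boundary chart and the slice in direction
  \<open>Suc j\<close> of \<open>c\<close> have the same parameters and points, and the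
  differentiated functions agree on them.\<close>

lemma jac_bdry_chart:
  assumes x: "x \<in> bdry_points M" and c: "c \<in> charts_at M x" and d: "d \<in> charts_at M x"
  shows "jac (bdry_chart M c) (bdry_chart M d) x i j = jac c d x (Suc i) (Suc j)"
proof -
  let ?c = "bdry_chart M c" and ?d = "bdry_chart M d"
  let ?A = "{t. (snd c x)(Suc j := t) \<in> snd c ` (fst c \<inter> fst d)}"
  have xc: "x \<in> fst c" "x \<in> fst d" "c \<in> atlas M" using c d by (auto simp: charts_at_def)
  have sl: "snd ?c p = (snd ?c x)(j := t)" if "snd c p = (snd c x)(Suc j := t)" for p t
    using that by (auto simp: fun_eq_iff)
  have "(snd ?c x)(j := t) \<in> snd ?c ` (fst ?c \<inter> fst ?d) \<longleftrightarrow> t \<in> ?A" for t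
  proof
    assume "(snd ?c x)(j := t) \<in> snd ?c ` (fst ?c \<inter> fst ?d)"
    then obtain p where p: "p \<in> fst c \<inter> fst d \<inter> bdry_points M" "(snd ?c x)(j := t) = snd ?c p" by auto
    have "((snd c x)(Suc j := t)) i = snd c p i" for i
    proof (cases i)
      case 0
      then show ?thesis using p bdry_points_iff[OF c x, of p] bdry_chart_coord(2)[OF x c] by auto
    next
      case (Suc i')
      then show ?thesis using fun_cong[OF p(2), of i'] by auto
    qed
    then have "(snd c x)(Suc j := t) = snd c p" by blast
    then show "t \<in> ?A" using p(1) by auto
  next
    assume "t \<in> ?A"
    then obtain p where "p \<in> fst c \<inter> fst d \<inter> bdry_points M" "snd c p = (snd c x)(Suc j := t)"
      using bdry_slice[OF x c d] by blast
    then show "(snd ?c x)(j := t) \<in> snd ?c ` (fst ?c \<inter> fst ?d)"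
      using sl[of p t] by (auto intro!: image_eqI[of _ _ p])
  qed
  then have set_eq: "{t. (snd ?c x)(j := t) \<in> snd ?c ` (fst ?c \<inter> fst ?d)} = ?A" by blast
  have "vector_derivative (\<lambda>t. transition ?c ?d ((snd ?c x)(j := t)) i) (at (snd c x (Suc j)) within ?A) =
    vector_derivative (\<lambda>t. transition c d ((snd c x)(Suc j := t)) (Suc i)) (at (snd c x (Suc j)) within ?A)"
  proof (rule vector_derivative_cong_on)
    fix t assume "t \<in> ?A"
    then obtain p where p: "p \<in> fst c \<inter> fst d \<inter> bdry_points M" "snd c p = (snd c x)(Suc j := t)"
      "inv_into (fst c) (snd c) ((snd c x)(Suc j := t)) = p"
      using bdry_slice[OF x c d] by blast
    have "inv_into (fst ?c) (snd ?c) ((snd ?c x)(j := t)) = p"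
      using inv_into_f_f[OF bdry_chart_inj[OF xc(3)], of p] sl[OF p(2)] p(1) by auto
    then show "transition ?c ?d ((snd ?c x)(j := t)) i = transition c d ((snd c x)(Suc j := t)) (Suc i)"
      using p(3) by simp
  qed (use xc in auto)
  then show ?thesis unfolding jac_def set_eq by simp
qed

lemma tangent_basis_M:
  "c \<in> charts_at M x \<Longrightarrow> basis_on (tangent_space M x) m (coord_vec M c x) (\<lambda>i v. v c i)"
  by (rule tangent_basis[OF jac_self jac_cocycle])

lemma charts_at_bdry:
  "c' \<in> charts_at (bdry M) x \<Longrightarrow> x \<in> bdry_points M \<and> (\<exists>c\<in>charts_at M x. c' = bdry_chart M c)"
proof -
  assume "c' \<in> charts_at (bdry M) x"
  then have "c' \<in> bdry_chart M ` atlas M" "x \<in> fst c'" by (simp_all add: charts_at_def bdry_def)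
  then obtain c where "c \<in> atlas M" "c' = bdry_chart M c" "x \<in> fst c \<inter> bdry_points M" by force
  then show ?thesis by (intro conjI bexI[of _ c]) (simp_all add: charts_at_def)
qed

lemma mdim_bdry: "mdim (bdry M) = m - 1"
  by (simp add: bdry_def)

text \<open>The boundary Jacobian is the block without row and column 0. It inherits the cocycle
  identity because the tangential entries of row 0 vanish.\<close>

lemma tangent_basis_bdry:
  assumes c: "c \<in> charts_at (bdry M) x"
  shows "basis_on (tangent_space (bdry M) x) (mdim (bdry M)) (coord_vec (bdry M) c x) (\<lambda>i v. v c i)"
proof (rule tangent_basis[OF _ _ c])
  have x: "x \<in> bdry_points M" using charts_at_bdry[OF c] by simp
  fix c i j assume "c \<in> charts_at (bdry M) x" and ij: "i < mdim (bdry M)" "j < mdim (bdry M)"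
  then obtain c0 where c0: "c0 \<in> charts_at M x" "c = bdry_chart M c0" using charts_at_bdry by blast
  show "jac c c x i j = (if i = j then 1 else 0)"
    using ij jac_self[OF c0(1), of "Suc i" "Suc j"] unfolding c0(2) jac_bdry_chart[OF x c0(1) c0(1)] mdim_bdry by simp
next
  have x: "x \<in> bdry_points M" using charts_at_bdry[OF c] by simp
  fix c d e i j assume "c \<in> charts_at (bdry M) x" "d \<in> charts_at (bdry M) x" "e \<in> charts_at (bdry M) x"
    and ij: "i < mdim (bdry M)" "j < mdim (bdry M)"
  then obtain c0 d0 e0 where 0: "c0 \<in> charts_at M x" "d0 \<in> charts_at M x" "e0 \<in> charts_at M x"
    and eq: "c = bdry_chart M c0" "d = bdry_chart M d0" "e = bdry_chart M e0"
    using charts_at_bdry by metis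
  have m: "m = Suc (m - 1)" "Suc i < m" "Suc j < m" using ij by (auto simp: mdim_bdry)
  have "jac c0 e0 x (Suc i) (Suc j) = (\<Sum>l<m. jac d0 e0 x (Suc i) l * jac c0 d0 x l (Suc j))"
    using m by (intro jac_cocycle 0) auto
  also have "\<dots> = (\<Sum>l<Suc (m - 1). jac d0 e0 x (Suc i) l * jac c0 d0 x l (Suc j))"
    using m(1) by simp
  \<comment> \<open>The term \<open>l = 0\<close> drops out by \<open>jac_bdry_zero\<close>.\<close>
  also have "\<dots> = (\<Sum>l<m - 1. jac d0 e0 x (Suc i) (Suc l) * jac c0 d0 x (Suc l) (Suc j))"
    unfolding sum.lessThan_Suc_shift using jac_bdry_zero[OF x 0(1,2) m(3)] by simp
  finally show "jac c e x i j = (\<Sum>l<mdim (bdry M). jac d e x i l * jac c d x l j)"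
    unfolding eq jac_bdry_chart[OF x 0(1,3)] jac_bdry_chart[OF x 0(2,3)] jac_bdry_chart[OF x 0(1,2)] mdim_bdry .
qed

end

section \<open>Smooth functions\<close>

lemma Ck_on_subset: "Ck_on m n W f \<Longrightarrow> V \<subseteq> W \<Longrightarrow> Ck_on m n V f"
proof (induction n arbitrary: f)
  case (Suc n)
  then obtain g where "\<forall>i<m. (\<forall>x\<in>W. ((\<lambda>t. f (x(i := t))) has_real_derivative g i x) (at (x i))) \<and> Ck_on m n W (g i)"
    by auto
  with Suc show ?case by (auto intro!: exI[of _ g] intro: continuous_on_subset)
qed (auto intro: continuous_on_subset)

lemma Ck_on_const: "Ck_on m n W (\<lambda>_. k)"
proof (induction n arbitrary: k)
  case (Suc n)
  then show ?case by (auto intro!: exI[of _ "\<lambda>_ _. 0"])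
qed simp

lemma Ck_on_comb: "Ck_on m n W f \<Longrightarrow> Ck_on m n W g \<Longrightarrow> Ck_on m n W (\<lambda>x. a * f x + b * g x)"
proof (induction n arbitrary: f g)
  case (Suc n)
  from Suc.prems(1) obtain f' where f': "\<forall>i<m. (\<forall>x\<in>W. ((\<lambda>t. f (x(i := t))) has_real_derivative f' i x) (at (x i))) \<and> Ck_on m n W (f' i)"
    by auto
  from Suc.prems(2) obtain g' where g': "\<forall>i<m. (\<forall>x\<in>W. ((\<lambda>t. g (x(i := t))) has_real_derivative g' i x) (at (x i))) \<and> Ck_on m n W (g' i)"
    by auto
  have "((\<lambda>t. a * f (x(i := t)) + b * g (x(i := t))) has_real_derivative a * f' i x + b * g' i x) (at (x i))"
    if "i < m" "x \<in> W" for i x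
    using f' g' that by (intro DERIV_add DERIV_cmult) auto
  moreover have "Ck_on m n W (\<lambda>x. a * f' i x + b * g' i x)" if "i < m" for i
    using f' g' that by (intro Suc.IH) auto
  moreover have "continuous_on W (\<lambda>x. a * f x + b * g x)"
    using Suc.prems by (intro continuous_intros) auto
  ultimately show ?case
    unfolding Ck_on.simps by (intro conjI exI[of _ "\<lambda>i x. a * f' i x + b * g' i x"]) auto
qed (auto intro!: continuous_intros)

text \<open>The combination of two local extensions is smooth on the intersection of their domains.
  Combinations with constant coefficients are what the component formulas for \<open>Phi\<close> and
  \<open>Phi_inv\<close> consist of.\<close>

lemma smooth_in_comb:
  assumes "smooth_in m S f" "smooth_in m S g"
  shows "smooth_in m S (\<lambda>x. a * f x + b * g x)"
  unfolding smooth_in_def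
proof
  fix x assume "x \<in> S"
  with assms obtain W f' V g' where
    W: "openin (Euclidean_space m) W" "x \<in> W" "\<forall>n. Ck_on m n W f'" "\<forall>y\<in>W \<inter> S. f' y = f y" and
    V: "openin (Euclidean_space m) V" "x \<in> V" "\<forall>n. Ck_on m n V g'" "\<forall>y\<in>V \<inter> S. g' y = g y"
    unfolding smooth_in_def by meson
  show "\<exists>W h. openin (Euclidean_space m) W \<and> x \<in> W \<and> (\<forall>n. Ck_on m n W h) \<and> (\<forall>y\<in>W \<inter> S. h y = a * f y + b * g y)"
  proof (intro exI conjI allI)
    show "openin (Euclidean_space m) (W \<inter> V)" "x \<in> W \<inter> V" using W V by auto
    show "Ck_on m n (W \<inter> V) (\<lambda>y. a * f' y + b * g' y)" for n
      using W(3) V(3) by (intro Ck_on_comb) (auto intro: Ck_on_subset)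
    show "\<forall>y\<in>W \<inter> V \<inter> S. a * f' y + b * g' y = a * f y + b * g y"
      using W(4) V(4) by auto
  qed
qed

lemma smooth_fun_comb:
  "smooth_fun N W f \<Longrightarrow> smooth_fun N W g \<Longrightarrow> smooth_fun N W (\<lambda>x. a * f x + b * g x)"
  unfolding smooth_fun_def using smooth_in_comb by fastforce

lemma smooth_fun_add: "smooth_fun N W f \<Longrightarrow> smooth_fun N W g \<Longrightarrow> smooth_fun N W (\<lambda>x. f x + g x)"
  using smooth_fun_comb[of N W f g 1 1] by simp

lemma smooth_fun_scale: "smooth_fun N W f \<Longrightarrow> smooth_fun N W (\<lambda>x. a * f x)"
  using smooth_fun_comb[of N W f f a 0] by simp

text \<open>The chart sums agree for every partition of unity, so the two definite descriptions have
  the same defining predicate.\<close>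

lemma mfd_integral_cong:
  assumes "\<And>c x. c \<in> atlas N \<Longrightarrow> x \<in> fst c \<Longrightarrow> \<omega> x = \<omega>' x"
  shows "mfd_integral N \<omega> = mfd_integral N \<omega>'"
proof -
  let ?i = "\<lambda>\<omega> c \<rho> y. if y \<in> snd c ` fst c
          then let x = inv_into (fst c) (snd c) y in
            \<rho> x * chart_sign N c x * \<omega> x (map (coord_vec N c x) [0..<mdim N])
          else 0"
  let ?s = "\<lambda>\<omega> P. \<Sum>(c, \<rho>)\<in>P. euclidean_integral (mdim N) (?i \<omega> c \<rho>)"
  have "?s \<omega> P = ?s \<omega>' P" if P: "partition_of_unity N P" for P
  proof (intro sum.cong refl)
    fix z assume z: "z \<in> P"
    obtain c \<rho> where cr: "z = (c, \<rho>)" by (cases z)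
    then have "c \<in> atlas N" using P z unfolding partition_of_unity_def by auto
    then have "?i \<omega> c \<rho> = ?i \<omega>' c \<rho>"
      by (intro ext) (simp add: Let_def assms inv_into_into)
    then show "(case z of (c, \<rho>) \<Rightarrow> euclidean_integral (mdim N) (?i \<omega> c \<rho>)) =
        (case z of (c, \<rho>) \<Rightarrow> euclidean_integral (mdim N) (?i \<omega>' c \<rho>))"
      unfolding cr prod.case by (rule arg_cong)
  qed
  then have "(\<lambda>I. \<forall>P. partition_of_unity N P \<longrightarrow> I = ?s \<omega> P) = (\<lambda>I. \<forall>P. partition_of_unity N P \<longrightarrow> I = ?s \<omega>' P)"
    by (intro ext) (simp cong: imp_cong)
  then show ?thesis unfolding mfd_integral_def by (rule arg_cong)
qed

section \<open>The isomorphism on sections\<close>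

text \<open>Holds for \<open>M\<close> with \<open>r = m\<close> and for its boundary with \<open>r = m - 1\<close>; the degree is constrained
  only at the points of \<open>N\<close> because for \<open>m = 0\<close> the boundary is empty and \<open>r = -1\<close>.\<close>

locale bundle_on_mfd =
  fixes N :: "'a mfd" and G :: "('a, 'f::real_vector) vbundle" and r :: int and k :: nat
  assumes cover: "topspace (mtop N) = (\<Union>c\<in>atlas N. fst c)"
    and inj: "c \<in> atlas N \<Longrightarrow> inj_on (snd c) (fst c)"
    and coords: "c \<in> atlas N \<Longrightarrow> x \<in> fst c \<Longrightarrow> mdim N \<le> i \<Longrightarrow> snd c x i = 0"
    and tangent: "c \<in> charts_at N x \<Longrightarrow>
      basis_on (tangent_space N x) (mdim N) (coord_vec N c x) (\<lambda>i v. v c i)"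
    and fibre: "x \<in> topspace (mtop N) \<Longrightarrow> \<exists>nF f cf. basis_on (fibre G x) nF f cf"
    and degree: "x \<in> topspace (mtop N) \<Longrightarrow> r = int (mdim N)"
begin

abbreviation "T \<equiv> tangent_space N"
abbreviation "P x \<equiv> Phi_fibre (T x) (fibre G x) k r"
abbreviation "A x \<equiv> mixed (T x) (fibre G x) (int k) r"
abbreviation "B x \<equiv> alt_maps (T x) (r - int k) (dual_sp (fibre G x))"

lemma based_at:
  assumes "c \<in> atlas N" "x \<in> fst c"
  obtains nF f cf where "based_fibre (T x) (mdim N) (coord_vec N c x) (\<lambda>i v. v c i) (fibre G x) nF f cf"
proof -
  have "x \<in> topspace (mtop N)" using assms cover by auto
  then obtain nF f cf where "basis_on (fibre G x) nF f cf" using fibre by blast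
  moreover have "c \<in> charts_at N x" using assms by (simp add: charts_at_def)
  ultimately show ?thesis using that tangent unfolding based_fibre_def by blast
qed

lemma subspace_fibre: "x \<in> topspace (mtop N) \<Longrightarrow> subspace (fibre G x)"
  using fibre basis_onD(1) by blast

text \<open>None of these facts mentions a basis, so the frame of any chart at the point may be used
  to obtain them.\<close>

lemma fibrewise:
  assumes "x \<in> topspace (mtop N)"
  shows "bij_betw (P x) (A x) (B x)" "linear_on (A x) (P x)"
    "\<kappa> \<in> A x \<Longrightarrow> contr (T x) (fibre G x) k r \<kappa> \<phi> = wedge (T x) (fibre G x) k (r - int k) \<phi> (P x \<kappa>)"
proof -
  obtain c where c: "c \<in> atlas N" "x \<in> fst c" using assms cover by auto
  obtain nF f cf where "based_fibre (T x) (mdim N) (coord_vec N c x) (\<lambda>i v. v c i) (fibre G x) nF f cf"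
    by (rule based_at[OF c])
  then interpret based_fibre "T x" "mdim N" "coord_vec N c x" "\<lambda>i v. v c i" "fibre G x" nF f cf .
  show "bij_betw (P x) (A x) (B x)"
    unfolding degree[OF assms] by (rule Phi_fibre_bij)
  show "linear_on (A x) (P x)"
    by (rule Phi_fibre_linear)
  show "contr (T x) (fibre G x) k r \<kappa> \<phi> = wedge (T x) (fibre G x) k (r - int k) \<phi> (P x \<kappa>)" if "\<kappa> \<in> A x"
    using that unfolding degree[OF assms] by (rule contr_eq_wedge)
qed

text \<open>The extension is 0 on all of \<open>Euclidean_space\<close>, which must contain the
  chart image; \<open>coords\<close> ensures this.\<close>

lemma smooth_fun_0: "smooth_fun N W (\<lambda>_. 0)"
  unfolding smooth_fun_def
proof (intro ballI, clarify)
  fix U h assume c: "(U, h) \<in> atlas N"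
  have "openin (Euclidean_space (mdim N)) (topspace (Euclidean_space (mdim N)))" by simp
  moreover have "h ` (U \<inter> W) \<subseteq> topspace (Euclidean_space (mdim N))"
    using coords[OF c] by (auto simp: topspace_Euclidean_space)
  ultimately show "smooth_in (mdim N) (h ` (U \<inter> W)) (\<lambda>y. 0)"
    unfolding smooth_in_def using Ck_on_const[of "mdim N"] by blast
qed

lemma smooth_fun_sum:
  assumes "finite I" "\<And>i. i \<in> I \<Longrightarrow> smooth_fun N W (f i)"
  shows "smooth_fun N W (\<lambda>x. \<Sum>i\<in>I. a i * f i x)"
  using assms
proof (induction I rule: finite_induct)
  case (insert i I)
  then show ?case using smooth_fun_comb[of N W "f i" "\<lambda>x. \<Sum>i\<in>I. a i * f i x" "a i" 1] by simp
qed (simp add: smooth_fun_0)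

text \<open>Injectivity of the chart makes \<open>inv_into U h\<close> return the point of
  \<open>W\<close> with the given coordinates.\<close>

lemma smooth_fun_cong:
  assumes f: "smooth_fun N W f" and eq: "\<And>x. x \<in> W \<Longrightarrow> f x = g x"
  shows "smooth_fun N W g"
  unfolding smooth_fun_def
proof (intro ballI, clarify)
  fix U h assume c: "(U, h) \<in> atlas N"
  have "f (inv_into U h y) = g (inv_into U h y)" if "y \<in> h ` (U \<inter> W)" for y
    using that inj[OF c] eq by (auto simp: inv_into_f_f)
  moreover have "smooth_in (mdim N) (h ` (U \<inter> W)) (\<lambda>y. f (inv_into U h y))"
    using f c unfolding smooth_fun_def by auto
  ultimately show "smooth_in (mdim N) (h ` (U \<inter> W)) (\<lambda>y. g (inv_into U h y))"
    unfolding smooth_in_def by (metis IntD2)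
qed

section \<open>Spaces of sections and the action of the bundle isomorphism on them\<close>

lemma Lambda_dualD:
  assumes "\<alpha> \<in> Lambda_dual N G s q"
  shows "x \<notin> topspace (mtop N) \<Longrightarrow> \<alpha> x = 0"
    "x \<in> topspace (mtop N) \<Longrightarrow> \<alpha> x \<in> mixed (T x) (fibre G x) s q"
    "c \<in> atlas N \<Longrightarrow> (U, n, \<tau>) \<in> trivs G \<Longrightarrow> I \<in> multi_idx (mdim N) s \<Longrightarrow> J \<in> multi_idx (mdim N) q \<Longrightarrow> a < n \<Longrightarrow>
     smooth_fun N (fst c \<inter> U) (\<lambda>x. \<alpha> x (map (coord_covec N c x) I) (map (coord_vec N c x) J) (frame G \<tau> x a))"
  using assms unfolding Lambda_dual_def by blast+

lemma Lambda_dualI: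
  assumes "\<And>x. x \<notin> topspace (mtop N) \<Longrightarrow> \<alpha> x = 0"
    "\<And>x. x \<in> topspace (mtop N) \<Longrightarrow> \<alpha> x \<in> mixed (T x) (fibre G x) s q"
    "\<And>c U n \<tau> I J a. c \<in> atlas N \<Longrightarrow> (U, n, \<tau>) \<in> trivs G \<Longrightarrow> I \<in> multi_idx (mdim N) s \<Longrightarrow>
      J \<in> multi_idx (mdim N) q \<Longrightarrow> a < n \<Longrightarrow>
     smooth_fun N (fst c \<inter> U) (\<lambda>x. \<alpha> x (map (coord_covec N c x) I) (map (coord_vec N c x) J) (frame G \<tau> x a))"
  shows "\<alpha> \<in> Lambda_dual N G s q"
  using assms unfolding Lambda_dual_def by blast

lemma Omega_dualD:
  assumes "\<beta> \<in> Omega_dual N G q"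
  shows "x \<notin> topspace (mtop N) \<Longrightarrow> \<beta> x = 0"
    "x \<in> topspace (mtop N) \<Longrightarrow> \<beta> x \<in> alt_maps (T x) q (dual_sp (fibre G x))"
    "c \<in> atlas N \<Longrightarrow> (U, n, \<tau>) \<in> trivs G \<Longrightarrow> J \<in> multi_idx (mdim N) q \<Longrightarrow> a < n \<Longrightarrow>
     smooth_fun N (fst c \<inter> U) (\<lambda>x. \<beta> x (map (coord_vec N c x) J) (frame G \<tau> x a))"
  using assms unfolding Omega_dual_def by blast+

lemma Omega_dualI:
  assumes "\<And>x. x \<notin> topspace (mtop N) \<Longrightarrow> \<beta> x = 0"
    "\<And>x. x \<in> topspace (mtop N) \<Longrightarrow> \<beta> x \<in> alt_maps (T x) q (dual_sp (fibre G x))"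
    "\<And>c U n \<tau> J a. c \<in> atlas N \<Longrightarrow> (U, n, \<tau>) \<in> trivs G \<Longrightarrow> J \<in> multi_idx (mdim N) q \<Longrightarrow> a < n \<Longrightarrow>
     smooth_fun N (fst c \<inter> U) (\<lambda>x. \<beta> x (map (coord_vec N c x) J) (frame G \<tau> x a))"
  shows "\<beta> \<in> Omega_dual N G q"
  using assms unfolding Omega_dual_def by blast

lemma subspace_Lambda_dual: "subspace (Lambda_dual N G s q)"
proof (rule subspaceI)
  show "0 \<in> Lambda_dual N G s q"
    by (rule Lambda_dualI) (simp_all add: subspace_0[OF subspace_mixed[OF subspace_fibre]] smooth_fun_0)
next
  fix \<alpha> \<beta> assume *: "\<alpha> \<in> Lambda_dual N G s q" "\<beta> \<in> Lambda_dual N G s q"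
  show "\<alpha> + \<beta> \<in> Lambda_dual N G s q"
  proof (rule Lambda_dualI)
    fix x assume x: "x \<in> topspace (mtop N)"
    have "\<alpha> x + \<beta> x \<in> mixed (T x) (fibre G x) s q"
      by (intro subspace_add subspace_mixed subspace_fibre Lambda_dualD(2) x *)
    then show "(\<alpha> + \<beta>) x \<in> mixed (T x) (fibre G x) s q"
      by (simp only: plus_fun_apply)
  next
    fix x assume "x \<notin> topspace (mtop N)"
    then show "(\<alpha> + \<beta>) x = 0" using Lambda_dualD(1)[OF *(1)] Lambda_dualD(1)[OF *(2)] by simp
  qed (unfold plus_fun_apply, intro smooth_fun_add Lambda_dualD(3)[OF *(1)] Lambda_dualD(3)[OF *(2)]; assumption)
next
  fix a \<alpha> assume *: "\<alpha> \<in> Lambda_dual N G s q"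
  show "a *\<^sub>R \<alpha> \<in> Lambda_dual N G s q"
  proof (rule Lambda_dualI)
    fix x assume x: "x \<in> topspace (mtop N)"
    have "a *\<^sub>R \<alpha> x \<in> mixed (T x) (fibre G x) s q"
      by (intro subspace_scale subspace_mixed subspace_fibre Lambda_dualD(2) x *)
    then show "(a *\<^sub>R \<alpha>) x \<in> mixed (T x) (fibre G x) s q"
      by (simp only: scaleR_fun_apply)
  next
    fix x assume "x \<notin> topspace (mtop N)"
    then show "(a *\<^sub>R \<alpha>) x = 0" using Lambda_dualD(1)[OF *] by simp
  qed (unfold scaleR_fun_apply real_scaleR_def, intro smooth_fun_scale Lambda_dualD(3)[OF *]; assumption)
qed

lemma subspace_Omega_dual: "subspace (Omega_dual N G q)"
proof (rule subspaceI)
  show "0 \<in> Omega_dual N G q"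
    by (rule Omega_dualI)
      (simp_all add: subspace_0[OF subspace_alt_maps[OF subspace_dual_sp[OF subspace_fibre]]] smooth_fun_0)
next
  fix \<alpha> \<beta> assume *: "\<alpha> \<in> Omega_dual N G q" "\<beta> \<in> Omega_dual N G q"
  show "\<alpha> + \<beta> \<in> Omega_dual N G q"
  proof (rule Omega_dualI)
    fix x assume x: "x \<in> topspace (mtop N)"
    have "\<alpha> x + \<beta> x \<in> alt_maps (T x) q (dual_sp (fibre G x))"
      by (intro subspace_add subspace_alt_maps subspace_dual_sp subspace_fibre Omega_dualD(2) x *)
    then show "(\<alpha> + \<beta>) x \<in> alt_maps (T x) q (dual_sp (fibre G x))"
      by (simp only: plus_fun_apply)
  next
    fix x assume "x \<notin> topspace (mtop N)"
    then show "(\<alpha> + \<beta>) x = 0" using Omega_dualD(1)[OF *(1)] Omega_dualD(1)[OF *(2)] by simp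
  qed (unfold plus_fun_apply, intro smooth_fun_add Omega_dualD(3)[OF *(1)] Omega_dualD(3)[OF *(2)]; assumption)
next
  fix a \<alpha> assume *: "\<alpha> \<in> Omega_dual N G q"
  show "a *\<^sub>R \<alpha> \<in> Omega_dual N G q"
  proof (rule Omega_dualI)
    fix x assume x: "x \<in> topspace (mtop N)"
    have "a *\<^sub>R \<alpha> x \<in> alt_maps (T x) q (dual_sp (fibre G x))"
      by (intro subspace_scale subspace_alt_maps subspace_dual_sp subspace_fibre Omega_dualD(2) x *)
    then show "(a *\<^sub>R \<alpha>) x \<in> alt_maps (T x) q (dual_sp (fibre G x))"
      by (simp only: scaleR_fun_apply)
  next
    fix x assume "x \<notin> topspace (mtop N)"
    then show "(a *\<^sub>R \<alpha>) x = 0" using Omega_dualD(1)[OF *] by simp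
  qed (unfold scaleR_fun_apply real_scaleR_def, intro smooth_fun_scale Omega_dualD(3)[OF *]; assumption)
qed

text \<open>By \<open>Phi_formula\<close>, component \<open>J\<close> of the image is the sum over
  \<open>I\<close> of the components of \<open>\<alpha>\<close> at \<open>I\<close> and
  \<open>I @ J\<close>, divided by \<open>fact k\<close>.\<close>

lemma Phi_in:
  assumes \<alpha>: "\<alpha> \<in> Lambda_dual N G (int k) r"
  shows "Phi N G k r \<alpha> \<in> Omega_dual N G (r - int k)"
proof (rule Omega_dualI)
  fix x assume x: "x \<in> topspace (mtop N)"
  show "Phi N G k r \<alpha> x \<in> B x"
    using x bij_betw_apply[OF fibrewise(1)[OF x] Lambda_dualD(2)[OF \<alpha> x]] by (simp add: Phi_def)
next
  fix c U n \<tau> J a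
  assume c: "c \<in> atlas N" and U: "(U, n, \<tau>) \<in> trivs G" and J: "J \<in> multi_idx (mdim N) (r - int k)" and a: "a < n"
  show "smooth_fun N (fst c \<inter> U) (\<lambda>x. Phi N G k r \<alpha> x (map (coord_vec N c x) J) (frame G \<tau> x a))"
  proof (rule smooth_fun_cong)
    show "smooth_fun N (fst c \<inter> U) (\<lambda>x. \<Sum>I\<in>multi_idx (mdim N) (int k). 1 / fact k *
        \<alpha> x (map (coord_covec N c x) I) (map (coord_vec N c x) (I @ J)) (frame G \<tau> x a))"
      using J by (intro smooth_fun_sum finite_multi_idx Lambda_dualD(3)[OF \<alpha> c U _ _ a]) (auto simp: multi_idx_def)
    fix x assume "x \<in> fst c \<inter> U"
    then have xc: "x \<in> fst c" and x: "x \<in> topspace (mtop N)" using c cover by auto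
    obtain nF f cf where "based_fibre (T x) (mdim N) (coord_vec N c x) (\<lambda>i v. v c i) (fibre G x) nF f cf"
      by (rule based_at[OF c xc])
    then interpret based_fibre "T x" "mdim N" "coord_vec N c x" "\<lambda>i v. v c i" "fibre G x" nF f cf .
    show "(\<Sum>I\<in>multi_idx (mdim N) (int k). 1 / fact k *
        \<alpha> x (map (coord_covec N c x) I) (map (coord_vec N c x) (I @ J)) (frame G \<tau> x a)) =
      Phi N G k r \<alpha> x (map (coord_vec N c x) J) (frame G \<tau> x a)"
      using x Lambda_dualD(2)[OF \<alpha> x]
      by (simp add: Phi_def Phi_fibre_eq Phi_formula_def sum_fun_apply dual_vec_coord_covec sum_distrib_left)
  qed
qed (simp add: Phi_def)

lemma Phi_inv_fibre:
  assumes "\<beta> \<in> Omega_dual N G (r - int k)" "x \<in> topspace (mtop N)"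
  shows "Phi_inv N G k r \<beta> x \<in> A x" "P x (Phi_inv N G k r \<beta> x) = \<beta> x"
proof -
  have "\<beta> x \<in> P x ` A x"
    using Omega_dualD(2)[OF assms] fibrewise(1)[OF assms(2)] by (simp add: bij_betw_def)
  then show "Phi_inv N G k r \<beta> x \<in> A x" "P x (Phi_inv N G k r \<beta> x) = \<beta> x"
    using assms(2) by (simp_all add: Phi_inv_def inv_into_into f_inv_into_f)
qed

text \<open>\<open>mixed_recover\<close> is evaluated at the coordinate coframe and frame. Their
  pairings are 0 or 1 at every point, so the determinants in it are constants, and the components
  are constant combinations of those of \<open>\<beta>\<close>.\<close>

lemma Phi_inv_in:
  assumes \<beta>: "\<beta> \<in> Omega_dual N G (r - int k)"
  shows "Phi_inv N G k r \<beta> \<in> Lambda_dual N G (int k) r"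
proof (rule Lambda_dualI)
  fix c U n \<tau> I J a
  assume c: "c \<in> atlas N" and U: "(U, n, \<tau>) \<in> trivs G" and I: "I \<in> multi_idx (mdim N) (int k)"
    and J: "J \<in> multi_idx (mdim N) r" and a: "a < n"
  let ?m = "mdim N"
  let ?h = "\<lambda>x. Phi_inv N G k r \<beta> x (map (coord_covec N c x) I) (map (coord_vec N c x) J) (frame G \<tau> x a)"
  \<comment> \<open>On an empty overlap \<open>degree\<close> says nothing about \<open>r\<close>;
    for \<open>?m < k\<close> the section vanishes on the overlap.\<close>
  consider "fst c \<inter> U = {}" | "fst c \<inter> U \<noteq> {}" "?m < k" | "fst c \<inter> U \<noteq> {}" "k \<le> ?m" by linarith
  then show "smooth_fun N (fst c \<inter> U) ?h"
  proof cases
    case 1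
    then show ?thesis by (intro smooth_fun_cong[OF smooth_fun_0]) auto
  next
    case 2
    have "Phi_inv N G k r \<beta> x = 0" if xU: "x \<in> fst c \<inter> U" for x
    proof -
      have xc: "x \<in> fst c" and x: "x \<in> topspace (mtop N)" using xU c cover by auto
      obtain nF f cf where "based_fibre (T x) ?m (coord_vec N c x) (\<lambda>i v. v c i) (fibre G x) nF f cf"
        by (rule based_at[OF c xc])
      then have "basis_on (T x) ?m (coord_vec N c x) (\<lambda>i v. v c i)" by (simp add: based_fibre_def)
      then show ?thesis
        using alt_maps_above_dim[OF basis_on_dual _ 2(2)] Phi_inv_fibre(1)[OF \<beta> x] unfolding mixed_def by blast
    qed
    then show ?thesis by (intro smooth_fun_cong[OF smooth_fun_0]) auto
  next
    case 3
    then obtain x0 where "x0 \<in> fst c" by auto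
    then have r: "r = int ?m" using degree c cover by auto
    have lJ: "length J = ?m" "set J \<subseteq> {..<?m}" using J r by (auto simp: multi_idx_def)
    \<comment> \<open>The determinant of the pairings of the coframe vectors \<open>I\<close> with
      the first \<open>k\<close> frame vectors of the permuted \<open>J\<close>.\<close>
    let ?d = "\<lambda>p. ndet k (\<lambda>i j. if I ! j = permute_list p J ! i then 1 else 0)"
    show ?thesis
    proof (rule smooth_fun_cong)
      show "smooth_fun N (fst c \<inter> U) (\<lambda>x. \<Sum>p | p permutes {..<?m}.
          (of_int (sign p) * ?d p / (fact k * fact (?m - k))) *
          \<beta> x (map (coord_vec N c x) (drop k (permute_list p J))) (frame G \<tau> x a))"
      proof (intro smooth_fun_sum finite_permutations finite_lessThan Omega_dualD(3)[OF \<beta> c U _ a])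
        fix p assume "p \<in> {p. p permutes {..<?m}}"
        then have "set (drop k (permute_list p J)) \<subseteq> {..<?m}"
          using lJ set_permute_list[of p J] set_drop_subset[of k "permute_list p J"] by auto
        then show "drop k (permute_list p J) \<in> multi_idx ?m (r - int k)"
          using lJ r 3(2) by (simp add: multi_idx_def)
      qed
      fix x assume "x \<in> fst c \<inter> U"
      then have xc: "x \<in> fst c" and x: "x \<in> topspace (mtop N)" using c cover by auto
      obtain nF f cf where "based_fibre (T x) ?m (coord_vec N c x) (\<lambda>i v. v c i) (fibre G x) nF f cf"
        by (rule based_at[OF c xc])
      then interpret based_fibre "T x" ?m "coord_vec N c x" "\<lambda>i v. v c i" "fibre G x" nF f cf .
      let ?e = "coord_vec N c x" and ?\<epsilon> = "coord_covec N c x"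
      note \<kappa> = Phi_inv_fibre[OF \<beta> x]
      have "?h x = (\<Sum>p | p permutes {..<?m}. of_int (sign p) *
          ndet k (\<lambda>i j. (map ?\<epsilon> I ! j) (permute_list p (map ?e J) ! i)) *
          \<beta> x (drop k (permute_list p (map ?e J))) (frame G \<tau> x a)) / (fact k * fact (?m - k))"
      proof -
        have "set (map ?\<epsilon> I) \<subseteq> dual_sp (T x)" "length (map ?\<epsilon> I) = k"
          using multi_idx_map_subset[OF basis_on_dual[OF S] I] multi_idx_length[OF I]
          by (simp_all only: dual_vec_coord_covec length_map)
        moreover have "set (map ?e J) \<subseteq> T x" "length (map ?e J) = ?m"
          using multi_idx_map_subset[OF S J] lJ by simp_all
        ultimately show ?thesis
          using mixed_recover[OF \<kappa>(1)[unfolded r], of "map ?\<epsilon> I" "map ?e J" "frame G \<tau> x a"] 3(2) \<kappa>(2) r by simp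
      qed
      also have "\<dots> = (\<Sum>p | p permutes {..<?m}. of_int (sign p) * ?d p *
          \<beta> x (map ?e (drop k (permute_list p J))) (frame G \<tau> x a)) / (fact k * fact (?m - k))"
      proof (intro arg_cong2[where f = "(/)"] sum.cong refl)
        fix p assume "p \<in> {p. p permutes {..<?m}}"
        then have p: "p permutes {..<length J}" using lJ by simp
        have "(map ?\<epsilon> I ! j) (permute_list p (map ?e J) ! i) = (if I ! j = permute_list p J ! i then 1 else 0)"
          if ij: "i < k" "j < k" for i j
        proof -
          have len: "j < length I" "i < length (permute_list p J)"
            using ij multi_idx_length[OF I] lJ 3(2) by auto
          have I': "I ! j < ?m" using I len(1) by (auto simp: multi_idx_def subset_iff)
          have "permute_list p J ! i \<in> set J" using nth_mem[OF len(2)] set_permute_list[OF p] by simp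
          then have J': "permute_list p J ! i < ?m" using lJ by auto
          have "?\<epsilon> (I ! j) (?e (permute_list p J ! i)) = (if I ! j = permute_list p J ! i then 1 else 0)"
            using basis_onD(2,5)[OF S] I' J' by (simp add: coord_covec_def)
          then show ?thesis using len by (simp add: permute_list_map[OF p])
        qed
        then have "ndet k (\<lambda>i j. (map ?\<epsilon> I ! j) (permute_list p (map ?e J) ! i)) = ?d p"
          by (rule ndet_cong)
        then show "of_int (sign p) * ndet k (\<lambda>i j. (map ?\<epsilon> I ! j) (permute_list p (map ?e J) ! i)) *
            \<beta> x (drop k (permute_list p (map ?e J))) (frame G \<tau> x a) =
          of_int (sign p) * ?d p * \<beta> x (map ?e (drop k (permute_list p J))) (frame G \<tau> x a)"
          by (simp only: permute_list_map[OF p] drop_map)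
      qed
      finally show "(\<Sum>p | p permutes {..<?m}. (of_int (sign p) * ?d p / (fact k * fact (?m - k))) *
          \<beta> x (map ?e (drop k (permute_list p J))) (frame G \<tau> x a)) = ?h x"
        by (simp add: sum_divide_distrib)
    qed
  qed
qed (simp_all add: Phi_inv_fibre[OF \<beta>], simp add: Phi_inv_def)

lemma Phi_Phi_inv:
  assumes "\<beta> \<in> Omega_dual N G (r - int k)"
  shows "Phi N G k r (Phi_inv N G k r \<beta>) = \<beta>"
proof
  fix x
  show "Phi N G k r (Phi_inv N G k r \<beta>) x = \<beta> x"
    using Phi_inv_fibre(2)[OF assms, of x] Omega_dualD(1)[OF assms, of x] by (simp add: Phi_def)
qed

lemma Phi_inv_Phi:
  assumes "\<alpha> \<in> Lambda_dual N G (int k) r"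
  shows "Phi_inv N G k r (Phi N G k r \<alpha>) = \<alpha>"
proof
  fix x
  show "Phi_inv N G k r (Phi N G k r \<alpha>) x = \<alpha> x"
  proof (cases "x \<in> topspace (mtop N)")
    case True
    then show ?thesis
      using inv_into_f_f[OF bij_betw_imp_inj_on[OF fibrewise(1)[OF True]] Lambda_dualD(2)[OF assms True]]
      by (simp add: Phi_def Phi_inv_def)
  next
    case False
    then show ?thesis using Lambda_dualD(1)[OF assms False] by (simp add: Phi_inv_def)
  qed
qed

lemma Phi_linear: "linear_on (Lambda_dual N G (int k) r) (Phi N G k r)"
proof (rule linear_onI, rule ext)
  fix \<alpha> \<alpha>' a b x assume *: "\<alpha> \<in> Lambda_dual N G (int k) r" "\<alpha>' \<in> Lambda_dual N G (int k) r"
  show "Phi N G k r (a *\<^sub>R \<alpha> + b *\<^sub>R \<alpha>') x = (a *\<^sub>R Phi N G k r \<alpha> + b *\<^sub>R Phi N G k r \<alpha>') x"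
  proof (cases "x \<in> topspace (mtop N)")
    case True
    show ?thesis
      using linear_onD[OF fibrewise(2)[OF True] Lambda_dualD(2)[OF *(1) True] Lambda_dualD(2)[OF *(2) True]] True
      by (simp only: Phi_def plus_fun_apply scaleR_fun_apply if_True)
  qed (simp add: Phi_def)
qed

text \<open>\<open>Phi\<close> maps the combination of the preimages to the combination of the
  forms, and \<open>Phi_inv\<close> undoes \<open>Phi\<close>.\<close>

lemma Phi_inv_linear: "linear_on (Omega_dual N G (r - int k)) (Phi_inv N G k r)"
proof (rule linear_onI)
  fix \<beta> \<beta>' a b assume *: "\<beta> \<in> Omega_dual N G (r - int k)" "\<beta>' \<in> Omega_dual N G (r - int k)"
  let ?\<alpha> = "a *\<^sub>R Phi_inv N G k r \<beta> + b *\<^sub>R Phi_inv N G k r \<beta>'"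
  have "Phi N G k r ?\<alpha> = a *\<^sub>R \<beta> + b *\<^sub>R \<beta>'"
    using linear_onD[OF Phi_linear Phi_inv_in[OF *(1)] Phi_inv_in[OF *(2)]] by (simp add: Phi_Phi_inv *)
  moreover have "?\<alpha> \<in> Lambda_dual N G (int k) r"
    by (intro subspace_comb subspace_Lambda_dual Phi_inv_in *)
  ultimately show "Phi_inv N G k r (a *\<^sub>R \<beta> + b *\<^sub>R \<beta>') = ?\<alpha>"
    using Phi_inv_Phi by metis
qed

lemma Phi_iso: "linear_iso_on (Lambda_dual N G (int k) r) (Omega_dual N G (r - int k)) (Phi N G k r)"
  unfolding linear_iso_on_def
  using subspace_Lambda_dual subspace_Omega_dual Phi_linear
    bij_betw_byWitness[of _ "Phi_inv N G k r" "Phi N G k r"] Phi_in Phi_inv_in Phi_Phi_inv Phi_inv_Phi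
  by (simp add: image_subset_iff)

lemma Phi_inv_iso: "linear_iso_on (Omega_dual N G (r - int k)) (Lambda_dual N G (int k) r) (Phi_inv N G k r)"
  unfolding linear_iso_on_def
  using subspace_Lambda_dual subspace_Omega_dual Phi_inv_linear
    bij_betw_byWitness[of _ "Phi N G k r" "Phi_inv N G k r"] Phi_in Phi_inv_in Phi_Phi_inv Phi_inv_Phi
  by (simp add: image_subset_iff)

text \<open>The integrands agree at each point by \<open>fibrewise\<close>. The family
  \<open>\<phi>\<close> is arbitrary, so the pullback to the boundary is covered.\<close>

lemma integral_Phi:
  assumes "\<alpha> \<in> Lambda_dual N G (int k) r"
  shows "mfd_integral N (\<lambda>x. wedge (T x) (fibre G x) k (r - int k) (\<phi> x) (Phi N G k r \<alpha> x)) =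
    mfd_integral N (\<lambda>x. contr (T x) (fibre G x) k r (\<alpha> x) (\<phi> x))"
proof (rule mfd_integral_cong)
  fix c x assume "c \<in> atlas N" "x \<in> fst c"
  then have x: "x \<in> topspace (mtop N)" using cover by auto
  show "wedge (T x) (fibre G x) k (r - int k) (\<phi> x) (Phi N G k r \<alpha> x) = contr (T x) (fibre G x) k r (\<alpha> x) (\<phi> x)"
    using fibrewise(3)[OF x Lambda_dualD(2)[OF assms x]] x by (simp add: Phi_def)
qed

end

text \<open>A trivialisation at \<open>x\<close> carries the unit vectors and coordinates of
  Euclidean space over to the fibre.\<close>

lemma vector_bundle_basis:
  assumes E: "vector_bundle M E" and x: "x \<in> topspace (mtop M)"
  shows "\<exists>nF f cf. basis_on (fibre E x) nF f cf"
proof -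
  note E' = E[unfolded vector_bundle_def]
  note sub_all = conjunct1[OF E'] and top = conjunct1[OF conjunct2[OF E']]
    and triv = conjunct1[OF conjunct2[OF conjunct2[OF E']]]
  obtain U n \<tau> where t: "(U, n, \<tau>) \<in> trivs E" "x \<in> U"
    using x unfolding top by auto
  let ?F = "fibre E x"
  have sub: "subspace ?F" using bspec[OF sub_all x] .
  have lin: "linear_on ?F (\<tau> x)" and bij: "bij_betw (\<tau> x) ?F (topspace (Euclidean_space n))"
    using bspec[OF triv t(1)] t(2) by simp_all
  have unit: "unit_vec a \<in> \<tau> x ` ?F" if "a < n" for a
    using bij that unfolding bij_betw_def by (auto simp: topspace_Euclidean_space unit_vec_def)
  have f: "frame E \<tau> x a \<in> ?F" "\<tau> x (frame E \<tau> x a) = unit_vec a" if "a < n" for a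
    unfolding frame_def using inv_into_into[OF unit[OF that]] f_inv_into_f[OF unit[OF that]] by auto
  have "(\<Sum>a<n. \<tau> x \<xi> a *\<^sub>R frame E \<tau> x a) = \<xi>" if \<xi>: "\<xi> \<in> ?F" for \<xi>
  proof (rule inj_onD[OF bij_betw_imp_inj_on[OF bij] _ _ \<xi>])
    show "(\<Sum>a<n. \<tau> x \<xi> a *\<^sub>R frame E \<tau> x a) \<in> ?F"
      using f by (intro subspace_sum subspace_scale sub) auto
    have "\<tau> x (\<Sum>a<n. \<tau> x \<xi> a *\<^sub>R frame E \<tau> x a) = (\<Sum>a<n. \<tau> x \<xi> a *\<^sub>R unit_vec a)"
      using f by (subst linear_on_sum[OF sub lin]) auto
    also have "\<dots> = \<tau> x \<xi>"
    proof
      fix l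
      have "(\<Sum>a<n. \<tau> x \<xi> a *\<^sub>R unit_vec a) l = (\<Sum>a<n. if a = l then \<tau> x \<xi> l else 0)"
        unfolding sum_fun_apply by (intro sum.cong) (auto simp: unit_vec_def)
      moreover have "\<tau> x \<xi> l = 0" if "n \<le> l"
        using bij_betw_apply[OF bij \<xi>] that by (simp add: topspace_Euclidean_space)
      ultimately show "(\<Sum>a<n. \<tau> x \<xi> a *\<^sub>R unit_vec a) l = \<tau> x \<xi> l" by auto
    qed
    finally show "\<tau> x (\<Sum>a<n. \<tau> x \<xi> a *\<^sub>R frame E \<tau> x a) = \<tau> x \<xi>" .
  qed
  moreover have "linear_on ?F (\<lambda>\<xi>. \<tau> x \<xi> a)" for a
    by (rule linear_on_compose[OF lin linear_on_apply[of UNIV]]) simp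
  ultimately have "basis_on ?F n (frame E \<tau> x) (\<lambda>a \<xi>. \<tau> x \<xi> a)"
    unfolding basis_on_def using sub f by (auto simp: unit_vec_def)
  then show ?thesis by blast
qed

lemma linear_iso_on_Times:
  assumes "linear_iso_on V W f" "linear_iso_on V' W' g"
  shows "linear_iso_on (V \<times> V') (W \<times> W') (\<lambda>(x, y). (f x, g y))"
proof -
  have f: "subspace V" "subspace W" "linear_on V f" "bij_betw f V W"
    and g: "subspace V'" "subspace W'" "linear_on V' g" "bij_betw g V' W'"
    using assms unfolding linear_iso_on_def by blast+
  have "linear_on (V \<times> V') (\<lambda>(x, y). (f x, g y))"
  proof (rule linear_onI)
    fix p q a b assume pq: "p \<in> V \<times> V'" "q \<in> V \<times> V'"
    obtain x y where p: "p = (x, y)" by (cases p)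
    obtain x' y' where q: "q = (x', y')" by (cases q)
    have "x \<in> V" "y \<in> V'" "x' \<in> V" "y' \<in> V'" using pq unfolding p q by blast+
    then show "(case a *\<^sub>R p + b *\<^sub>R q of (x, y) \<Rightarrow> (f x, g y)) =
        a *\<^sub>R (case p of (x, y) \<Rightarrow> (f x, g y)) + b *\<^sub>R (case q of (x, y) \<Rightarrow> (f x, g y))"
      unfolding p q scaleR_Pair add_Pair prod.case
      by (simp only: linear_onD[OF f(3)] linear_onD[OF g(3)])
  qed
  moreover have "bij_betw (\<lambda>(x, y). (f x, g y)) (V \<times> V') (W \<times> W')"
    using bij_betw_map_prod[OF f(4) g(4)] unfolding map_prod_def .
  ultimately show ?thesis
    unfolding linear_iso_on_def by (intro conjI subspace_Times f g)
qed

section \<open>The manifold and its boundary as instances, and the conclusion\<close>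

context smooth_mfd
begin

lemma bundle_on_M:
  assumes "vector_bundle M E" shows "bundle_on_mfd M E (int m)"
proof
  show "topspace (mtop M) = (\<Union>c\<in>atlas M. fst c)" by (rule topspace_charts)
  show "inj_on (snd c) (fst c)" if "c \<in> atlas M" for c
    using that by (rule chart_inj)
  show "snd c x i = 0" if "c \<in> atlas M" "x \<in> fst c" "m \<le> i" for c x i
    using that by (rule chart_sub)
  show "basis_on (tangent_space M x) m (coord_vec M c x) (\<lambda>i v. v c i)" if "c \<in> charts_at M x" for c x
    using that by (rule tangent_basis_M)
  show "\<exists>nF f cf. basis_on (fibre E x) nF f cf" if "x \<in> topspace (mtop M)" for x
    using that by (rule vector_bundle_basis[OF assms])
qed simp

lemma bundle_on_bdry:
  assumes "vector_bundle M E" shows "bundle_on_mfd (bdry M) (bdry_bundle M E) (int m - 1)"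
proof
  have top: "topspace (mtop (bdry M)) = topspace (mtop M) \<inter> bdry_points M" by (simp add: bdry_def)
  have at: "atlas (bdry M) = bdry_chart M ` atlas M" by (simp add: bdry_def)
  show "topspace (mtop (bdry M)) = (\<Union>c\<in>atlas (bdry M). fst c)"
    unfolding top at topspace_charts by auto
  show "inj_on (snd c) (fst c)" if "c \<in> atlas (bdry M)" for c
    using that bdry_chart_inj unfolding at by blast
  show "snd c x i = 0" if "c \<in> atlas (bdry M)" "x \<in> fst c" "mdim (bdry M) \<le> i" for c x i
    using that chart_sub unfolding at mdim_bdry by auto
  show "basis_on (tangent_space (bdry M) x) (mdim (bdry M)) (coord_vec (bdry M) c x) (\<lambda>i v. v c i)"
    if "c \<in> charts_at (bdry M) x" for c x
    using that by (rule tangent_basis_bdry)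
  show "\<exists>nF f cf. basis_on (fibre (bdry_bundle M E) x) nF f cf" if "x \<in> topspace (mtop (bdry M))" for x
    using vector_bundle_basis[OF assms, of x] that unfolding top restrict_bundle_def select_convs by (elim IntE) simp
  \<comment> \<open>A boundary point exists only if the dimension is positive, so the truncated
    subtraction in \<open>bdry\<close> is exact here.\<close>
  show "int m - 1 = int (mdim (bdry M))" if "x \<in> topspace (mtop (bdry M))" for x
    using that unfolding top mdim_bdry bdry_points_def by auto
qed

end

theorem proposition2p5:
  fixes M :: "'a mfd" and E :: "('a, 'f::real_vector) vbundle" and m k :: nat
  assumes "compact_oriented_manifold M" and "mdim M = m"
    and "vector_bundle M E"
    and "k \<le> m"
  shows "linear_iso_on (V_star M E k) (V_dagger M E k) (star_to_dagger M E k) \<and>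
    linear_iso_on (V_dagger M E k) (V_star M E k) (dagger_to_star M E k) \<and>
    (\<forall>a\<in>V_star M E k. dagger_to_star M E k (star_to_dagger M E k a) = a) \<and>
    (\<forall>b\<in>V_dagger M E k. star_to_dagger M E k (dagger_to_star M E k b) = b) \<and>
    (\<forall>a\<in>V_star M E k. Psi_dagger M E k (star_to_dagger M E k a) = Psi_star M E k a) \<and>
    (\<forall>b\<in>V_dagger M E k. Psi_star M E k (dagger_to_star M E k b) = Psi_dagger M E k b)"
proof -
  interpret smooth: smooth_mfd M
    by unfold_locales (use assms(1) in \<open>simp add: compact_oriented_manifold_def\<close>)
  interpret I: bundle_on_mfd M E "int m" k
    unfolding assms(2)[symmetric] by (rule smooth.bundle_on_M[OF assms(3)])
  interpret J: bundle_on_mfd "bdry M" "bdry_bundle M E" "int m - 1" k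
    unfolding assms(2)[symmetric] by (rule smooth.bundle_on_bdry[OF assms(3)])
  have fib: "fibre (bdry_bundle M E) = fibre E" by (simp add: restrict_bundle_def)
  \<comment> \<open>The locale subtracts \<open>k\<close> from the boundary dimension, whereas
    \<open>V_dagger\<close> writes the same degree in another order.\<close>
  have deg: "int m - 1 - int k = int m - int k - 1" by simp
  note J = J.Phi_iso J.Phi_inv_iso J.Phi_in J.Phi_inv_in J.Phi_Phi_inv J.Phi_inv_Phi J.integral_Phi
  note J' = J[unfolded deg fib]
  have star: "linear_iso_on (V_star M E k) (V_dagger M E k) (star_to_dagger M E k)"
    unfolding V_star_def V_dagger_def star_to_dagger_def assms(2)
    by (rule linear_iso_on_Times[OF I.Phi_iso J'(1)])
  have dagger: "linear_iso_on (V_dagger M E k) (V_star M E k) (dagger_to_star M E k)"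
    unfolding V_star_def V_dagger_def dagger_to_star_def assms(2)
    by (rule linear_iso_on_Times[OF I.Phi_inv_iso J'(2)])
  have inv1: "dagger_to_star M E k (star_to_dagger M E k a) = a" if "a \<in> V_star M E k" for a
    using that I.Phi_inv_Phi J'(6)
    unfolding V_star_def dagger_to_star_def star_to_dagger_def assms(2) by (elim SigmaE) simp
  have inv2: "star_to_dagger M E k (dagger_to_star M E k b) = b" if "b \<in> V_dagger M E k" for b
    using that I.Phi_Phi_inv J'(5)
    unfolding V_dagger_def dagger_to_star_def star_to_dagger_def assms(2) by (elim SigmaE) simp
  have psi: "Psi_dagger M E k (star_to_dagger M E k a) = Psi_star M E k a" if a: "a \<in> V_star M E k" for a
  proof -
    obtain \<alpha> \<alpha>b where a': "a = (\<alpha>, \<alpha>b)" "\<alpha> \<in> Lambda_dual M E (int k) (int m)"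
      "\<alpha>b \<in> Lambda_dual (bdry M) (bdry_bundle M E) (int k) (int m - 1)"
      using a unfolding V_star_def assms(2) by (elim SigmaE) (rule that)
    have "pairing_dagger M E k (star_to_dagger M E k a) \<phi> = pairing_star M E k a \<phi>" for \<phi>
      unfolding pairing_dagger_def pairing_star_def star_to_dagger_def assms(2) a'(1) prod.case
        I.integral_Phi[OF a'(2)] J'(7)[OF a'(3)] ..
    then show ?thesis unfolding Psi_dagger_def Psi_star_def by (simp only: restrict_def)
  qed
  have "Psi_star M E k (dagger_to_star M E k b) = Psi_dagger M E k b" if b: "b \<in> V_dagger M E k" for b
  proof -
    have "dagger_to_star M E k b \<in> V_star M E k"
      using dagger b unfolding linear_iso_on_def by (blast intro: bij_betw_apply)
    \<comment> \<open>The second identity is the first one at \<open>dagger_to_star M E k b\<close>,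
      whose image is \<open>b\<close>.\<close>
    from psi[OF this] show ?thesis unfolding inv2[OF b] ..
  qed
  then show ?thesis using star dagger inv1 inv2 psi by (intro conjI ballI)
qed

end
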